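(* In the setting described in the context (with $Q_t\succ0$, $R_t\succ 0$ for $t=0,\dots,N$), define matrices backward in time by $$\mathcal{Q}_N = \mathcal{C}^T \mathcal{F}_N \mathcal{C} - \mathcal{C}^T \mathcal{F}_N \mathcal{D} \left(\mathcal{D}^T\mathcal{F}_N\mathcal{D}\right)^\dagger \mathcal{D}^T\mathcal{F}_N\mathcal{C},$$ and, for $t=N-1,\dots,0$, $$\mathcal{Q}_t = \mathcal{C}^T\mathcal{F}_t\mathcal{C} + \mathcal{A}^T\mathcal{Q}_{t+1}\mathcal{A} - \left(\mathcal{D}^T \mathcal{F}_t \mathcal{C} + \mathcal{B}^T\mathcal{Q}_{t+1}\mathcal{A}\right)^T\left(\mathcal{D}^T \mathcal{F}_t \mathcal{D} + \mathcal{B}^T\mathcal{Q}_{t+1}\mathcal{B}\right)^{-1}\left(\mathcal{D}^T \mathcal{F}_t \mathcal{C} + \mathcal{B}^T\mathcal{Q}_{t+1}\mathcal{A}\right).$$ Then an attack sequence $e_0,\dots,e_N$ that minimizes $$J = \mathbb{E} \Big[\sum_{t=0}^N (x_t-x^* )^T Q_t (x_t-x^* ) + (\nu_t^e)^TR_t\nu_t^e \Big]$$ over all admissible attack sequences is $$e_N = -\left(\mathcal{D}^T \mathcal{F}_N \mathcal{D}\right)^\dagger\mathcal{D}^T \mathcal{F}_N\left(\mathcal{C} \xi_N + \mathcal{M}\nu_N\right),$$ $$e_t = -\left(\mathcal{D}^T \mathcal{F}_t \mathcal{D} + \mathcal{B}^T\mathcal{Q}_{t+1}\mathcal{B}\right)^{-1}\left(\left(\mathcal{D}^T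 \mathcal{F}_t \mathcal{C}+ \mathcal{B}^T\mathcal{Q}_{t+1}\mathcal{A}\right)\xi_t+ \mathcal{D}^T\mathcal{F}_t \mathcal{M} \nu_t\right),\quad t=0,\dots,N-1.$$
   Context: Notation: $M^\dagger$ is the Moore-Penrose pseudoinverse; $S\succ0$ ($S\succeq 0$) means symmetric positive (semi)definite. System. $x_{t+1}=Ax_t+Bu_t+\Gamma e_t+w_t$, $y_t=Cx_t+\Psi e_t+v_t$, with $x_t\in\mathbb{R}^n$, $u_t\in\mathbb{R}^m$, attack $e_t\in\mathbb{R}^s$, $y_t\in\mathbb{R}^p$. The noises $w_t$ are i.i.d. $\mathcal N(0,\Sigma_w)$, $v_t$ are i.i.d. $\mathcal N(0,\Sigma_v)$, $\Sigma_w,\Sigma_v\succ0$, mutually independent and independent of the Gaussian initial state. $(A,C)$ is observable, $(A,B)$ controllable, $\begin{bmatrix}\Gamma\\ \Psi\end{bmatrix}$ is injective, and $L$ is such that $A+BL$ is stable (Schur). The system has been running since $t=-\infty$, with $e_t=0$ for $t<0$, so its Kalman filter is in steady state: $P=APA^T+\Sigma_w-APC^T(CPC^T+\Sigma_v)^{-1}CPA^T$, $\Sigma_\nu=CPC^T+\Sigma_v$, $K=PC^T\Sigma_\nu^{-1}$. At time $0$, $\widehat x_{0|-1}$ denotes the conditional mean of $x_0$ given the pre-attack outputs $(y_s)_{s<0}$; $x_0-\widehat x_{0|-1}\sim\mathcal N(0,P)$ is independent of the pre-attack outputs; $\widehat x_{0|-1}\sim\mathcal N(0,\Sigma_0)$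 with $\Sigma_0=(A+BL)(\Sigma_0+K\Sigma_\nu K^T)(A+BL)^T$; $(w_t,v_t)_{t\ge0}$ are independent of all of these. System's filter and controller (which ignore the attack), for $t=0,\dots,N$: $\widehat x^e_{0|-1}=\widehat x_{0|-1}$, $\nu_t^e=y_t-C\widehat x^e_{t|t-1}$, $\widehat x^e_t=\widehat x^e_{t|t-1}+K\nu^e_t$, $u_t=L\widehat x^e_t$, $\widehat x^e_{t+1|t}=(A+BL)\widehat x^e_t$. The superscript $0$ (e.g. $\widehat x_t^0,\nu_t^0$) denotes the same quantities on the same noise and initial-state realization when $e_0=e_1=\dots=0$. Attacker. Let $\widetilde y_t=Cx_t+v_t$. The attacker knows the model (including $L,\Gamma,\Psi$), the pre-attack outputs, and at time $t$ the information set $\mathcal I_t$, where $\mathcal I_0=\{\widetilde y_0\}$, $\mathcal I_{t+1}=\{\mathcal I_t,\widetilde y_{t+1},e_t\}$ (conditioning on $\mathcal I_t$ is understood to include the pre-attack outputs). An attack sequence $e_0,\dots,e_N$ is admissible if each $e_t$ is a (measurable) function of the attacker's information at time $t$. The attacker's Kalman filter is $\nu_t=\widetilde y_t-C\widehat x_{t|t-1}$, $\widehat x_t=\widehat x_{t|t-1}+K\nu_t$, $\widehat x_{t+1|t}=A\widehat x_t+Bu_t+\Gamma e_t$ (so $\widehat x_t=\mathbb E[x_t|\mathcal I_t]$). $N\ge 0$ and the target state $x^*\in\mathbb R^n$ are fixed. Attack-effect state. $\theta_t\in\mathbb R^{3n}$ is defined by $\theta_0=0$, $\theta_{t+1}=\widehat{\mathcal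 A}\theta_t+\widehat{\mathcal B}e_t$, with $$\widehat{\mathcal A}=\begin{bmatrix}(I_n-KC)A+BL & KC & KC \\ A B L & A & 0 \\ 0 & 0 & A\end{bmatrix},\ \widehat{\mathcal B}=\begin{bmatrix}K\Psi \\ 0 \\ \Gamma\end{bmatrix},\ \widehat{\mathcal C}=\begin{bmatrix}-CA & C & C\end{bmatrix}.$$ Augmented quantities. $\xi_t=(\widehat x_t;\theta_t;\widehat x^0_t;x^* )\in\mathbb R^{6n}$ (stacked column), $\Omega=\begin{bmatrix}(I_n-KC)A+BL & KC & KC\end{bmatrix}$, $$\mathcal A=\begin{bmatrix}A & BL\Omega & BL & 0 \\ 0 & \widehat{\mathcal A} & 0 & 0 \\ 0 & 0 & A+BL & 0 \\ 0 & 0 & 0 & I_n\end{bmatrix},\ \mathcal B=\begin{bmatrix}\Gamma+BLK\Psi \\ \widehat{\mathcal B} \\ 0 \\ 0\end{bmatrix},$$ $$\mathcal H=\begin{bmatrix}I_n & 0 & 0 & -I_n\end{bmatrix},\ \widetilde{\mathcal C}=\begin{bmatrix}0 & \widehat{\mathcal C} & 0 & 0\end{bmatrix},\ \mathcal C=\begin{bmatrix}\mathcal H \\ \widetilde{\mathcal C}\end{bmatrix},\ \mathcal D=\begin{bmatrix}0 \\ \Psi\end{bmatrix},\ \mathcal M=\begin{bmatrix}0 \\ I_p\end{bmatrix},\ \mathcal F_t=\begin{bmatrix}Q_t & 0 \\ 0 & R_t\end{bmatrix},$$ where $Q_t\in\mathbb R^{n\times n}$ and $R_t\in\mathbb R^{p\times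 p}$ are symmetric positive definite for $t=0,\dots,N$. *)

theory Defs
  imports "HOL-Probability.Probability"
begin

section \<open>Matrices\<close>

text \<open>
  Block vectors and matrices are indexed by sum types. Since a matrix is a vector of rows,
  vertical stacking of matrices and stacking of column vectors are the same operation.
\<close>

definition vcat :: "'c ^ 'a::finite \<Rightarrow> 'c ^ 'b::finite \<Rightarrow> 'c ^ ('a + 'b)"  (infixr "<'/>" 55)
  where "u </> v = (\<chi> i. case i of Inl a \<Rightarrow> u $ a | Inr b \<Rightarrow> v $ b)"

definition hcat :: "'c ^ 'a::finite ^ 'r::finite \<Rightarrow> 'c ^ 'b::finite ^ 'r \<Rightarrow> 'c ^ ('a + 'b) ^ 'r"
    (infixr "<|>" 60)
  where "U <|> V = (\<chi> i. U $ i </> V $ i)"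

definition qform :: "real ^ 'n ^ 'n \<Rightarrow> real ^ 'n::finite \<Rightarrow> real"
  where "qform S x = x \<bullet> (S *v x)"

definition posdef :: "real ^ 'n ^ 'n::finite \<Rightarrow> bool"
  where "posdef S \<longleftrightarrow> transpose S = S \<and> (\<forall>x. x \<noteq> 0 \<longrightarrow> qform S x > 0)"

definition possemidef :: "real ^ 'n ^ 'n::finite \<Rightarrow> bool"
  where "possemidef S \<longleftrightarrow> transpose S = S \<and> (\<forall>x. qform S x \<ge> 0)"

text \<open>The Moore-Penrose pseudoinverse, by the four Penrose equations.\<close>

definition is_pinv :: "real ^ 'n::finite ^ 'm::finite \<Rightarrow> real ^ 'm ^ 'n \<Rightarrow> bool"
  where "is_pinv M X \<longleftrightarrow>
    M ** X ** M = M \<and> X ** M ** X = X \<and>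
    transpose (M ** X) = M ** X \<and> transpose (X ** M) = X ** M"

lemma is_pinv_unique:
  assumes "is_pinv M X" "is_pinv M Y"
  shows "X = Y"
proof -
  have X: "M ** X ** M = M" "X ** M ** X = X"
      "transpose (M ** X) = M ** X" "transpose (X ** M) = X ** M"
    and Y: "M ** Y ** M = M" "Y ** M ** Y = Y"
      "transpose (M ** Y) = M ** Y" "transpose (Y ** M) = Y ** M"
    using assms by (auto simp: is_pinv_def)
  have "M ** X = transpose (M ** Y ** M ** X)"
    using X(3) Y(1) by simp
  also have "\<dots> = transpose (M ** X) ** transpose (M ** Y)"
    by (metis matrix_mul_assoc matrix_transpose_mul)
  also have "\<dots> = M ** Y"
    using X(1,3) Y(3) by (metis matrix_mul_assoc)
  finally have 1: "M ** X = M ** Y" .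
  have "X ** M = transpose (X ** M ** Y ** M)"
    using X(4) Y(1) by (metis matrix_mul_assoc)
  also have "\<dots> = transpose (Y ** M) ** transpose (X ** M)"
    by (metis matrix_mul_assoc matrix_transpose_mul)
  also have "\<dots> = Y ** M"
    using X(1,4) Y(4) by (metis matrix_mul_assoc)
  finally have 2: "X ** M = Y ** M" .
  show "X = Y"
    using 1 2 X(2) Y(2) by (metis matrix_mul_assoc)
qed

definition pinv :: "real ^ 'n::finite ^ 'm::finite \<Rightarrow> real ^ 'm ^ 'n"
  where "pinv M = (THE X. is_pinv M X)"

text \<open>The power operation on the vector type is componentwise, hence a separate matrix power.\<close>

primrec matpow :: "real ^ 'n ^ 'n::finite \<Rightarrow> nat \<Rightarrow> real ^ 'n ^ 'n"
  where
    "matpow A 0 = mat 1"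
  | "matpow A (Suc k) = A ** matpow A k"

text \<open>
  Kalman rank conditions: the columns of \<open>[B, A B, \<dots>, A\<^sup>n\<^sup>-\<^sup>1 B]\<close>, respectively the rows of
  \<open>[C; C A; \<dots>; C A\<^sup>n\<^sup>-\<^sup>1]\<close>, span the state space.
\<close>

definition controllable :: "real ^ 'n ^ 'n::finite \<Rightarrow> real ^ 'm::finite ^ 'n \<Rightarrow> bool"
  where "controllable A B \<longleftrightarrow> span (\<Union>k<CARD('n). columns (matpow A k ** B)) = UNIV"

definition observable :: "real ^ 'n ^ 'n::finite \<Rightarrow> real ^ 'n ^ 'p::finite \<Rightarrow> bool"
  where "observable A C \<longleftrightarrow> span (\<Union>k<CARD('n). rows (C ** matpow A k)) = UNIV"

definition schur_stable :: "real ^ 'n ^ 'n::finite \<Rightarrow> bool"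
  where "schur_stable A \<longleftrightarrow>
    (\<forall>(\<mu>::complex) (z::complex ^ 'n).
       z \<noteq> 0 \<and> (\<chi> i j. complex_of_real (A $ i $ j)) *v z = \<mu> *s z \<longrightarrow> norm \<mu> < 1)"


section \<open>Gaussian vectors\<close>

text \<open>Variance \<open>0\<close> gives the point mass at \<open>0\<close>; a covariance matrix may be singular.\<close>

definition centered_normal :: "real \<Rightarrow> real measure"
  where "centered_normal var =
    (if var = 0 then return borel 0
     else density lborel (\<lambda>x. ennreal (normal_density 0 (sqrt var) x)))"

definition gaussian :: "'a measure \<Rightarrow> ('a \<Rightarrow> real ^ 'n::finite) \<Rightarrow> real ^ 'n ^ 'n \<Rightarrow> bool"
  where "gaussian M X \<Sigma> \<longleftrightarrow>
    X \<in> borel_measurable M \<and> possemidef \<Sigma> \<and>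
    (\<forall>a. distr M borel (\<lambda>\<omega>. a \<bullet> X \<omega>) = centered_normal (qform \<Sigma> a))"


section \<open>The system, its filter and its controller\<close>

record ('n::finite, 'm::finite, 's::finite, 'p::finite) model =
  mA :: "real ^ 'n ^ 'n"
  mB :: "real ^ 'm ^ 'n"
  mC :: "real ^ 'n ^ 'p"
  mGamma :: "real ^ 's ^ 'n"
  mPsi :: "real ^ 's ^ 'p"
  mL :: "real ^ 'n ^ 'm"
  mSigmaW :: "real ^ 'n ^ 'n"
  mSigmaV :: "real ^ 'p ^ 'p"
  mP :: "real ^ 'n ^ 'n"
  mSigma0 :: "real ^ 'n ^ 'n"

definition mSigmaNu :: "('n::finite, 'm::finite, 's::finite, 'p::finite) model \<Rightarrow> real ^ 'p ^ 'p"
  where "mSigmaNu S = mC S ** mP S ** transpose (mC S) + mSigmaV S"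

definition mK :: "('n::finite, 'm::finite, 's::finite, 'p::finite) model \<Rightarrow> real ^ 'p ^ 'n"
  where "mK S = mP S ** transpose (mC S) ** matrix_inv (mSigmaNu S)"

definition mABL :: "('n::finite, 'm::finite, 's::finite, 'p::finite) model \<Rightarrow> real ^ 'n ^ 'n"
  where "mABL S = mA S + mB S ** mL S"

text \<open>
  One realization of all exogenous quantities: the outputs at times \<open>s < 0\<close> (only these values of
  \<open>pre_output\<close> are used), the state \<open>x\<^sub>0\<close>, the prediction of \<open>x\<^sub>0\<close> from the outputs before
  time \<open>0\<close>, and the noises from time \<open>0\<close> on. A random realization is a function into this type.
\<close>

record ('n::finite, 'p::finite) realization =
  pre_output :: "int \<Rightarrow> real ^ 'p"
  init_state :: "real ^ 'n"
  init_pred :: "real ^ 'n"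
  proc_noise :: "nat \<Rightarrow> real ^ 'n"
  meas_noise :: "nat \<Rightarrow> real ^ 'p"

text \<open>
  The trajectories of one realization under the attack values \<open>e\<close>: \<open>x\<close>, \<open>y\<close> and, for the
  filter that ignores the attack, \<open>\<nu>\<^sup>e\<close>, the estimate, \<open>u\<close> and the one-step prediction
  (\<open>sys_pred S r e t\<close> is the prediction of \<open>x\<^sub>t\<close> from the outputs before \<open>t\<close>).
\<close>

function
  plant_state :: "('n::finite, 'm::finite, 's::finite, 'p::finite) model \<Rightarrow>
    ('n, 'p) realization \<Rightarrow> (nat \<Rightarrow> real ^ 's) \<Rightarrow> nat \<Rightarrow> real ^ 'n" and
  plant_output :: "('n, 'm, 's, 'p) model \<Rightarrow>
    ('n, 'p) realization \<Rightarrow> (nat \<Rightarrow> real ^ 's) \<Rightarrow> nat \<Rightarrow> real ^ 'p" and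
  sys_innov :: "('n, 'm, 's, 'p) model \<Rightarrow>
    ('n, 'p) realization \<Rightarrow> (nat \<Rightarrow> real ^ 's) \<Rightarrow> nat \<Rightarrow> real ^ 'p" and
  sys_est :: "('n, 'm, 's, 'p) model \<Rightarrow>
    ('n, 'p) realization \<Rightarrow> (nat \<Rightarrow> real ^ 's) \<Rightarrow> nat \<Rightarrow> real ^ 'n" and
  sys_input :: "('n, 'm, 's, 'p) model \<Rightarrow>
    ('n, 'p) realization \<Rightarrow> (nat \<Rightarrow> real ^ 's) \<Rightarrow> nat \<Rightarrow> real ^ 'm" and
  sys_pred :: "('n, 'm, 's, 'p) model \<Rightarrow>
    ('n, 'p) realization \<Rightarrow> (nat \<Rightarrow> real ^ 's) \<Rightarrow> nat \<Rightarrow> real ^ 'n"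
  where
    "plant_state S r e 0 = init_state r"
  | "plant_state S r e (Suc t) =
       mA S *v plant_state S r e t + mB S *v sys_input S r e t + mGamma S *v e t + proc_noise r t"
  | "plant_output S r e t = mC S *v plant_state S r e t + mPsi S *v e t + meas_noise r t"
  | "sys_innov S r e t = plant_output S r e t - mC S *v sys_pred S r e t"
  | "sys_est S r e t = sys_pred S r e t + mK S *v sys_innov S r e t"
  | "sys_input S r e t = mL S *v sys_est S r e t"
  | "sys_pred S r e 0 = init_pred r"
  | "sys_pred S r e (Suc t) = mABL S *v sys_est S r e t"
  by pat_completeness auto
termination by size_change

section \<open>The attacker\<close>

definition att_output :: "('n::finite, 'm::finite, 's::finite, 'p::finite) model \<Rightarrow>
    ('n, 'p) realization \<Rightarrow> (nat \<Rightarrow> real ^ 's) \<Rightarrow> nat \<Rightarrow> real ^ 'p"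
  where "att_output S r e t = mC S *v plant_state S r e t + meas_noise r t"

function
  att_innov :: "('n::finite, 'm::finite, 's::finite, 'p::finite) model \<Rightarrow>
    ('n, 'p) realization \<Rightarrow> (nat \<Rightarrow> real ^ 's) \<Rightarrow> nat \<Rightarrow> real ^ 'p" and
  att_est :: "('n, 'm, 's, 'p) model \<Rightarrow>
    ('n, 'p) realization \<Rightarrow> (nat \<Rightarrow> real ^ 's) \<Rightarrow> nat \<Rightarrow> real ^ 'n" and
  att_pred :: "('n, 'm, 's, 'p) model \<Rightarrow>
    ('n, 'p) realization \<Rightarrow> (nat \<Rightarrow> real ^ 's) \<Rightarrow> nat \<Rightarrow> real ^ 'n"
  where
    "att_innov S r e t = att_output S r e t - mC S *v att_pred S r e t"
  | "att_est S r e t = att_pred S r e t + mK S *v att_innov S r e t"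
  | "att_pred S r e 0 = init_pred r"
  | "att_pred S r e (Suc t) =
       mA S *v att_est S r e t + mB S *v sys_input S r e t + mGamma S *v e t"
  by pat_completeness auto
termination by size_change

text \<open>
  A (random) attack is a process \<open>e :: nat \<Rightarrow> 'a \<Rightarrow> real ^ 's\<close>; its value at time \<open>t\<close> may use the
  outputs before time \<open>0\<close>, the attacker's outputs up to \<open>t\<close>, which themselves depend on the
  earlier attack values, and the attack values before \<open>t\<close>.
\<close>

definition info_space :: "nat \<Rightarrow>
    ((int \<Rightarrow> real ^ 'p::finite) \<times> (nat \<Rightarrow> real ^ 'p) \<times> (nat \<Rightarrow> real ^ 's::finite)) measure"
  where "info_space t =
    (\<Pi>\<^sub>M i\<in>{..<0}. borel) \<Otimes>\<^sub>M ((\<Pi>\<^sub>M i\<in>{..t}. borel) \<Otimes>\<^sub>M (\<Pi>\<^sub>M i\<in>{..<t}. borel))"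

definition att_info :: "('n::finite, 'm::finite, 's::finite, 'p::finite) model \<Rightarrow>
    ('n, 'p) realization \<Rightarrow> (nat \<Rightarrow> real ^ 's) \<Rightarrow> nat \<Rightarrow>
    (int \<Rightarrow> real ^ 'p) \<times> (nat \<Rightarrow> real ^ 'p) \<times> (nat \<Rightarrow> real ^ 's)"
  where "att_info S r e t =
    (restrict (pre_output r) {..<0}, restrict (att_output S r e) {..t}, restrict e {..<t})"

definition admissible :: "'a measure \<Rightarrow> ('n::finite, 'm::finite, 's::finite, 'p::finite) model \<Rightarrow>
    ('a \<Rightarrow> ('n, 'p) realization) \<Rightarrow> nat \<Rightarrow> (nat \<Rightarrow> 'a \<Rightarrow> real ^ 's) \<Rightarrow> bool"
  where "admissible M S \<rho> N e \<longleftrightarrow>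
    (\<forall>t\<le>N. \<exists>g \<in> info_space t \<rightarrow>\<^sub>M borel. \<forall>\<omega>\<in>space M.
       e t \<omega> = g (att_info S (\<rho> \<omega>) (\<lambda>k. e k \<omega>) t))"

text \<open>
  The cost is an expectation of a nonnegative quantity. It is taken in \<^typ>\<open>ennreal\<close>, because a
  Bochner integral would give cost \<open>0\<close> to an attack with infinite cost.
\<close>

definition attack_cost :: "'a measure \<Rightarrow> ('n::finite, 'm::finite, 's::finite, 'p::finite) model \<Rightarrow>
    ('a \<Rightarrow> ('n, 'p) realization) \<Rightarrow> real ^ 'n \<Rightarrow> (nat \<Rightarrow> real ^ 'n ^ 'n) \<Rightarrow> (nat \<Rightarrow> real ^ 'p ^ 'p) \<Rightarrow>
    nat \<Rightarrow> (nat \<Rightarrow> 'a \<Rightarrow> real ^ 's) \<Rightarrow> ennreal"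
  where "attack_cost M S \<rho> xs Q R N e =
    (\<integral>\<^sup>+ \<omega>. ennreal (\<Sum>t\<le>N. qform (Q t) (plant_state S (\<rho> \<omega>) (\<lambda>k. e k \<omega>) t - xs)
                       + qform (R t) (sys_innov S (\<rho> \<omega>) (\<lambda>k. e k \<omega>) t)) \<partial>M)"


section \<open>The probabilistic setting\<close>

definition pre_algebra :: "'a measure \<Rightarrow> ('a \<Rightarrow> ('n::finite, 'p::finite) realization) \<Rightarrow> 'a measure"
  where "pre_algebra M \<rho> =
    vimage_algebra (space M) (\<lambda>\<omega>. restrict (pre_output (\<rho> \<omega>)) {..<0}) (\<Pi>\<^sub>M i\<in>{..<0}. borel)"

text \<open>
  Independence of two random variables with values in possibly different types (both value
  spaces of \<^const>\<open>prob_space.indep_var\<close> have the same type).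
\<close>

definition (in prob_space) indep_rv ::
    "'b measure \<Rightarrow> ('a \<Rightarrow> 'b) \<Rightarrow> 'c measure \<Rightarrow> ('a \<Rightarrow> 'c) \<Rightarrow> bool"
  where "indep_rv MX X MY Y \<longleftrightarrow>
    random_variable MX X \<and> random_variable MY Y \<and>
    indep_set {X -` E \<inter> space M | E. E \<in> sets MX} {Y -` E \<inter> space M | E. E \<in> sets MY}"

locale attack_setting = prob_space M
  for M :: "'a measure"
    and S :: "('n::finite, 'm::finite, 's::finite, 'p::finite) model"
    and \<rho> :: "'a \<Rightarrow> ('n, 'p) realization" +
  assumes observable: "observable (mA S) (mC S)"
    and controllable: "controllable (mA S) (mB S)"
    and attack_injective: "inj (\<lambda>a. (mGamma S </> mPsi S) *v a)"
    and stable: "schur_stable (mABL S)"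
    and SigmaW_posdef: "posdef (mSigmaW S)"
    and SigmaV_posdef: "posdef (mSigmaV S)"
    and riccati: "mP S =
      mA S ** mP S ** transpose (mA S) + mSigmaW S
      - mA S ** mP S ** transpose (mC S)
        ** matrix_inv (mC S ** mP S ** transpose (mC S) + mSigmaV S)
        ** mC S ** mP S ** transpose (mA S)"
    and Sigma0_eq: "mSigma0 S =
      mABL S ** (mSigma0 S + mK S ** mSigmaNu S ** transpose (mK S)) ** transpose (mABL S)"
    and pre_output_measurable: "\<And>s. s < 0 \<Longrightarrow> random_variable borel (\<lambda>\<omega>. pre_output (\<rho> \<omega>) s)"
    and init_state_measurable: "random_variable borel (\<lambda>\<omega>. init_state (\<rho> \<omega>))"
    and init_pred_measurable: "(\<lambda>\<omega>. init_pred (\<rho> \<omega>)) \<in> borel_measurable (pre_algebra M \<rho>)"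
    and init_pred_cond_mean: "\<And>i. AE \<omega> in M. init_pred (\<rho> \<omega>) $ i =
      real_cond_exp M (pre_algebra M \<rho>) (\<lambda>\<omega>. init_state (\<rho> \<omega>) $ i) \<omega>"
    and init_pred_gaussian: "gaussian M (\<lambda>\<omega>. init_pred (\<rho> \<omega>)) (mSigma0 S)"
    and init_error_gaussian: "gaussian M (\<lambda>\<omega>. init_state (\<rho> \<omega>) - init_pred (\<rho> \<omega>)) (mP S)"
    and init_error_indep: "indep_rv
      borel (\<lambda>\<omega>. init_state (\<rho> \<omega>) - init_pred (\<rho> \<omega>))
      (\<Pi>\<^sub>M i\<in>{..<0}. borel) (\<lambda>\<omega>. restrict (pre_output (\<rho> \<omega>)) {..<0})"
    and proc_noise_gaussian: "\<And>t. gaussian M (\<lambda>\<omega>. proc_noise (\<rho> \<omega>) t) (mSigmaW S)"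
    and meas_noise_gaussian: "\<And>t. gaussian M (\<lambda>\<omega>. meas_noise (\<rho> \<omega>) t) (mSigmaV S)"
    and noise_indep_time: "indep_vars (\<lambda>_. borel \<Otimes>\<^sub>M borel)
      (\<lambda>t \<omega>. (proc_noise (\<rho> \<omega>) t, meas_noise (\<rho> \<omega>) t)) UNIV"
    and noise_indep_pair: "\<And>t. indep_rv
      borel (\<lambda>\<omega>. proc_noise (\<rho> \<omega>) t) borel (\<lambda>\<omega>. meas_noise (\<rho> \<omega>) t)"
    and noise_indep_init: "indep_rv
      (\<Pi>\<^sub>M t\<in>UNIV. borel \<Otimes>\<^sub>M borel) (\<lambda>\<omega> t. (proc_noise (\<rho> \<omega>) t, meas_noise (\<rho> \<omega>) t))
      ((\<Pi>\<^sub>M i\<in>{..<0}. borel) \<Otimes>\<^sub>M (borel \<Otimes>\<^sub>M borel))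
      (\<lambda>\<omega>. (restrict (pre_output (\<rho> \<omega>)) {..<0}, init_state (\<rho> \<omega>), init_pred (\<rho> \<omega>)))"


section \<open>Augmented system\<close>

definition theta_A :: "('n::finite, 'm::finite, 's::finite, 'p::finite) model \<Rightarrow>
    real ^ ('n + 'n + 'n) ^ ('n + 'n + 'n)"
  where "theta_A S =
    ((mat 1 - mK S ** mC S) ** mA S + mB S ** mL S <|> mK S ** mC S <|> mK S ** mC S) </>
    (mA S ** mB S ** mL S                          <|> mA S         <|> 0) </>
    (0                                             <|> 0            <|> mA S)"

definition theta_B :: "('n::finite, 'm::finite, 's::finite, 'p::finite) model \<Rightarrow>
    real ^ 's ^ ('n + 'n + 'n)"
  where "theta_B S = mK S ** mPsi S </> 0 </> mGamma S"

definition theta_C :: "('n::finite, 'm::finite, 's::finite, 'p::finite) model \<Rightarrow>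
    real ^ ('n + 'n + 'n) ^ 'p"
  where "theta_C S = - (mC S ** mA S) <|> mC S <|> mC S"

primrec theta :: "('n::finite, 'm::finite, 's::finite, 'p::finite) model \<Rightarrow>
    (nat \<Rightarrow> real ^ 's) \<Rightarrow> nat \<Rightarrow> real ^ ('n + 'n + 'n)"
  where
    "theta S e 0 = 0"
  | "theta S e (Suc t) = theta_A S *v theta S e t + theta_B S *v e t"

type_synonym 'n aug = "'n + ('n + 'n + 'n) + 'n + 'n"

text \<open>The third block is the system's estimate on the same realization without attack.\<close>

definition aug_state :: "('n::finite, 'm::finite, 's::finite, 'p::finite) model \<Rightarrow>
    ('n, 'p) realization \<Rightarrow> real ^ 'n \<Rightarrow> (nat \<Rightarrow> real ^ 's) \<Rightarrow> nat \<Rightarrow> real ^ 'n aug"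
  where "aug_state S r xs e t =
    att_est S r e t </> theta S e t </> sys_est S r (\<lambda>_. 0) t </> xs"

definition aug_Omega :: "('n::finite, 'm::finite, 's::finite, 'p::finite) model \<Rightarrow>
    real ^ ('n + 'n + 'n) ^ 'n"
  where "aug_Omega S =
    (mat 1 - mK S ** mC S) ** mA S + mB S ** mL S <|> mK S ** mC S <|> mK S ** mC S"

definition aug_A :: "('n::finite, 'm::finite, 's::finite, 'p::finite) model \<Rightarrow>
    real ^ 'n aug ^ 'n aug"
  where "aug_A S =
    (mA S <|> mB S ** mL S ** aug_Omega S <|> mB S ** mL S <|> 0) </>
    (0    <|> theta_A S                   <|> 0            <|> 0) </>
    (0    <|> 0                           <|> mABL S       <|> 0) </>
    (0    <|> 0                           <|> 0            <|> mat 1)"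

definition aug_B :: "('n::finite, 'm::finite, 's::finite, 'p::finite) model \<Rightarrow>
    real ^ 's ^ 'n aug"
  where "aug_B S =
    mGamma S + mB S ** mL S ** mK S ** mPsi S </> theta_B S </> 0 </> 0"

definition aug_H :: "real ^ 'n::finite aug ^ 'n"
  where "aug_H = mat 1 <|> 0 <|> 0 <|> - mat 1"

definition aug_Ctilde :: "('n::finite, 'm::finite, 's::finite, 'p::finite) model \<Rightarrow>
    real ^ 'n aug ^ 'p"
  where "aug_Ctilde S = 0 <|> theta_C S <|> 0 <|> 0"

definition aug_C :: "('n::finite, 'm::finite, 's::finite, 'p::finite) model \<Rightarrow>
    real ^ 'n aug ^ ('n + 'p)"
  where "aug_C S = aug_H </> aug_Ctilde S"

definition aug_D :: "('n::finite, 'm::finite, 's::finite, 'p::finite) model \<Rightarrow>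
    real ^ 's ^ ('n + 'p)"
  where "aug_D S = 0 </> mPsi S"

definition aug_M :: "real ^ 'p::finite ^ ('n::finite + 'p)"
  where "aug_M = 0 </> mat 1"

definition aug_F :: "real ^ 'n ^ 'n \<Rightarrow> real ^ 'p ^ 'p \<Rightarrow>
    real ^ ('n::finite + 'p::finite) ^ ('n + 'p)"
  where "aug_F Q R = (Q <|> 0) </> (0 <|> R)"

end

theory Submission
  imports Defs
begin

text \<open>
  The attacker's innovations \<open>\<nu>\<^sub>t\<close> and estimation errors \<open>x\<^sub>t - E[x\<^sub>t | I\<^sub>t]\<close> do not depend on the attack,
  and in terms of \<open>\<xi>\<^sub>t\<close> the problem is linear-quadratic: \<open>\<xi>\<^sub>t\<^sub>+\<^sub>1 = \<A> \<xi>\<^sub>t + \<B> e\<^sub>t + (K, 0, K, 0) \<nu>\<^sub>t\<^sub>+\<^sub>1\<close>.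
  Let \<open>e\<close> be the proposed attack, \<open>e'\<close> an admissible one, and \<open>\<Delta>\<^sub>t = \<xi>'\<^sub>t - \<xi>\<^sub>t\<close>, which is free of noise given
  the attacks. By convexity the cost of \<open>e'\<close> exceeds that of \<open>e\<close> by at least a cross term linear in \<open>\<Delta>\<close>.
  Since \<open>e\<close> is stationary for the backward recursion, the cross term telescopes to a sum of
  products \<open>\<nu>\<^sub>t \<bullet> T\<^sub>t \<Delta>\<^sub>t\<close> and \<open>(x\<^sub>t - E[x\<^sub>t | I\<^sub>t]) \<bullet> Q\<^sub>t H \<Delta>\<^sub>t\<close>, where \<open>\<Delta>\<^sub>t\<close> is a function of the information before
  time \<open>t\<close>. These have mean zero, because the steady-state prediction error is independent of
  that information. The independence is proved with characteristic functions, as the Gaussian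
  laws are only known through their one-dimensional projections.
\<close>

section \<open>Matrices\<close>

text \<open>Convexity bounds the difference of the two costs realization by realization, so that no
  conditional expectations are needed; only the mean of the cross term is. The obstacle is
  integrability. A competitor is merely measurable, and even at finite cost \<open>e' N\<close> may
  lack second moments: the last attack value reaches the cost only through \<open>mPsi S\<close>,
  which may have a kernel. That kernel is also why the last stage needs a pseudoinverse. The
  telescoped cross term contains no difference of attack values, only \<open>dx t\<close> with t
  \<le> N, and finite cost does make these square integrable. Two devices shape the backward
  recursion. The value matrix after the horizon is set to 0, so that the last stage is an instance
  of the general one, with an abstract \<open>G\<close> for either kind of inverse. And the value
  matrices are only known to be semidefinite, so invertibility cannot come from their definiteness:
  the invariant is that zeros of \<open>qform Q\<close> lie in the kernel of \<open>aug_H\<close>,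
  which suffices together with definite \<open>F\<close> and the injectivity of the stacked attack
  matrix.\<close>

declare transpose_matrix_vector [simp del]

lemma inner_transpose_mult:
  fixes A :: "real ^ 'n::finite ^ 'm::finite"
  shows "x \<bullet> (transpose A *v y) = (A *v x) \<bullet> y"
  by (metis dot_lmul_matrix vector_transpose_matrix)

lemma transpose_add:
  fixes A :: "real ^ 'n::finite ^ 'm::finite"
  shows "transpose (A + B) = transpose A + transpose B"
  by (simp add: transpose_def vec_eq_iff)

lemma transpose_diff:
  fixes A :: "real ^ 'n::finite ^ 'm::finite"
  shows "transpose (A - B) = transpose A - transpose B"
  by (simp add: transpose_def vec_eq_iff)

lemma transpose_zero [simp]: "transpose (0 :: real ^ 'n::finite ^ 'm::finite) = 0"
  by (simp add: transpose_def vec_eq_iff)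

lemma matrix_mult_distribs:
  fixes A A' :: "real ^ 'n::finite ^ 'm::finite" and B B' :: "real ^ 'k::finite ^ 'n"
  shows "A ** (B + B') = A ** B + A ** B'" "A ** (B - B') = A ** B - A ** B'"
    "(A + A') ** B = A ** B + A' ** B" "(A - A') ** B = A ** B - A' ** B"
  by (simp_all add: matrix_eq algebra_simps flip: matrix_vector_mul_assoc)

lemma matrix_vector_mult_uminus:
  fixes A :: "real ^ 'n::finite ^ 'm::finite"
  shows "A *v (- x) = - (A *v x)"
  by (simp add: linear_neg)

lemma uminus_matrix_vector_mult:
  fixes A :: "real ^ 'n::finite ^ 'm::finite"
  shows "(- A) *v x = - (A *v x)"
  by (simp add: matrix_vector_mult_def vec_eq_iff sum_negf)

lemmas matvec = matrix_vector_mul_assoc [symmetric] matrix_vector_mult_add_rdistrib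
  matrix_vector_mult_diff_rdistrib matrix_vector_right_distrib matrix_vector_mult_diff_distrib
  matrix_vector_mult_uminus uminus_matrix_vector_mult

lemmas transpose_simps = transpose_add transpose_diff matrix_transpose_mul

lemma symmetric_inner:
  fixes A :: "real ^ 'n::finite ^ 'n"
  assumes "transpose A = A"
  shows "(A *v x) \<bullet> y = x \<bullet> (A *v y)"
  by (metis assms inner_transpose_mult)

lemma qform_add:
  fixes A :: "real ^ 'n::finite ^ 'n"
  assumes "transpose A = A"
  shows "qform A (x + y) = qform A x + 2 * (y \<bullet> (A *v x)) + qform A y"
  using symmetric_inner [OF assms, of x y]
  by (simp add: qform_def matvec inner_add inner_commute)

lemma posdef_possemidef: "posdef A \<Longrightarrow> possemidef A"
  unfolding posdef_def possemidef_def by (metis inner_zero_left less_eq_real_def qform_def)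

lemma posdef_qform_eq_0: "posdef A \<Longrightarrow> qform A x = 0 \<Longrightarrow> x = 0"
  unfolding posdef_def by fastforce

lemma possemidef_nonneg: "possemidef A \<Longrightarrow> 0 \<le> qform A x"
  by (simp add: possemidef_def)

lemma invertible_if_trivial_kernel:
  fixes A :: "real ^ 'n::finite ^ 'n"
  assumes "\<And>x. A *v x = 0 \<Longrightarrow> x = 0"
  shows "invertible A"
  using assms by (metis invertible_left_inverse matrix_left_invertible_ker)

lemma posdef_invertible: "posdef A \<Longrightarrow> invertible A"
  by (rule invertible_if_trivial_kernel) (simp add: posdef_qform_eq_0 qform_def)

lemma matrix_inv_mult:
  fixes A :: "real ^ 'n::finite ^ 'n"
  assumes "invertible A"
  shows "A ** matrix_inv A = mat 1" "matrix_inv A ** A = mat 1"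
  using assms unfolding matrix_inv_def invertible_def by (metis (mono_tags, lifting) someI_ex)+

text \<open>The constant is the minimum of the form on the compact unit sphere, and homogeneity does
  the rest. It later turns a finite cost into second moments of the state and of the system's
  innovation.\<close>

lemma posdef_lower_bound:
  fixes A :: "real ^ 'n::finite ^ 'n"
  assumes "posdef A"
  shows "\<exists>c>0. \<forall>x. c * (norm x)\<^sup>2 \<le> qform A x"
proof -
  have cont: "continuous_on (sphere 0 1) (qform A)"
    unfolding qform_def by (intro continuous_intros linear_continuous_on) auto
  have "sphere (0 :: real ^ 'n) 1 \<noteq> {}" by simp
  then obtain u where u: "u \<in> sphere 0 1" "\<And>x. x \<in> sphere 0 1 \<Longrightarrow> qform A u \<le> qform A x"
    using continuous_attains_inf [OF compact_sphere _ cont] by blast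
  from u(1) have "u \<noteq> 0" by auto
  then have pos: "qform A u > 0" using assms by (simp add: posdef_def)
  have "qform A u * (norm x)\<^sup>2 \<le> qform A x" for x
  proof (cases "x = 0")
    case False
    have "qform A x = (norm x)\<^sup>2 * qform A (x /\<^sub>R norm x)"
      using False by (simp add: qform_def matrix_vector_mult_scaleR power2_eq_square field_simps)
    moreover have "qform A u \<le> qform A (x /\<^sub>R norm x)"
      using False by (intro u(2)) simp
    ultimately show ?thesis by (metis mult.commute mult_left_mono zero_le_power2)
  qed (simp add: qform_def)
  with pos show ?thesis by blast
qed

text \<open>With an orthonormal basis of the kernel, the sum of the maps x to (b \<bullet> x) b is
  the orthogonal projection; each summand is symmetric, hence so is the matrix.\<close>

lemma kernel_projection:
  fixes A :: "real ^ 'n::finite ^ 'n"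
  obtains E :: "real ^ 'n ^ 'n" where "transpose E = E" "\<And>x. A *v (E *v x) = 0"
    "\<And>x. A *v x = 0 \<Longrightarrow> E *v x = x"
proof -
  let ?K = "{x. A *v x = 0}"
  have sub: "subspace ?K"
    by (auto simp: subspace_def matvec matrix_vector_mult_scaleR)
  obtain B where B: "B \<subseteq> ?K" "pairwise orthogonal B" "\<And>x. x \<in> B \<Longrightarrow> norm x = 1"
      "independent B" "span B = ?K"
    using orthonormal_basis_subspace [OF sub] by metis
  have fin: "finite B" using B(4) independent_imp_finite by blast
  define f where "f x = (\<Sum>b\<in>B. (b \<bullet> x) *\<^sub>R b)" for x
  have lin: "linear f"
    unfolding f_def by (intro linear_compose_sum ballI linearI)
      (auto simp: inner_add_right scaleR_add_left)
  then have E: "matrix f *v x = f x" for x by (metis matrix_vector_mul(2))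
  show thesis
  proof
    have "x \<bullet> f y = f x \<bullet> y" for x y
      unfolding f_def inner_sum_left inner_sum_right by (simp add: inner_commute mult.commute)
    then show "transpose (matrix f) = matrix f"
      unfolding matrix_eq
      by (metis E inner_transpose_mult vector_eq_ldot)
    show "A *v (matrix f *v x) = 0" for x
    proof -
      have "f x \<in> span B" unfolding f_def by (intro span_sum span_scale span_base)
      then show ?thesis using B(5) E by simp
    qed
    show "matrix f *v x = x" if "A *v x = 0" for x
    proof -
      have "x \<in> span B" using that B(5) by simp
      moreover have "f b = b" if "b \<in> B" for b
      proof -
        have "f b = (\<Sum>c\<in>B. if c = b then b else 0)"
          unfolding f_def using that B(2,3)
          by (intro sum.cong) (auto simp: pairwise_def orthogonal_def dot_square_norm)
        then show ?thesis using that fin by simp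
      qed
      ultimately have "f x = x"
        using linear_eq_on [OF lin linear_id, of x B] by simp
      then show ?thesis by (simp add: E)
    qed
  qed
qed

text \<open>
  If \<open>E\<close> is the orthogonal projection onto the kernel of a symmetric \<open>A\<close>, then \<open>A + E\<close> is
  invertible, and \<open>(A + E)\<^sup>-\<^sup>1 - E\<close> is the pseudoinverse of \<open>A\<close>.
\<close>

lemma is_pinv_pinv_symmetric:
  fixes A :: "real ^ 'n::finite ^ 'n"
  assumes sym: "transpose A = A"
  shows "is_pinv A (pinv A)"
proof -
  obtain E where E: "transpose E = E" "\<And>x. A *v (E *v x) = 0" "\<And>x. A *v x = 0 \<Longrightarrow> E *v x = x"
    using kernel_projection by blast
  have AE: "A ** E = 0" by (simp add: matrix_eq matvec E(2))
  then have EA: "E ** A = 0" by (metis E(1) sym matrix_transpose_mul transpose_zero)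
  have EE: "E ** E = E" by (simp add: matrix_eq matvec E(2,3))
  have "x = 0" if "(A + E) *v x = 0" for x
  proof -
    \<comment> \<open>Applying \<open>E\<close> isolates the kernel component of x, which therefore
      vanishes; then A x = 0 puts x into the kernel, where \<open>E\<close> is the identity.\<close>
    have "E *v x = E *v ((A + E) *v x)" by (simp add: matrix_vector_mul_assoc matrix_mult_distribs EA EE)
    then have "E *v x = 0" by (simp add: that)
    moreover from this that have "A *v x = 0" by (simp add: matvec)
    ultimately show ?thesis using E(3) by metis
  qed
  then have inv: "invertible (A + E)" by (rule invertible_if_trivial_kernel)
  define G where "G = matrix_inv (A + E)"
  have G: "(A + E) ** G = mat 1" "G ** (A + E) = mat 1"
    unfolding G_def by (rule matrix_inv_mult [OF inv])+
  have "(A + E) ** E = E" "E ** (A + E) = E"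
    using AE EA EE by (simp_all add: matrix_mult_distribs)
  then have GE: "G ** E = E" "E ** G = E"
    by (metis G matrix_mul_assoc matrix_mul_lid matrix_mul_rid)+
  have 1: "A ** (G - E) = mat 1 - E" "(G - E) ** A = mat 1 - E"
    using G AE EA GE
    by (simp_all add: matrix_mult_distribs eq_diff_eq)
  have "is_pinv A (G - E)"
    unfolding is_pinv_def 1
    by (simp add: matrix_mult_distribs EA GE EE transpose_simps E(1) transpose_mat)
  then show ?thesis
    unfolding pinv_def by (metis is_pinv_unique theI)
qed

text \<open>The kernels of \<open>D\<^sup>T F D\<close> and \<open>D\<close> agree, so the range of \<open>D\<^sup>T F\<close> lies in the range of \<open>D\<^sup>T F D\<close>.\<close>

lemma pinv_normal_equation:
  fixes D :: "real ^ 's::finite ^ 'q::finite"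
  assumes F: "posdef F"
  shows "(transpose D ** F ** D) ** pinv (transpose D ** F ** D) *v (transpose D ** F *v g)
    = transpose D ** F *v g"
proof -
  define L where "L = transpose D ** F ** D"
  define X where "X = pinv L"
  have symF: "transpose F = F" using F by (simp add: posdef_def)
  have sym: "transpose L = L"
    by (simp add: L_def matrix_transpose_mul symF matrix_mul_assoc)
  from is_pinv_pinv_symmetric [OF this] have X: "L ** X ** L = L" "transpose (L ** X) = L ** X"
    by (simp_all add: is_pinv_def X_def)
  define h where "h = transpose D ** F *v g"
  \<comment> \<open>\<open>u\<close> is the residual of \<open>h\<close> after the projection
    \<open>L ** X\<close> onto the range of \<open>L\<close>. It lies in the kernel of
    \<open>L\<close>, hence of \<open>D\<close>; being orthogonal to the projected part, it
    satisfies u \<bullet> u = u \<bullet> h, and u \<bullet> h vanishes because \<open>h\<close> is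
    an image of \<open>transpose D\<close>.\<close>
  define u where "u = h - L ** X *v h"
  have LLX: "L ** (L ** X) = L"
    by (metis X matrix_transpose_mul sym)
  have Lu: "L *v u = 0"
    unfolding u_def by (simp add: matrix_vector_mult_diff_distrib matrix_vector_mul_assoc LLX)
  have "qform F (D *v u) = u \<bullet> (L *v u)"
    by (simp add: qform_def L_def matvec inner_transpose_mult)
  then have Du: "D *v u = 0"
    using Lu posdef_qform_eq_0 [OF F] by simp
  have "u \<bullet> (L ** X *v h) = (L ** X *v u) \<bullet> h"
    by (metis X(2) inner_transpose_mult)
  also have "L ** X *v u = 0"
    unfolding u_def by (simp add: matrix_vector_mult_diff_distrib matrix_vector_mul_assoc matrix_mul_assoc X(1))
  finally have "u \<bullet> u = u \<bullet> h"
    by (simp add: u_def inner_diff)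
  also have "\<dots> = (D *v u) \<bullet> (F *v g)"
    by (simp add: h_def matvec inner_transpose_mult)
  finally have "u = 0" by (simp add: Du)
  then show ?thesis by (simp add: u_def h_def X_def L_def)
qed

subsection \<open>Block vectors\<close>

lemma UNIV_sum_eq: "(UNIV :: ('a + 'b) set) = Inl ` UNIV \<union> Inr ` UNIV"
proof -
  have "x \<in> Inl ` UNIV \<union> Inr ` UNIV" for x :: "'a + 'b" by (cases x) auto
  then show ?thesis by blast
qed

lemma sum_UNIV_plus:
  fixes f :: "'a::finite + 'b::finite \<Rightarrow> 'c::comm_monoid_add"
  shows "sum f UNIV = (\<Sum>a\<in>UNIV. f (Inl a)) + (\<Sum>b\<in>UNIV. f (Inr b))"
  unfolding UNIV_sum_eq by (subst sum.union_disjoint) (auto simp: sum.reindex)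

lemma vcat_nth [simp]: "(u </> v) $ Inl a = u $ a" "(u </> v) $ Inr b = v $ b"
  by (simp_all add: vcat_def)

lemma vec_eq_vcat_iff:
  fixes x y :: "'c ^ ('a::finite + 'b::finite)"
  shows "x = y \<longleftrightarrow> (\<forall>a. x $ Inl a = y $ Inl a) \<and> (\<forall>b. x $ Inr b = y $ Inr b)"
  by (metis sum.exhaust vec_eq_iff)

lemma vcat_mult:
  fixes U :: "real ^ 'n::finite ^ 'a::finite"
  shows "(U </> V) *v x = (U *v x </> V *v x)"
  by (simp add: vec_eq_vcat_iff matrix_vector_mult_def)

lemma hcat_mult:
  fixes U :: "real ^ 'a::finite ^ 'r::finite"
  shows "(U <|> V) *v (x </> y) = U *v x + V *v y"
  by (simp add: vec_eq_iff matrix_vector_mult_def hcat_def sum_UNIV_plus)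

lemma vcat_add:
  fixes u :: "real ^ 'a::finite"
  shows "(u </> v) + (x </> y) = (u + x </> v + y)"
  by (simp add: vec_eq_vcat_iff)

lemma vcat_zero:
  shows "((0 :: real ^ 'a::finite) </> (0 :: real ^ 'b::finite)) = 0"
  by (simp add: vec_eq_vcat_iff)

lemma vcat_exhaust:
  fixes x :: "real ^ ('a::finite + 'b::finite)"
  obtains u v where "x = (u </> v)"
proof
  show "x = ((\<chi> a. x $ Inl a) </> (\<chi> b. x $ Inr b))" by (simp add: vec_eq_vcat_iff)
qed

lemma inner_vcat:
  fixes u :: "real ^ 'a::finite"
  shows "(u </> v) \<bullet> (x </> y) = u \<bullet> x + v \<bullet> y"
  by (simp add: inner_vec_def sum_UNIV_plus)

lemmas block_simps = vcat_mult hcat_mult vcat_add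

lemma qform_aug_F: "qform (aug_F Q R) (u </> v) = qform Q u + qform R v"
  by (simp add: qform_def aug_F_def block_simps inner_vcat)

lemma posdef_aug_F:
  assumes "posdef Q" "posdef R"
  shows "posdef (aug_F Q R)"
proof -
  have "transpose (aug_F Q R) = aug_F Q R"
    using assms unfolding posdef_def
    by (auto simp: vec_eq_iff transpose_def aug_F_def hcat_def vcat_def split: sum.split)
  moreover have "qform (aug_F Q R) x > 0" if x: "x \<noteq> 0" for x
  proof -
    obtain u v where uv: "x = (u </> v)" by (rule vcat_exhaust)
    then have "u \<noteq> 0 \<or> v \<noteq> 0" using x by (auto simp: vcat_zero)
    then show ?thesis
      using assms possemidef_nonneg [OF posdef_possemidef [OF assms(1)], of u]
        possemidef_nonneg [OF posdef_possemidef [OF assms(2)], of v]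
      unfolding uv qform_aug_F posdef_def by (metis add_nonneg_pos add_pos_nonneg)
  qed
  ultimately show ?thesis by (simp add: posdef_def)
qed

section \<open>The backward recursion\<close>

text \<open>Up to a factor 2, the Hessian in the attack value of one stage cost plus the quadratic
  cost-to-go \<open>Qn\<close>; \<open>stage_mixed\<close> is the mixed second derivative in attack
  value and state.\<close>

definition stage_gram :: "real ^ 's::finite ^ 'k::finite \<Rightarrow> real ^ 's ^ 'q::finite \<Rightarrow>
    real ^ 'q ^ 'q \<Rightarrow> real ^ 'k ^ 'k \<Rightarrow> real ^ 's ^ 's"
  where "stage_gram B D F Qn = transpose D ** F ** D + transpose B ** Qn ** B"

definition stage_mixed :: "real ^ 'k::finite ^ 'k \<Rightarrow> real ^ 's::finite ^ 'k \<Rightarrow> real ^ 'k ^ 'q::finite \<Rightarrow>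
    real ^ 's ^ 'q \<Rightarrow> real ^ 'q ^ 'q \<Rightarrow> real ^ 'k ^ 'k \<Rightarrow> real ^ 'k ^ 's"
  where "stage_mixed A B C D F Qn = transpose D ** F ** C + transpose B ** Qn ** A"

text \<open>\<open>G\<close> stands for the inverse of \<open>stage_gram\<close> before the horizon
  and for its pseudoinverse at the horizon. \<open>LGY\<close> is what both share: \<open>G\<close>
  solves the stationarity equation for every right-hand side that a state can produce.\<close>

locale riccati_step =
  fixes A :: "real ^ 'k::finite ^ 'k" and B :: "real ^ 's::finite ^ 'k"
    and C :: "real ^ 'k ^ 'q::finite" and D :: "real ^ 's ^ 'q"
    and F :: "real ^ 'q ^ 'q" and Qn Q :: "real ^ 'k ^ 'k" and G :: "real ^ 's ^ 's"
  assumes symF: "transpose F = F" and symQn: "transpose Qn = Qn"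
    and LGY: "stage_gram B D F Qn ** G ** stage_mixed A B C D F Qn = stage_mixed A B C D F Qn"
    and Q_eq: "Q = transpose C ** F ** C + transpose A ** Qn ** A
      - transpose (stage_mixed A B C D F Qn) ** G ** stage_mixed A B C D F Qn"
begin

abbreviation "L \<equiv> stage_gram B D F Qn"
abbreviation "Y \<equiv> stage_mixed A B C D F Qn"

lemmas L_def = stage_gram_def [of B D F Qn]
lemmas Y_def = stage_mixed_def [of A B C D F Qn]

lemma transpose_L: "transpose L = L"
  by (simp add: L_def transpose_simps symF symQn matrix_mul_assoc)

lemma transpose_Y: "transpose Y = transpose C ** F ** D + transpose A ** Qn ** B"
  by (simp add: Y_def transpose_simps symF symQn matrix_mul_assoc)

text \<open>\<open>G\<close> itself is not assumed symmetric. Inserting \<open>LGY\<close> turns the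
  subtracted term into \<open>Y^T G^T L G Y\<close>, whose symmetry follows from that of
  \<open>L\<close>.\<close>

lemma symmetric: "transpose Q = Q"
proof -
  have "transpose Y ** G ** Y = transpose (L ** G ** Y) ** G ** Y" by (simp add: LGY)
  also have "\<dots> = transpose Y ** transpose G ** L ** G ** Y"
    by (simp add: matrix_transpose_mul transpose_L matrix_mul_assoc)
  finally have eq: "transpose Y ** G ** Y = transpose Y ** transpose G ** L ** G ** Y" .
  then have "transpose (transpose Y ** G ** Y) = transpose Y ** G ** Y"
    by (simp add: matrix_transpose_mul transpose_L matrix_mul_assoc)
  then show ?thesis
    by (simp add: Q_eq transpose_diff transpose_add)
      (simp add: matrix_transpose_mul symF symQn matrix_mul_assoc)
qed

text \<open>Since L e = - Y x, the quadratic term in \<open>e\<close> cancels half of the mixed one.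
  The value matrix is thus the cost of an actual step, so its sign and its zeros can be read off
  from \<open>F\<close> and \<open>Qn\<close>.\<close>

lemma qform_eq:
  fixes x
  defines "e \<equiv> - (G *v (Y *v x))"
  shows "qform Q x = qform F (C *v x + D *v e) + qform Qn (A *v x + B *v e)"
proof -
  have "qform F (C *v x + D *v e) + qform Qn (A *v x + B *v e)
      = qform F (C *v x) + qform Qn (A *v x) + 2 * (e \<bullet> (Y *v x)) + e \<bullet> (L *v e)"
    unfolding qform_add [OF symF] qform_add [OF symQn]
    by (simp add: qform_def L_def Y_def matvec inner_add inner_transpose_mult)
  also have "L *v e = - (Y *v x)"
    unfolding e_def by (simp add: matrix_vector_mult_uminus matrix_vector_mul_assoc matrix_mul_assoc LGY)
  also have "qform F (C *v x) + qform Qn (A *v x) + 2 * (e \<bullet> (Y *v x)) + e \<bullet> (- (Y *v x)) = qform Q x"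
    unfolding qform_def Q_eq e_def
    by (simp add: matvec inner_diff inner_add inner_transpose_mult inner_commute)
  finally show ?thesis by simp
qed

text \<open>
  Since \<open>e\<close> is stationary, the terms telescope along a trajectory; \<open>Q x + (\<dots>) v\<close> is the costate.
\<close>

lemma stage_cross:
  fixes Mm :: "real ^ 'r::finite ^ 'q"
  assumes GM: "L ** G ** (transpose D ** F ** Mm) = transpose D ** F ** Mm"
    and e: "e = - (G *v (Y *v x + (transpose D ** F ** Mm) *v v))"
  shows "(C *v dx + D *v de) \<bullet> (F *v (C *v x + D *v e + Mm *v v))
    = dx \<bullet> (Q *v x + (transpose C ** F ** Mm - transpose Y ** G ** (transpose D ** F ** Mm)) *v v)
      - (A *v dx + B *v de) \<bullet> (Qn *v (A *v x + B *v e))"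
proof -
  let ?z = "C *v x + D *v e + Mm *v v" and ?w = "A *v x + B *v e"
  have "L *v e = - (L ** G ** Y *v x + L ** G ** (transpose D ** F ** Mm) *v v)"
    unfolding e by (simp only: matvec)
  then have "L *v e = - (Y *v x + (transpose D ** F ** Mm) *v v)"
    unfolding LGY GM .
  \<comment> \<open>Stationarity: the coefficient of \<open>de\<close> in the cross term is zero, so
    an arbitrary deviation of the attack drops out.\<close>
  then have stat: "transpose D *v (F *v ?z) + transpose B *v (Qn *v ?w) = 0"
    unfolding L_def Y_def by (simp add: matvec algebra_simps add_eq_0_iff)
  have "transpose Y *v e = - (transpose Y ** G ** Y *v x
      + transpose Y ** G ** (transpose D ** F ** Mm) *v v)"
    unfolding e by (simp only: matvec)
  moreover have "transpose Y *v e = transpose C *v (F *v (D *v e)) + transpose A *v (Qn *v (B *v e))"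
    unfolding transpose_Y by (simp only: matvec)
  ultimately have Ye: "transpose C *v (F *v (D *v e)) + transpose A *v (Qn *v (B *v e))
      = - (transpose Y ** G ** Y *v x + transpose Y ** G ** (transpose D ** F ** Mm) *v v)"
    by simp
  have "transpose C *v (F *v ?z) + transpose A *v (Qn *v ?w)
    = (transpose C ** F ** C + transpose A ** Qn ** A) *v x + (transpose C ** F ** Mm) *v v
      + (transpose C *v (F *v (D *v e)) + transpose A *v (Qn *v (B *v e)))"
    by (simp add: matvec)
  then have costate: "transpose C *v (F *v ?z) + transpose A *v (Qn *v ?w)
    = Q *v x + (transpose C ** F ** Mm - transpose Y ** G ** (transpose D ** F ** Mm)) *v v"
    unfolding Ye Q_eq
    by (simp add: matrix_vector_mult_add_rdistrib matrix_vector_mult_diff_rdistrib)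
  have "(C *v dx + D *v de) \<bullet> (F *v ?z) + (A *v dx + B *v de) \<bullet> (Qn *v ?w)
    = dx \<bullet> (transpose C *v (F *v ?z) + transpose A *v (Qn *v ?w))
      + de \<bullet> (transpose D *v (F *v ?z) + transpose B *v (Qn *v ?w))"
    by (simp add: inner_add inner_transpose_mult)
  then show ?thesis unfolding stat costate by simp
qed

end

section \<open>Uniqueness of Fourier transforms\<close>

text \<open>Sets over which \<open>h\<close> integrates to 0 are closed under disjoint countable
  unions, and under complements because the total integral is 0; as \<open>G\<close> is closed under
  intersections, Dynkin's lemma applies.\<close>

lemma set_integral_zero_generated:
  fixes h :: "'a \<Rightarrow> 'b::{banach, second_countable_topology}"
  assumes h: "integrable M h" "integral\<^sup>L M h = 0"
    and G: "G \<subseteq> sets M" "Int_stable G" and zero: "\<And>A. A \<in> G \<Longrightarrow> (LINT x:A|M. h x) = 0"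
    and A: "A \<in> sigma_sets (space M) G"
  shows "(LINT x:A|M. h x) = 0"
proof -
  have sub: "sigma_sets (space M) G \<subseteq> sets M"
    using G(1) by (rule sets.sigma_sets_subset)
  have int: "set_integrable M B h" if "B \<in> sets M" for B
    using integrable_mult_indicator [OF that h(1)] by (simp add: set_integrable_def)
  have "G \<subseteq> Pow (space M)" using G(1) sets.sets_into_space by blast
  from this A show ?thesis
  proof (induction rule: sigma_sets_induct_disjoint [OF G(2), consumes 2, case_names basic empty compl union])
    case (basic A)
    then show ?case by (rule zero)
  next
    case empty
    show ?case by (simp add: set_lebesgue_integral_def)
  next
    case (compl A)
    then have "A \<in> sets M" using sub by blast
    then have "(LINT x:A \<union> (space M - A)|M. h x) = (LINT x:A|M. h x) + (LINT x:space M - A|M. h x)"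
      by (intro set_integral_Un int) auto
    moreover have "A \<union> (space M - A) = space M"
      using \<open>A \<in> sets M\<close> sets.sets_into_space by blast
    ultimately show ?case using compl.IH h(2) by (simp add: set_integral_space [OF h(1)])
  next
    case (union A)
    have "A i \<in> sets M" for i using union.hyps(2) sub by blast
    then have "(LINT x:(\<Union>i. A i)|M. h x) = (\<Sum>i. LINT x:A i|M. h x)"
      using union.hyps(1)
      by (intro lebesgue_integral_countable_add int) (auto simp: disjoint_family_on_def)
    then show ?case using union.IH by simp
  qed
qed

lemma norm_iexp [simp]: "norm (iexp x) = 1"
  by (simp add: norm_exp_eq_Re)

context prob_space
begin

lemma integrable_mult_iexp [intro]:
  fixes W :: "'a \<Rightarrow> complex"
  assumes "integrable M W" "X \<in> borel_measurable M"
  shows "integrable M (\<lambda>\<omega>. W \<omega> * iexp (X \<omega>))"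
proof (rule Bochner_Integration.integrable_bound [OF assms(1)])
  show "(\<lambda>\<omega>. W \<omega> * iexp (X \<omega>)) \<in> borel_measurable M" using assms by measurable
qed (simp add: norm_mult)

text \<open>The signed weight is split into positive and negative parts. Normalized, each becomes a
  probability density, and the hypothesis says that the two laws of \<open>X\<close> under these
  densities have equal characteristic functions; Levy's theorem identifies them.\<close>

lemma fourier_zero_real:
  fixes W X :: "'a \<Rightarrow> real"
  assumes W: "integrable M W" and X [measurable]: "X \<in> borel_measurable M"
    and zero: "\<And>s. (\<integral>\<omega>. complex_of_real (W \<omega>) * iexp (s * X \<omega>) \<partial>M) = 0"
    and E [measurable]: "E \<in> sets borel"
  shows "(\<integral>\<omega>. W \<omega> * indicator E (X \<omega>) \<partial>M) = 0"
proof -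
  have [measurable]: "W \<in> borel_measurable M" using W by simp
  define Wp where "Wp \<omega> = max (W \<omega>) 0" for \<omega>
  define Wm where "Wm \<omega> = max (- W \<omega>) 0" for \<omega>
  have int: "integrable M Wp" "integrable M Wm"
    unfolding Wp_def Wm_def using W by (auto intro!: integrable_max)
  have [measurable]: "Wp \<in> borel_measurable M" "Wm \<in> borel_measurable M" using int by auto
  have nonneg: "Wp \<omega> \<ge> 0" "Wm \<omega> \<ge> 0" for \<omega> by (auto simp: Wp_def Wm_def)
  have W_eq: "W \<omega> = Wp \<omega> - Wm \<omega>" for \<omega> by (auto simp: Wp_def Wm_def)
  have intc: "integrable M (\<lambda>\<omega>. complex_of_real (V \<omega>) * iexp (s * X \<omega>))"
    if "integrable M V" for V :: "'a \<Rightarrow> real" and s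
    using that by (intro integrable_mult_iexp) measurable
  have eq: "(\<integral>\<omega>. complex_of_real (Wp \<omega>) * iexp (s * X \<omega>) \<partial>M)
      = (\<integral>\<omega>. complex_of_real (Wm \<omega>) * iexp (s * X \<omega>) \<partial>M)" for s
  proof -
    have "(\<integral>\<omega>. complex_of_real (Wp \<omega>) * iexp (s * X \<omega>) \<partial>M)
      - (\<integral>\<omega>. complex_of_real (Wm \<omega>) * iexp (s * X \<omega>) \<partial>M)
      = (\<integral>\<omega>. complex_of_real (W \<omega>) * iexp (s * X \<omega>) \<partial>M)"
      by (subst Bochner_Integration.integral_diff [symmetric])
        (intro intc int Bochner_Integration.integral_cong refl; simp add: W_eq algebra_simps)+
    then show ?thesis using zero by simp
  qed
  \<comment> \<open>Frequency 0 in \<open>eq\<close> gives both parts the same total mass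
    \<open>m\<close>, so one normalization serves both; if \<open>m\<close> is 0, the weight
    vanishes almost everywhere.\<close>
  define m where "m = integral\<^sup>L M Wp"
  have m: "integral\<^sup>L M Wm = m"
    using eq [of 0] by (simp add: m_def)
  have intE: "integrable M (\<lambda>\<omega>. V \<omega> * indicator E (X \<omega>))"
    if "integrable M V" for V :: "'a \<Rightarrow> real"
  proof (rule Bochner_Integration.integrable_bound [OF that])
    have [measurable]: "V \<in> borel_measurable M" using that by simp
    show "(\<lambda>\<omega>. V \<omega> * indicator E (X \<omega>)) \<in> borel_measurable M" by measurable
  qed (simp add: indicator_def)
  have split: "(\<integral>\<omega>. W \<omega> * indicator E (X \<omega>) \<partial>M)
      = (\<integral>\<omega>. Wp \<omega> * indicator E (X \<omega>) \<partial>M) - (\<integral>\<omega>. Wm \<omega> * indicator E (X \<omega>) \<partial>M)"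
    by (subst Bochner_Integration.integral_diff [symmetric])
      (auto intro!: intE int Bochner_Integration.integral_cong simp: W_eq algebra_simps)
  show ?thesis
  proof (cases "m = 0")
    case True
    have "AE \<omega> in M. Wp \<omega> = 0" "AE \<omega> in M. Wm \<omega> = 0"
      using integral_nonneg_eq_0_iff_AE [OF int(1)] integral_nonneg_eq_0_iff_AE [OF int(2)]
        True m nonneg by (auto simp: m_def)
    then have "AE \<omega> in M. W \<omega> * indicator E (X \<omega>) = 0" by eventually_elim (simp add: W_eq)
    then show ?thesis by (rule integral_eq_zero_AE)
  next
    case False
    then have m_pos: "m > 0"
      unfolding m_def using nonneg by (simp add: less_le Bochner_Integration.integral_nonneg)
    define law where "law V = distr (density M (\<lambda>\<omega>. ennreal (V \<omega> / m))) borel X" for V :: "'a \<Rightarrow> real"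
    have law: "real_distribution (law V)"
        "char (law V) s = (\<integral>\<omega>. complex_of_real (V \<omega>) * iexp (s * X \<omega>) \<partial>M) / m"
        "measure (law V) E = (\<integral>\<omega>. V \<omega> * indicator E (X \<omega>) \<partial>M) / m"
      if V: "integrable M V" "\<And>\<omega>. V \<omega> \<ge> 0" "integral\<^sup>L M V = m" for V s
    proof -
      have [measurable]: "V \<in> borel_measurable M" using V by auto
      have "emeasure (density M (\<lambda>\<omega>. ennreal (V \<omega> / m))) (space M) = \<integral>\<^sup>+\<omega>. ennreal (V \<omega> / m) \<partial>M"
        by (subst emeasure_density) (auto intro!: nn_integral_cong)
      also have "\<dots> = ennreal (\<integral>\<omega>. V \<omega> / m \<partial>M)"
        using V m_pos by (intro nn_integral_eq_integral) auto
      also have "\<dots> = 1" using V(3) m_pos by simp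
      finally have "prob_space (density M (\<lambda>\<omega>. ennreal (V \<omega> / m)))"
        by (intro prob_spaceI) simp
      then show *: "real_distribution (law V)"
        unfolding law_def by (intro prob_space.real_distribution_distr) auto
      show "char (law V) s = (\<integral>\<omega>. complex_of_real (V \<omega>) * iexp (s * X \<omega>) \<partial>M) / m"
        unfolding char_def law_def using V(2) m_pos
        by (subst integral_distr) (auto simp: integral_density scaleR_conv_of_real)
      have "finite_measure (law V)" using * by (simp add: real_distribution_def prob_space_def)
      then have "measure (law V) E = (\<integral>x. indicator E x \<partial>law V)"
        using * by (simp add: law_def)
      also have "\<dots> = (\<integral>\<omega>. V \<omega> / m * indicator E (X \<omega>) \<partial>M)"
        unfolding law_def using V(2) m_pos
        by (subst integral_distr) (auto simp: integral_density)
      finally show "measure (law V) E = (\<integral>\<omega>. V \<omega> * indicator E (X \<omega>) \<partial>M) / m" by simp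
    qed
    have "law Wp = law Wm"
      using int nonneg m m_def eq
      by (intro Levy_uniqueness law(1) ext) (simp_all add: law(2))
    then have "(\<integral>\<omega>. Wp \<omega> * indicator E (X \<omega>) \<partial>M) = (\<integral>\<omega>. Wm \<omega> * indicator E (X \<omega>) \<partial>M)"
      using law(3) [OF int(1)] law(3) [OF int(2)] nonneg m m_def m_pos by simp
    then show ?thesis using split by simp
  qed
qed

text \<open>A complex weight is reduced to its real and imaginary parts. They are combinations of
  \<open>W\<close> and its conjugate, and the hypothesis for the conjugate is the conjugate of the
  one at frequency \<open>- s\<close>.\<close>

lemma fourier_zero:
  fixes W :: "'a \<Rightarrow> complex" and X :: "'a \<Rightarrow> real"
  assumes W: "integrable M W" and X [measurable]: "X \<in> borel_measurable M"
    and zero: "\<And>s. (\<integral>\<omega>. W \<omega> * iexp (s * X \<omega>) \<partial>M) = 0"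
    and E [measurable]: "E \<in> sets borel"
  shows "(\<integral>\<omega>. W \<omega> * indicator E (X \<omega>) \<partial>M) = 0"
proof -
  have [measurable]: "W \<in> borel_measurable M" using W by simp
  have int: "integrable M (\<lambda>\<omega>. W \<omega> * iexp (s * X \<omega>))"
      "integrable M (\<lambda>\<omega>. cnj (W \<omega>) * iexp (s * X \<omega>))" for s
    using W by (intro integrable_mult_iexp; simp)+
  have cnj_zero: "(\<integral>\<omega>. cnj (W \<omega>) * iexp (s * X \<omega>) \<partial>M) = 0" for s
  proof -
    have "(\<integral>\<omega>. cnj (W \<omega>) * iexp (s * X \<omega>) \<partial>M) = (\<integral>\<omega>. cnj (W \<omega> * iexp (- s * X \<omega>)) \<partial>M)"
      by (simp add: exp_cnj)
    also have "\<dots> = cnj (\<integral>\<omega>. W \<omega> * iexp (- s * X \<omega>) \<partial>M)" by (rule Bochner_Integration.integral_cnj)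
    finally show ?thesis by (simp only: zero complex_cnj_zero)
  qed
  have "(\<integral>\<omega>. complex_of_real (Re (W \<omega>)) * iexp (s * X \<omega>) \<partial>M)
      = (\<integral>\<omega>. (W \<omega> * iexp (s * X \<omega>) + cnj (W \<omega>) * iexp (s * X \<omega>)) / 2 \<partial>M)" for s
    by (intro Bochner_Integration.integral_cong refl) (simp add: complex_add_cnj flip: distrib_right)
  then have "(\<integral>\<omega>. complex_of_real (Re (W \<omega>)) * iexp (s * X \<omega>) \<partial>M) = 0" for s
    using int by (simp add: zero cnj_zero del: of_real_mult)
  then have re: "(\<integral>\<omega>. Re (W \<omega>) * indicator E (X \<omega>) \<partial>M) = 0"
    using W by (intro fourier_zero_real) auto
  have "(\<integral>\<omega>. complex_of_real (Im (W \<omega>)) * iexp (s * X \<omega>) \<partial>M)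
      = (\<integral>\<omega>. (W \<omega> * iexp (s * X \<omega>) - cnj (W \<omega>) * iexp (s * X \<omega>)) / (2 * \<i>) \<partial>M)" for s
  proof (intro Bochner_Integration.integral_cong refl)
    fix \<omega>
    have "W \<omega> * iexp (s * X \<omega>) - cnj (W \<omega>) * iexp (s * X \<omega>)
        = (2 * \<i>) * (complex_of_real (Im (W \<omega>)) * iexp (s * X \<omega>))"
      by (simp only: left_diff_distrib [symmetric] complex_diff_cnj) simp
    then show "complex_of_real (Im (W \<omega>)) * iexp (s * X \<omega>)
        = (W \<omega> * iexp (s * X \<omega>) - cnj (W \<omega>) * iexp (s * X \<omega>)) / (2 * \<i>)"
      by (simp only:) (simp add: field_simps)
  qed
  then have "(\<integral>\<omega>. complex_of_real (Im (W \<omega>)) * iexp (s * X \<omega>) \<partial>M) = 0" for s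
    using int by (simp add: zero cnj_zero del: of_real_mult)
  then have im: "(\<integral>\<omega>. Im (W \<omega>) * indicator E (X \<omega>) \<partial>M) = 0"
    using W by (intro fourier_zero_real) auto
  have int: "integrable M (\<lambda>\<omega>. W \<omega> * indicator E (X \<omega>))"
    using W by (rule Bochner_Integration.integrable_bound) (auto simp: indicator_def W)
  have *: "W \<omega> * indicator E (X \<omega>)
      = Complex (Re (W \<omega>) * indicator E (X \<omega>)) (Im (W \<omega>) * indicator E (X \<omega>))" for \<omega>
    by (auto simp: indicator_def complex_eq_iff)
  show ?thesis
    using integral_Re [OF int] integral_Im [OF int] re im
    by (intro complex_eqI) (simp_all add: *)
qed

text \<open>
  The exponentials are replaced by indicators one coordinate at a time; the other factors
  serve as the complex weight of the one-dimensional statement.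
\<close>

lemma fourier_zero_vec:
  fixes W :: "'a \<Rightarrow> complex" and V :: "'a \<Rightarrow> real ^ 'p::finite"
  assumes W: "integrable M W" and V [measurable]: "V \<in> borel_measurable M"
    and zero: "\<And>b. (\<integral>\<omega>. W \<omega> * iexp (b \<bullet> V \<omega>) \<partial>M) = 0"
    and E: "E \<in> sets borel"
  shows "(LINT \<omega>:V -` E \<inter> space M|M. W \<omega>) = 0"
proof -
  have [measurable]: "W \<in> borel_measurable M" using W by simp
  have [measurable]: "(\<lambda>\<omega>. V \<omega> $ j) \<in> borel_measurable M" for j
    using V by (rule measurable_compose) (intro borel_measurable_continuous_onI continuous_intros)
  \<comment> \<open>The coordinates in \<open>J\<close> already carry indicators. Quantifying over
    all \<open>b\<close> leaves the frequency of the next coordinate free, as the one-dimensional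
    statement demands.\<close>
  have partial: "(\<integral>\<omega>. W \<omega> * (\<Prod>j\<in>J. indicator (I j) (V \<omega> $ j)) * iexp (\<Sum>j\<in>-J. b j * V \<omega> $ j) \<partial>M) = 0"
    if "\<And>j. I j \<in> sets borel" for J :: "'p set" and I :: "'p \<Rightarrow> real set" and b
    using finite [of J] that
  proof (induction J arbitrary: b rule: finite_induct)
    case empty
    show ?case using zero [of "\<chi> j. b j"] by (simp add: inner_vec_def)
  next
    case (insert k J)
    have [measurable]: "I j \<in> sets borel" for j by (rule insert.prems)
    let ?U = "\<lambda>\<omega>. W \<omega> * (\<Prod>j\<in>J. indicator (I j) (V \<omega> $ j)) * iexp (\<Sum>j\<in>-insert k J. b j * V \<omega> $ j)"
    have "integrable M (\<lambda>\<omega>. W \<omega> * (\<Prod>j\<in>J. indicator (I j) (V \<omega> $ j)))"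
    proof (rule Bochner_Integration.integrable_bound [OF W])
      have "norm (\<Prod>j\<in>J. indicator (I j) (V \<omega> $ j) :: complex) \<le> 1" for \<omega>
        unfolding prod_norm [symmetric] by (intro prod_le_1) (auto simp: indicator_def)
      then show "AE \<omega> in M. norm (W \<omega> * (\<Prod>j\<in>J. indicator (I j) (V \<omega> $ j))) \<le> norm (W \<omega>)"
        by (intro AE_I2) (simp add: norm_mult mult_left_le)
    qed simp
    then have U: "integrable M ?U" by (rule integrable_mult_iexp) simp
    have "(\<integral>\<omega>. ?U \<omega> * iexp (s * V \<omega> $ k) \<partial>M) = 0" for s
    proof -
      have "(\<Sum>j\<in>-J. (b(k := s)) j * V \<omega> $ j) = (\<Sum>j\<in>-insert k J. b j * V \<omega> $ j) + s * V \<omega> $ k" for \<omega>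
      proof -
        have "- J = insert k (- insert k J)" using insert.hyps by auto
        then have "(\<Sum>j\<in>-J. (b(k := s)) j * V \<omega> $ j)
            = s * V \<omega> $ k + (\<Sum>j\<in>-insert k J. (b(k := s)) j * V \<omega> $ j)"
          by simp
        also have "(\<Sum>j\<in>-insert k J. (b(k := s)) j * V \<omega> $ j) = (\<Sum>j\<in>-insert k J. b j * V \<omega> $ j)"
          by (intro sum.cong) auto
        finally show ?thesis by simp
      qed
      then have *: "?U \<omega> * iexp (s * V \<omega> $ k)
          = W \<omega> * (\<Prod>j\<in>J. indicator (I j) (V \<omega> $ j)) * iexp (\<Sum>j\<in>-J. (b(k := s)) j * V \<omega> $ j)" for \<omega>
        by (simp only: of_real_add distrib_left exp_add mult.assoc)
      show ?thesis unfolding * by (rule insert.IH [OF insert.prems])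
    qed
    from fourier_zero [OF U _ this, of "I k"]
    have "(\<integral>\<omega>. ?U \<omega> * indicator (I k) (V \<omega> $ k) \<partial>M) = 0" by simp
    then show ?case using insert.hyps by (simp add: ac_simps)
  qed
  \<comment> \<open>Preimages of open boxes are closed under intersection, generate all preimages of
    Borel sets, and have indicators that are products over the coordinates.\<close>
  define G where "G = {V -` B \<inter> space M | B. B \<in> range (\<lambda>(a, b). box a b)}"
  show ?thesis
  proof (rule set_integral_zero_generated [OF W, where G = G])
    show "integral\<^sup>L M W = 0" using zero [of 0] by simp
    show "G \<subseteq> sets M" unfolding G_def by auto
    show "Int_stable G"
    proof (rule Int_stableI)
      fix A B assume "A \<in> G" "B \<in> G"
      then obtain a b c d where "A = V -` box a b \<inter> space M" "B = V -` box c d \<inter> space M"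
        by (auto simp: G_def)
      then have "A \<inter> B = V -` (box a b \<inter> box c d) \<inter> space M" by auto
      then show "A \<inter> B \<in> G" unfolding G_def box_Int_box by blast
    qed
    show "(LINT \<omega>:A|M. W \<omega>) = 0" if AG: "A \<in> G" for A
    proof -
      obtain a b where A: "A = V -` box a b \<inter> space M" using AG by (auto simp: G_def)
      have "indicator A \<omega> *\<^sub>R W \<omega> = W \<omega> * (\<Prod>j\<in>UNIV. indicator {a $ j<..<b $ j} (V \<omega> $ j))"
        if "\<omega> \<in> space M" for \<omega>
        using that by (auto simp: A mem_box_cart indicator_def prod_zero_iff)
      then have "(LINT \<omega>:A|M. W \<omega>) = (\<integral>\<omega>. W \<omega> * (\<Prod>j\<in>UNIV. indicator {a $ j<..<b $ j} (V \<omega> $ j)) \<partial>M)"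
        unfolding set_lebesgue_integral_def by (rule Bochner_Integration.integral_cong [OF refl])
      then show ?thesis using partial [of "\<lambda>j. {a $ j<..<b $ j}" UNIV "\<lambda>_. 0"] by simp
    qed
    have "sigma_sets (space M) G = {V -` B \<inter> space M | B. B \<in> sigma_sets UNIV (range (\<lambda>(a, b). box a b))}"
      unfolding G_def by (rule sigma_sets_vimage_commute [symmetric]) simp
    also have "sigma_sets UNIV (range (\<lambda>(a, b). box a b)) = sets (borel :: (real ^ 'p) measure)"
      by (subst borel_eq_box) simp
    finally show "V -` E \<inter> space M \<in> sigma_sets (space M) G" using E by blast
  qed
qed

end

section \<open>Measurability and independence\<close>

text \<open>The Doob-Dynkin lemma, by induction over nonnegative measurable functions. It will
  convert measurability with respect to the attacker's information back into the explicit function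
  that \<open>admissible\<close> demands.\<close>

lemma factorization_nonneg:
  fixes f :: "'a \<Rightarrow> ennreal"
  assumes X: "X \<in> \<Omega> \<rightarrow> space N" and f: "f \<in> borel_measurable (vimage_algebra \<Omega> X N)"
  shows "\<exists>g\<in>borel_measurable N. \<forall>\<omega>\<in>\<Omega>. f \<omega> = g (X \<omega>)"
  using f
proof (induction rule: borel_measurable_induct)
  case (cong f g)
  then show ?case by simp
next
  case (set A)
  then obtain B where "B \<in> sets N" "A = X -` B \<inter> \<Omega>"
    using sets_vimage_algebra2 [OF X] by auto
  then show ?case by (intro bexI [of _ "indicator B"]) (auto simp: indicator_def)
next
  case (mult u c)
  then obtain g where "g \<in> borel_measurable N" "\<forall>\<omega>\<in>\<Omega>. u \<omega> = g (X \<omega>)" using mult.IH by blast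
  then show ?case by (intro bexI [of _ "\<lambda>x. c * g x"]) auto
next
  case (add u v)
  then obtain g h where "g \<in> borel_measurable N" "\<forall>\<omega>\<in>\<Omega>. u \<omega> = g (X \<omega>)"
    "h \<in> borel_measurable N" "\<forall>\<omega>\<in>\<Omega>. v \<omega> = h (X \<omega>)" using add.IH by blast
  then show ?case by (intro bexI [of _ "\<lambda>x. h x + g x"]) auto
next
  case (seq U)
  then obtain g where "\<And>i::nat. g i \<in> borel_measurable N" "\<And>i \<omega>. \<omega> \<in> \<Omega> \<Longrightarrow> U i \<omega> = g i (X \<omega>)"
    by metis
  then show ?case by (intro bexI [of _ "\<lambda>x. SUP i. g i x"]) (auto simp: image_comp)
qed

lemma factorization_real:
  fixes f :: "'a \<Rightarrow> real"
  assumes X: "X \<in> \<Omega> \<rightarrow> space N" and f [measurable]: "f \<in> borel_measurable (vimage_algebra \<Omega> X N)"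
  shows "\<exists>g\<in>borel_measurable N. \<forall>\<omega>\<in>\<Omega>. f \<omega> = g (X \<omega>)"
proof -
  have "(\<lambda>\<omega>. ennreal (f \<omega>)) \<in> borel_measurable (vimage_algebra \<Omega> X N)" by measurable
  from factorization_nonneg [OF X this] obtain g
    where g: "g \<in> borel_measurable N" "\<forall>\<omega>\<in>\<Omega>. ennreal (f \<omega>) = g (X \<omega>)" by blast
  have "(\<lambda>\<omega>. ennreal (- f \<omega>)) \<in> borel_measurable (vimage_algebra \<Omega> X N)" by measurable
  from factorization_nonneg [OF X this] obtain h
    where h: "h \<in> borel_measurable N" "\<forall>\<omega>\<in>\<Omega>. ennreal (- f \<omega>) = h (X \<omega>)" by blast
  have eq: "enn2real (ennreal x) - enn2real (ennreal (- x)) = x" for x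
    by (cases "x \<ge> 0") (auto simp: ennreal_neg)
  show ?thesis
  proof (intro bexI ballI)
    show "f \<omega> = enn2real (g (X \<omega>)) - enn2real (h (X \<omega>))" if "\<omega> \<in> \<Omega>" for \<omega>
      using that by (metis eq g(2) h(2))
    show "(\<lambda>x. enn2real (g x) - enn2real (h x)) \<in> borel_measurable N" using g(1) h(1) by measurable
  qed
qed

lemma borel_measurable_vec_iff:
  fixes f :: "'a \<Rightarrow> real ^ 'n::finite"
  shows "f \<in> borel_measurable N \<longleftrightarrow> (\<forall>i. (\<lambda>x. f x $ i) \<in> borel_measurable N)"
proof
  assume "f \<in> borel_measurable N"
  then show "\<forall>i. (\<lambda>x. f x $ i) \<in> borel_measurable N"
    by (auto intro!: measurable_compose [of f N borel "\<lambda>v. v $ _"] borel_measurable_continuous_onI continuous_intros)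
next
  assume "\<forall>i. (\<lambda>x. f x $ i) \<in> borel_measurable N"
  then show "f \<in> borel_measurable N"
    by (subst borel_measurable_euclidean_space) (auto simp: Basis_vec_def inner_axis)
qed

lemma factorization_vec:
  fixes f :: "'a \<Rightarrow> real ^ 'n::finite"
  assumes X: "X \<in> \<Omega> \<rightarrow> space N" and f: "f \<in> borel_measurable (vimage_algebra \<Omega> X N)"
  shows "\<exists>g\<in>borel_measurable N. \<forall>\<omega>\<in>\<Omega>. f \<omega> = g (X \<omega>)"
proof -
  have "\<forall>i. \<exists>g\<in>borel_measurable N. \<forall>\<omega>\<in>\<Omega>. f \<omega> $ i = g (X \<omega>)"
    using factorization_real [OF X] f by (simp add: borel_measurable_vec_iff)
  then obtain g where "\<And>i. g i \<in> borel_measurable N" "\<And>i \<omega>. \<omega> \<in> \<Omega> \<Longrightarrow> f \<omega> $ i = g i (X \<omega>)"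
    by metis
  then show ?thesis
    by (intro bexI [of _ "\<lambda>x. \<chi> i. g i x"]) (auto simp: vec_eq_iff borel_measurable_vec_iff)
qed

lemma measurable_matrix_vector_mult [measurable (raw)]:
  fixes A :: "real ^ 'n::finite ^ 'm::finite"
  assumes "f \<in> borel_measurable N"
  shows "(\<lambda>x. A *v f x) \<in> borel_measurable N"
  using assms by (rule measurable_compose)
    (intro borel_measurable_continuous_onI linear_continuous_on matrix_vector_mul_bounded_linear)

lemma measurable_vcat [measurable (raw)]:
  fixes f :: "'a \<Rightarrow> real ^ 'n::finite" and g :: "'a \<Rightarrow> real ^ 'm::finite"
  assumes "f \<in> borel_measurable N" "g \<in> borel_measurable N"
  shows "(\<lambda>x. f x </> g x) \<in> borel_measurable N"
proof -
  have "(\<lambda>x. (f x </> g x) $ i) \<in> borel_measurable N" for i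
    using assms unfolding borel_measurable_vec_iff by (cases i) simp_all
  then show ?thesis unfolding borel_measurable_vec_iff ..
qed

context prob_space
begin

lemma indep_set_integral_mult:
  fixes X Y :: "'a \<Rightarrow> 'b::{real_normed_field, banach, second_countable_topology}"
  assumes ind: "indep_set (sets H) (sets G)" and sp: "space H = space M" "space G = space M"
    and X: "X \<in> borel_measurable H" "integrable M X" and Y: "Y \<in> borel_measurable G" "integrable M Y"
  shows "(\<integral>\<omega>. X \<omega> * Y \<omega> \<partial>M) = (\<integral>\<omega>. X \<omega> \<partial>M) * (\<integral>\<omega>. Y \<omega> \<partial>M)"
proof (rule indep_var_lebesgue_integral)
  have "{X -` A \<inter> space M | A. A \<in> sets borel} \<subseteq> sets H"
    using measurable_sets [OF X(1)] sp(1) by auto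
  from sets.sigma_sets_subset [OF this]
  have H: "sigma_sets (space M) {X -` A \<inter> space M | A. A \<in> sets borel} \<subseteq> sets H"
    by (simp only: sp)
  have "{Y -` A \<inter> space M | A. A \<in> sets borel} \<subseteq> sets G"
    using measurable_sets [OF Y(1)] sp(2) by auto
  from sets.sigma_sets_subset [OF this]
  have G: "sigma_sets (space M) {Y -` A \<inter> space M | A. A \<in> sets borel} \<subseteq> sets G"
    by (simp only: sp)
  have "indep_set (sigma_sets (space M) {X -` A \<inter> space M | A. A \<in> sets borel})
      (sigma_sets (space M) {Y -` A \<inter> space M | A. A \<in> sets borel})"
    using ind H G unfolding indep_sets2_eq by (meson subset_iff subset_trans)
  then show "indep_var borel X borel Y"
    using X(2) Y(2) unfolding indep_var_eq by simp
qed fact+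

end

section \<open>Square integrable vectors\<close>

text \<open>Measurability is required separately: integrability of the squared norm controls only
  the norm.\<close>

definition sq_integrable :: "'a measure \<Rightarrow> ('a \<Rightarrow> 'b::real_normed_vector) \<Rightarrow> bool"
  where "sq_integrable N f \<longleftrightarrow> f \<in> borel_measurable N \<and> integrable N (\<lambda>x. (norm (f x))\<^sup>2)"

lemma sq_integrable_measurable: "sq_integrable N f \<Longrightarrow> f \<in> borel_measurable N"
  by (simp add: sq_integrable_def)

lemma sq_integrable_bound:
  fixes f :: "'a \<Rightarrow> 'b::{real_normed_vector, second_countable_topology}"
  assumes "integrable N g" "f \<in> borel_measurable N" "\<And>x. x \<in> space N \<Longrightarrow> (norm (f x))\<^sup>2 \<le> g x"
  shows "sq_integrable N f"
  unfolding sq_integrable_def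
proof
  have [measurable]: "f \<in> borel_measurable N" by fact
  show "integrable N (\<lambda>x. (norm (f x))\<^sup>2)"
    using assms(1)
  proof (rule Bochner_Integration.integrable_bound)
    show "AE x in N. norm ((norm (f x))\<^sup>2) \<le> norm (g x)"
      using assms(3) by (intro AE_I2) (smt (verit) real_norm_def zero_le_power2)
  qed measurable
qed fact

lemma sq_integrable_add:
  fixes f g :: "'a \<Rightarrow> 'b::{real_normed_vector, second_countable_topology}"
  assumes "sq_integrable N f" "sq_integrable N g"
  shows "sq_integrable N (\<lambda>x. f x + g x)"
proof (rule sq_integrable_bound)
  show "integrable N (\<lambda>x. 2 * (norm (f x))\<^sup>2 + 2 * (norm (g x))\<^sup>2)"
    using assms by (auto simp: sq_integrable_def)
  show "(\<lambda>x. f x + g x) \<in> borel_measurable N"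
    using assms by (auto simp: sq_integrable_def)
  show "(norm (f x + g x))\<^sup>2 \<le> 2 * (norm (f x))\<^sup>2 + 2 * (norm (g x))\<^sup>2" for x
  proof -
    have "(norm (f x + g x))\<^sup>2 \<le> (norm (f x) + norm (g x))\<^sup>2"
      by (intro power_mono norm_triangle_ineq) simp
    also have "\<dots> \<le> 2 * (norm (f x))\<^sup>2 + 2 * (norm (g x))\<^sup>2"
      using zero_le_power2 [of "norm (f x) - norm (g x)"] by (simp add: power2_eq_square algebra_simps)
    finally show ?thesis .
  qed
qed

lemma sq_integrable_bounded_linear:
  fixes f :: "'a \<Rightarrow> 'b::{real_normed_vector, second_countable_topology}"
    and h :: "'b \<Rightarrow> 'c::{real_normed_vector, second_countable_topology}"
  assumes h: "bounded_linear h" and f: "sq_integrable N f"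
  shows "sq_integrable N (\<lambda>x. h (f x))"
proof -
  obtain K where K: "\<And>x. norm (h x) \<le> norm x * K" using bounded_linear.bounded [OF h] by blast
  show ?thesis
  proof (rule sq_integrable_bound)
    show "integrable N (\<lambda>x. (norm (f x))\<^sup>2 * K\<^sup>2)"
      using f by (auto simp: sq_integrable_def)
    show "(\<lambda>x. h (f x)) \<in> borel_measurable N"
      using f by (intro measurable_compose [of f _ borel h] borel_measurable_continuous_onI
          linear_continuous_on h) (auto simp: sq_integrable_def)
    show "(norm (h (f x)))\<^sup>2 \<le> (norm (f x))\<^sup>2 * K\<^sup>2" for x
      using power_mono [OF K norm_ge_zero, of "f x" 2] by (simp add: power_mult_distrib)
  qed
qed

lemma sq_integrable_matrix_mult:
  fixes A :: "real ^ 'n::finite ^ 'm::finite"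
  shows "sq_integrable N f \<Longrightarrow> sq_integrable N (\<lambda>x. A *v f x)"
  by (rule sq_integrable_bounded_linear [OF matrix_vector_mul_bounded_linear])

lemma sq_integrable_cong:
  assumes "sq_integrable N f" "\<And>\<omega>. \<omega> \<in> space N \<Longrightarrow> f \<omega> = g \<omega>"
  shows "sq_integrable N g"
  using assms unfolding sq_integrable_def
  by (metis (mono_tags, lifting) Bochner_Integration.integrable_cong measurable_cong)

lemma sq_integrable_uminus:
  fixes f :: "'a \<Rightarrow> 'b::{real_normed_vector, second_countable_topology}"
  shows "sq_integrable N f \<Longrightarrow> sq_integrable N (\<lambda>x. - f x)"
  by (intro sq_integrable_bounded_linear [OF bounded_linear_minus [OF bounded_linear_ident]])

lemma sq_integrable_diff:
  fixes f g :: "'a \<Rightarrow> 'b::{real_normed_vector, second_countable_topology}"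
  assumes "sq_integrable N f" "sq_integrable N g"
  shows "sq_integrable N (\<lambda>x. f x - g x)"
  using sq_integrable_add [OF assms(1) sq_integrable_uminus [OF assms(2)]] by simp

lemma sq_integrable_nth:
  fixes f :: "'a \<Rightarrow> real ^ 'n::finite"
  shows "sq_integrable N f \<Longrightarrow> sq_integrable N (\<lambda>x. f x $ i)"
  by (intro sq_integrable_bounded_linear [OF bounded_linear_vec_nth])

lemma sq_integrable_vcat:
  fixes f :: "'a \<Rightarrow> real ^ 'n::finite" and g :: "'a \<Rightarrow> real ^ 'm::finite"
  assumes "sq_integrable N f" "sq_integrable N g"
  shows "sq_integrable N (\<lambda>x. f x </> g x)"
proof (rule sq_integrable_bound)
  show "integrable N (\<lambda>x. (norm (f x))\<^sup>2 + (norm (g x))\<^sup>2)"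
    using assms by (auto simp: sq_integrable_def)
  show "(\<lambda>x. f x </> g x) \<in> borel_measurable N"
    using assms by (auto simp: sq_integrable_def)
qed (simp add: power2_norm_eq_inner inner_vcat)

lemma sq_integrable_inner:
  fixes f g :: "'a \<Rightarrow> 'b::euclidean_space"
  assumes "sq_integrable N f" "sq_integrable N g"
  shows "integrable N (\<lambda>x. f x \<bullet> g x)"
proof (rule Bochner_Integration.integrable_bound)
  show "integrable N (\<lambda>x. (norm (f x))\<^sup>2 + (norm (g x))\<^sup>2)"
    using assms by (auto simp: sq_integrable_def)
  show "(\<lambda>x. f x \<bullet> g x) \<in> borel_measurable N"
    using assms by (auto simp: sq_integrable_def)
  show "AE x in N. norm (f x \<bullet> g x) \<le> norm ((norm (f x))\<^sup>2 + (norm (g x))\<^sup>2)"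
  proof (intro AE_I2)
    fix x
    have "norm (f x \<bullet> g x) \<le> norm (f x) * norm (g x)"
      using Cauchy_Schwarz_ineq2 by simp
    also have "\<dots> \<le> (norm (f x))\<^sup>2 + (norm (g x))\<^sup>2"
      using zero_le_power2 [of "norm (f x) - norm (g x)"] zero_le_power2 [of "norm (f x)"]
        zero_le_power2 [of "norm (g x)"] unfolding power2_diff by linarith
    finally show "norm (f x \<bullet> g x) \<le> norm ((norm (f x))\<^sup>2 + (norm (g x))\<^sup>2)" by simp
  qed
qed

lemma sq_integrable_qform:
  "sq_integrable N f \<Longrightarrow> integrable N (\<lambda>x. qform A (f x))"
  unfolding qform_def by (intro sq_integrable_inner sq_integrable_matrix_mult)

lemma (in prob_space) sq_integrable_const: "sq_integrable M (\<lambda>_. c)"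
  by (simp add: sq_integrable_def)

lemma (in prob_space) sq_integrable_integrable:
  fixes f :: "'a \<Rightarrow> real"
  assumes "sq_integrable M f"
  shows "integrable M f"
  using sq_integrable_inner [OF assms sq_integrable_const [of 1]] by simp

section \<open>Centred Gaussian vectors\<close>

context prob_space
begin

lemma gaussian_measurable: "gaussian M X \<Sigma> \<Longrightarrow> X \<in> borel_measurable M"
  by (simp add: gaussian_def)

text \<open>A singular covariance makes some projections constant, with a law that has no density;
  the results on normal densities apply only to the other case.\<close>

lemma gaussian_inner_cases:
  assumes X: "gaussian M X \<Sigma>"
  obtains (degenerate) "qform \<Sigma> a = 0" "AE \<omega> in M. a \<bullet> X \<omega> = 0"
    | (normal) "qform \<Sigma> a > 0"
      "distributed M lborel (\<lambda>\<omega>. a \<bullet> X \<omega>) (normal_density 0 (sqrt (qform \<Sigma> a)))"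
proof -
  have [measurable]: "X \<in> borel_measurable M" using X by (rule gaussian_measurable)
  have law: "distr M borel (\<lambda>\<omega>. a \<bullet> X \<omega>) = centered_normal (qform \<Sigma> a)"
    using X by (simp add: gaussian_def)
  have "qform \<Sigma> a \<ge> 0" using X by (simp add: gaussian_def possemidef_def)
  then consider "qform \<Sigma> a = 0" | "qform \<Sigma> a > 0" by linarith
  then show thesis
  proof cases
    case 1
    have "AE x in distr M borel (\<lambda>\<omega>. a \<bullet> X \<omega>). x = 0"
      unfolding law centered_normal_def using 1 by (simp add: AE_return)
    then show thesis using 1 by (intro degenerate) (simp_all add: AE_distr_iff)
  next
    case 2
    have "distr M lborel (\<lambda>\<omega>. a \<bullet> X \<omega>) = distr M borel (\<lambda>\<omega>. a \<bullet> X \<omega>)"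
      by (intro distr_cong) auto
    then show thesis
      using 2 law by (intro normal) (auto simp: distributed_def centered_normal_def)
  qed
qed

lemma gaussian_char:
  assumes X: "gaussian M X \<Sigma>"
  shows "(\<integral>\<omega>. iexp (a \<bullet> X \<omega>) \<partial>M) = exp (- qform \<Sigma> a / 2)"
proof (cases rule: gaussian_inner_cases [OF X, of a, case_names degenerate normal])
  case degenerate
  have [measurable]: "X \<in> borel_measurable M" using X by (rule gaussian_measurable)
  have "(\<integral>\<omega>. iexp (a \<bullet> X \<omega>) \<partial>M) = (\<integral>\<omega>. 1 \<partial>M)"
    using degenerate(2) by (intro integral_cong_AE) (auto elim!: eventually_mono)
  then show ?thesis using degenerate(1) by (simp add: prob_space)
next
  case normal
  have [measurable]: "X \<in> borel_measurable M" using X by (rule gaussian_measurable)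
  define s where "s = sqrt (qform \<Sigma> a)"
  have s: "s > 0" "s\<^sup>2 = qform \<Sigma> a" using normal(1) by (auto simp: s_def)
  have "distributed M lborel (\<lambda>\<omega>. (a \<bullet> X \<omega> - 0) / s) std_normal_density"
    using normal(2) normal_standard_normal_convert [OF s(1)] by (simp add: s_def)
  then have "distr M lborel (\<lambda>\<omega>. a \<bullet> X \<omega> / s) = std_normal_distribution"
    by (simp add: distributed_def)
  moreover have "distr M lborel (\<lambda>\<omega>. a \<bullet> X \<omega> / s) = distr M borel (\<lambda>\<omega>. a \<bullet> X \<omega> / s)"
    by (intro distr_cong) auto
  ultimately have "char (distr M borel (\<lambda>\<omega>. a \<bullet> X \<omega> / s)) s = exp (- (s\<^sup>2) / 2)"
    by (simp add: char_std_normal_distribution)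
  moreover have "char (distr M borel (\<lambda>\<omega>. a \<bullet> X \<omega> / s)) s = (\<integral>\<omega>. iexp (a \<bullet> X \<omega>) \<partial>M)"
    unfolding char_def using s(1) by (subst integral_distr) auto
  ultimately show ?thesis by (simp add: s(2))
qed

lemma gaussian_inner_moments:
  assumes X: "gaussian M X \<Sigma>"
  shows "integrable M (\<lambda>\<omega>. (a \<bullet> X \<omega>)\<^sup>2)" "(\<integral>\<omega>. a \<bullet> X \<omega> \<partial>M) = 0"
proof -
  have [measurable]: "X \<in> borel_measurable M" using X by (rule gaussian_measurable)
  have "integrable M (\<lambda>\<omega>. (a \<bullet> X \<omega>)\<^sup>2) \<and> (\<integral>\<omega>. a \<bullet> X \<omega> \<partial>M) = 0"
  proof (cases rule: gaussian_inner_cases [OF X, of a, case_names degenerate normal])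
    case degenerate
    have "integrable M (\<lambda>\<omega>. (a \<bullet> X \<omega>)\<^sup>2) \<longleftrightarrow> integrable M (\<lambda>\<omega>. 0 :: real)"
      using degenerate(2) by (intro integrable_cong_AE) (auto elim!: eventually_mono)
    moreover have "(\<integral>\<omega>. a \<bullet> X \<omega> \<partial>M) = 0"
      using degenerate(2) by (rule integral_eq_zero_AE)
    ultimately show ?thesis by simp
  next
    case normal
    have s: "0 < sqrt (qform \<Sigma> a)" using normal(1) by simp
    have "integrable M (\<lambda>\<omega>. (a \<bullet> X \<omega>)\<^sup>2)"
      using distributed_integrable [OF normal(2), of "\<lambda>x. x\<^sup>2"] integrable_normal_moment [OF s, of 0 2]
      by simp
    moreover have "(\<integral>\<omega>. a \<bullet> X \<omega> \<partial>M) = 0"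
      using distributed_integral [OF normal(2), of "\<lambda>x. x"] integral_normal_moment_nz_1 [OF s, of 0]
      by simp
    ultimately show ?thesis ..
  qed
  then show "integrable M (\<lambda>\<omega>. (a \<bullet> X \<omega>)\<^sup>2)" "(\<integral>\<omega>. a \<bullet> X \<omega> \<partial>M) = 0" by auto
qed

lemma gaussian_sq_integrable:
  fixes X :: "'a \<Rightarrow> real ^ 'n::finite"
  assumes X: "gaussian M X \<Sigma>"
  shows "sq_integrable M X"
proof -
  have "(norm (X \<omega>))\<^sup>2 = (\<Sum>i\<in>UNIV. (axis i 1 \<bullet> X \<omega>)\<^sup>2)" for \<omega>
    unfolding inner_axis' by (simp add: norm_vec_def L2_set_def sum_nonneg)
  then show ?thesis
    using gaussian_measurable [OF X] gaussian_inner_moments(1) [OF X]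
    by (simp add: sq_integrable_def)
qed

lemma gaussian_nth_mean:
  fixes X :: "'a \<Rightarrow> real ^ 'n::finite"
  assumes X: "gaussian M X \<Sigma>"
  shows "(\<integral>\<omega>. X \<omega> $ i \<partial>M) = 0"
  using gaussian_inner_moments(2) [OF X, of "axis i 1"] by (simp add: inner_axis')

end

section \<open>Trajectories\<close>

text \<open>
  The attacker's prediction error \<open>x\<^sub>t - x\<^sub>t\<^sub>|\<^sub>t\<^sub>-\<^sub>1\<close>, which does not depend on the attack.
\<close>

primrec pred_err :: "('n::finite, 'm::finite, 's::finite, 'p::finite) model \<Rightarrow>
    ('n, 'p) realization \<Rightarrow> nat \<Rightarrow> real ^ 'n"
  where
    "pred_err S r 0 = init_state r - init_pred r"
  | "pred_err S r (Suc t) = mA S *v (pred_err S r t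
      - mK S *v (mC S *v pred_err S r t + meas_noise r t)) + proc_noise r t"

definition nom_innov :: "('n::finite, 'm::finite, 's::finite, 'p::finite) model \<Rightarrow>
    ('n, 'p) realization \<Rightarrow> nat \<Rightarrow> real ^ 'p"
  where "nom_innov S r t = mC S *v pred_err S r t + meas_noise r t"

definition est_err :: "('n::finite, 'm::finite, 's::finite, 'p::finite) model \<Rightarrow>
    ('n, 'p) realization \<Rightarrow> nat \<Rightarrow> real ^ 'n"
  where "est_err S r t = pred_err S r t - mK S *v nom_innov S r t"

lemma pred_err_Suc: "pred_err S r (Suc t) = mA S *v est_err S r t + proc_noise r t"
  by (simp add: est_err_def nom_innov_def)

declare pred_err.simps(2) [simp del]

text \<open>The control input and the attack enter the plant and the attacker's filter identically,
  so they cancel in the difference; only initial error and noise remain.\<close>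

lemma plant_state_eq: "plant_state S r e t = att_pred S r e t + pred_err S r t"
proof (induction t)
  case (Suc t)
  have "att_innov S r e t = nom_innov S r t"
    by (simp add: att_output_def Suc nom_innov_def matvec)
  then show ?case
    unfolding plant_state.simps(2) att_pred.simps(2) att_est.simps
    by (simp only: Suc pred_err_Suc est_err_def matvec) (simp add: algebra_simps)
qed simp

lemma att_innov_eq: "att_innov S r e t = nom_innov S r t"
  by (simp add: att_output_def plant_state_eq nom_innov_def matvec)

lemma att_est_eq: "att_est S r e t = att_pred S r e t + mK S *v nom_innov S r t"
  by (simp only: att_est.simps att_innov_eq)

lemma plant_state_eq_att_est: "plant_state S r e t = att_est S r e t + est_err S r t"
  by (simp only: plant_state_eq att_est_eq est_err_def) simp

text \<open>Without attack the system's filter and the attacker's filter receive the same outputs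
  and inputs, hence make the same predictions.\<close>

lemma sys_innov_no_attack: "sys_innov S r (\<lambda>_. 0) t = nom_innov S r t"
proof -
  have "sys_pred S r (\<lambda>_. 0) t = att_pred S r (\<lambda>_. 0) t"
  proof (induction t)
    case (Suc t)
    then have "sys_est S r (\<lambda>_. 0) t = att_est S r (\<lambda>_. 0) t"
      by (simp add: att_output_def)
    then show ?case
      unfolding sys_pred.simps(2) att_pred.simps(2) sys_input.simps mABL_def
      by (simp only: matvec) simp
  qed simp
  then show ?thesis by (simp add: plant_state_eq nom_innov_def matvec)
qed

lemma sys_est_no_attack:
  "sys_est S r (\<lambda>_. 0) t = sys_pred S r (\<lambda>_. 0) t + mK S *v nom_innov S r t"
  by (simp only: sys_est.simps sys_innov_no_attack)

text \<open>
  With \<open>\<theta> = (\<theta>\<^sub>1, \<theta>\<^sub>2, \<theta>\<^sub>3)\<close>: the attack shifts the previous estimate of the system by \<open>\<theta>\<^sub>1\<close>, and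
  it shifts the state by \<open>\<theta>\<^sub>3\<close> directly and by \<open>\<theta>\<^sub>2 + B L \<theta>\<^sub>1\<close> through the inputs.
\<close>

lemma attack_effect:
  "\<exists>\<theta>1 \<theta>2 \<theta>3. theta S e t = (\<theta>1 </> \<theta>2 </> \<theta>3)
    \<and> plant_state S r e t = plant_state S r (\<lambda>_. 0) t + (\<theta>2 + mB S *v (mL S *v \<theta>1) + \<theta>3)
    \<and> sys_pred S r e t = sys_pred S r (\<lambda>_. 0) t + mABL S *v \<theta>1
    \<and> sys_innov S r e t = nom_innov S r t + theta_C S *v theta S e t + mPsi S *v e t
    \<and> sys_est S r e t = sys_est S r (\<lambda>_. 0) t + aug_Omega S *v theta S e t
        + mK S *v (mPsi S *v e t)"
  (is "\<exists>\<theta>1 \<theta>2 \<theta>3. ?th t \<theta>1 \<theta>2 \<theta>3 \<and> ?x t \<theta>1 \<theta>2 \<theta>3 \<and> ?pred t \<theta>1 \<and> ?innov t \<and> ?est t")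
proof (induction t)
  case 0
  show ?case
  proof (intro exI conjI)
    show "?th 0 0 0 0" by (simp add: vcat_zero)
    show "?innov 0"
      using sys_innov_no_attack [of S r 0] by (simp add: algebra_simps)
    then show "?est 0" by (simp only: sys_est.simps) (simp add: sys_innov_no_attack [of S r 0, simplified] matvec)
  qed simp_all
next
  case (Suc t)
  then obtain \<theta>1 \<theta>2 \<theta>3 where IH: "?th t \<theta>1 \<theta>2 \<theta>3" "?x t \<theta>1 \<theta>2 \<theta>3" "?est t" by blast
  \<comment> \<open>\<open>\<eta>\<close> is the shift of the system's estimate at t, which becomes
    the first block of the next \<open>theta\<close>.\<close>
  define \<eta> where "\<eta> = aug_Omega S *v theta S e t + mK S *v (mPsi S *v e t)"
  have th: "?th (Suc t) \<eta> (mA S *v (mB S *v (mL S *v \<theta>1)) + mA S *v \<theta>2) (mA S *v \<theta>3 + mGamma S *v e t)"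
    unfolding theta.simps \<eta>_def IH(1) theta_A_def theta_B_def aug_Omega_def
    by (simp add: block_simps) (simp add: matvec)
  have est: "sys_est S r e t = sys_est S r (\<lambda>_. 0) t + \<eta>"
    using IH(3) unfolding \<eta>_def by (simp only: add.assoc)
  have x: "?x (Suc t) \<eta> (mA S *v (mB S *v (mL S *v \<theta>1)) + mA S *v \<theta>2) (mA S *v \<theta>3 + mGamma S *v e t)"
    unfolding plant_state.simps(2) sys_input.simps est IH(2)
    by (simp only: matvec) (simp add: algebra_simps)
  have pred: "?pred (Suc t) \<eta>"
    unfolding sys_pred.simps(2) est by (simp only: matvec)
  have innov: "?innov (Suc t)"
  proof -
    have "sys_innov S r e (Suc t) = sys_innov S r (\<lambda>_. 0) (Suc t) + theta_C S *v theta S e (Suc t)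
        + mPsi S *v e (Suc t)"
      unfolding sys_innov.simps plant_output.simps x pred unfolding th theta_C_def
      by (simp add: block_simps mABL_def del: plant_state.simps sys_pred.simps)
        (simp add: matvec algebra_simps del: plant_state.simps sys_pred.simps)
    then show ?thesis by (simp only: sys_innov_no_attack)
  qed
  have "?est (Suc t)"
    unfolding sys_est_no_attack unfolding sys_est.simps innov pred unfolding th theta_C_def aug_Omega_def
    by (simp add: block_simps mABL_def del: sys_pred.simps)
      (simp add: matvec algebra_simps del: sys_pred.simps)
  with th x pred innov show ?case by blast
qed

lemma sys_innov_eq:
  "sys_innov S r e t = nom_innov S r t + theta_C S *v theta S e t + mPsi S *v e t"
  using attack_effect by metis

lemma sys_est_eq:
  "sys_est S r e t = sys_est S r (\<lambda>_. 0) t + aug_Omega S *v theta S e t + mK S *v (mPsi S *v e t)"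
  using attack_effect by metis

text \<open>The attacker's filter and the unattacked system filter have the same innovation and
  gain, so both estimates receive the same update; the attack effect and the target stay free of
  noise.\<close>

definition aug_K :: "('n::finite, 'm::finite, 's::finite, 'p::finite) model \<Rightarrow> real ^ 'p ^ 'n aug"
  where "aug_K S = mK S </> 0 </> mK S </> 0"

lemma aug_state_0:
  "aug_state S r xs e 0 = (init_pred r + mK S *v nom_innov S r 0 </> 0
    </> init_pred r + mK S *v nom_innov S r 0 </> xs)"
  by (simp only: aug_state_def att_est_eq sys_est_no_attack att_pred.simps sys_pred.simps theta.simps)

lemma aug_state_Suc:
  "aug_state S r xs e (Suc t) = aug_A S *v aug_state S r xs e t + aug_B S *v e t
    + aug_K S *v nom_innov S r (Suc t)"
  unfolding aug_state_def att_est_eq [of S r e "Suc t"] sys_est_no_attack [of S r "Suc t"]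
    att_pred.simps(2) sys_pred.simps(2) sys_input.simps theta.simps(2) sys_est_eq [of S r e t]
    aug_A_def aug_B_def aug_K_def
  by (simp add: block_simps del: att_est.simps sys_est.simps)
    (simp add: matvec algebra_simps del: att_est.simps sys_est.simps)

lemma aug_H_aug_state: "aug_H *v aug_state S r xs e t = att_est S r e t - xs"
  by (simp add: aug_H_def aug_state_def block_simps uminus_matrix_vector_mult del: att_est.simps)

lemma att_est_fst_block: "att_est S r e t = (mat 1 <|> 0) *v aug_state S r xs e t"
  by (simp add: aug_state_def block_simps del: att_est.simps)

text \<open>The attacker steers its own estimate; the gap to the true state does not depend on the
  attack and enters the state block as an additive offset.\<close>

lemma stage_cost_eq:
  "qform Q (plant_state S r e t - xs) + qform R (sys_innov S r e t) =
    qform (aug_F Q R) (aug_C S *v aug_state S r xs e t + aug_D S *v e t + aug_M *v nom_innov S r t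
      + (est_err S r t </> 0))"
proof -
  have "aug_C S *v aug_state S r xs e t + aug_D S *v e t + aug_M *v nom_innov S r t + (est_err S r t </> 0)
    = (plant_state S r e t - xs </> sys_innov S r e t)"
    unfolding aug_C_def aug_D_def aug_M_def vcat_mult aug_H_aug_state
    unfolding aug_Ctilde_def aug_state_def plant_state_eq_att_est sys_innov_eq
    by (simp add: block_simps algebra_simps del: att_est.simps)
  then show ?thesis by (simp add: qform_aug_F)
qed

section \<open>The attacker's information\<close>

lemma sets_vimage_algebra_measurable:
  assumes "X \<in> measurable N K" "space N = \<Omega>"
  shows "sets (vimage_algebra \<Omega> X K) = {X -` E \<inter> \<Omega> | E. E \<in> sets K}"
  using assms by (intro sets_vimage_algebra2) (auto dest: measurable_space)

lemma measurable_into_larger: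
  assumes "f \<in> measurable N K" "sets N \<subseteq> sets N'" "space N = space N'"
  shows "f \<in> measurable N' K"
  using assms by (auto simp: measurable_def)

lemma (in prob_space) indep_set_subset:
  assumes "indep_set \<A> \<B>" "\<A>' \<subseteq> \<A>" "\<B>' \<subseteq> \<B>"
  shows "indep_set \<A>' \<B>'"
  using assms unfolding indep_sets2_eq by (meson subset_iff subset_trans)

lemma (in prob_space) indep_rv_vimage_algebra:
  assumes "indep_rv K X L Y"
  shows "indep_set (sets (vimage_algebra (space M) X K)) (sets (vimage_algebra (space M) Y L))"
  using assms unfolding indep_rv_def
  by (simp add: sets_vimage_algebra_measurable [of _ M])

lemma inner_measurable:
  fixes X :: "'a \<Rightarrow> real ^ 'k::finite"
  assumes "X \<in> borel_measurable N"
  shows "(\<lambda>\<omega>. a \<bullet> X \<omega>) \<in> borel_measurable N"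
  using assms by measurable

lemma exp_half_mult: "exp (- x / 2) * exp (- y / 2) = exp (- (x + y) / 2)" for x y :: real
  unfolding exp_add [symmetric] by (simp add: field_simps)

context prob_space
begin

lemma integrable_indicator_complex:
  assumes "A \<in> events"
  shows "integrable M (indicator A :: 'a \<Rightarrow> complex)"
proof (rule Bochner_Integration.integrable_bound)
  show "integrable M (\<lambda>_. 1 :: real)" by simp
qed (use assms in \<open>auto simp: indicator_def\<close>)

lemma integral_indicator_complex:
  assumes A: "A \<in> events"
  shows "(\<integral>\<omega>. indicator A \<omega> \<partial>M) = complex_of_real (prob A)"
proof -
  have "(\<integral>\<omega>. indicator A \<omega> \<partial>M) = (\<integral>\<omega>. complex_of_real (indicator A \<omega>) \<partial>M)"
    by (intro Bochner_Integration.integral_cong) (auto simp: indicator_def)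
  then show ?thesis
    using sets.sets_into_space [OF A] by (simp add: Int_absorb2)
qed

lemma integrable_indicator_iexp:
  assumes "A \<in> events" "X \<in> borel_measurable M"
  shows "integrable M (\<lambda>\<omega>. indicator A \<omega> * iexp (X \<omega>))"
proof -
  show ?thesis using integrable_indicator_complex [OF assms(1)] assms(2) by (rule integrable_mult_iexp)
qed

end

lemma integral_indicator_mult_set:
  fixes f :: "'a \<Rightarrow> complex"
  shows "(\<integral>\<omega>. indicator A \<omega> * f \<omega> \<partial>N) = (LINT \<omega>:A|N. f \<omega>)"
  unfolding set_lebesgue_integral_def by (intro Bochner_Integration.integral_cong) (auto simp: indicator_def)

context attack_setting
begin

section \<open>The sigma-algebra of the past and its independence of the present noise\<close>

abbreviation "noise k \<omega> \<equiv> (proc_noise (\<rho> \<omega>) k, meas_noise (\<rho> \<omega>) k)"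

abbreviation "initial \<omega> \<equiv> (restrict (pre_output (\<rho> \<omega>)) {..<0}, init_state (\<rho> \<omega>), init_pred (\<rho> \<omega>))"

abbreviation "initial_space \<equiv> (\<Pi>\<^sub>M i\<in>{..<(0::int)}. (borel :: (real ^ 'p) measure))
  \<Otimes>\<^sub>M ((borel :: (real ^ 'n) measure) \<Otimes>\<^sub>M (borel :: (real ^ 'n) measure))"

abbreviation "noise_space \<equiv> (borel :: (real ^ 'n) measure) \<Otimes>\<^sub>M (borel :: (real ^ 'p) measure)"

abbreviation "noise_alg k \<equiv> vimage_algebra (space M) (noise k) noise_space"

text \<open>Generated by intersections instead of by a joint map: these form a pi-system on which
  independence can be checked from the separate independence assumptions. The noise of time t itself
  is excluded.\<close>

definition past :: "nat \<Rightarrow> 'a measure"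
  where "past t = sigma (space M)
    {A \<inter> B | A B. A \<in> sets (vimage_algebra (space M) initial initial_space)
      \<and> B \<in> sets (vimage_algebra (space M) (\<lambda>\<omega>. restrict (\<lambda>k. noise k \<omega>) {..<t}) (\<Pi>\<^sub>M k\<in>{..<t}. noise_space))}"

lemma initial_measurable: "initial \<in> measurable M initial_space"
  using noise_indep_init by (simp add: indep_rv_def)

lemma noise_measurable: "noise k \<in> measurable M noise_space"
  using noise_indep_time by (simp add: indep_vars_def)

lemma noise_restrict_measurable:
  "(\<lambda>\<omega>. restrict (\<lambda>k. noise k \<omega>) I) \<in> measurable M (\<Pi>\<^sub>M k\<in>I. noise_space)"
  using noise_measurable by (intro measurable_restrict) auto

lemmas sets_noise_alg = sets_vimage_algebra_measurable [OF noise_measurable refl]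
lemmas sets_noise_restrict_alg = sets_vimage_algebra_measurable [OF noise_restrict_measurable refl]

lemma space_past [simp]: "space (past t) = space M"
  unfolding past_def by (rule space_measure_of) (use sets.sets_into_space in fastforce)

lemma sets_past: "sets (past t) = sigma_sets (space M)
    {A \<inter> B | A B. A \<in> sets (vimage_algebra (space M) initial initial_space)
      \<and> B \<in> sets (vimage_algebra (space M) (\<lambda>\<omega>. restrict (\<lambda>k. noise k \<omega>) {..<t}) (\<Pi>\<^sub>M k\<in>{..<t}. noise_space))}"
  unfolding past_def by (rule sets_measure_of) (use sets.sets_into_space in fastforce)

text \<open>For A from the initial data, B from the earlier noise and C from the present noise, A
  splits off the noise event B \<inter> C by independence of the initial data, and B splits from C
  by independence over time. The pi-system extends this to \<open>past t\<close>.\<close>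

lemma indep_past_noise: "indep_set (sets (past t)) (sets (noise_alg t))"
proof -
  let ?I = "sets (vimage_algebra (space M) initial initial_space)"
  let ?N = "sets (vimage_algebra (space M) (\<lambda>\<omega>. restrict (\<lambda>k. noise k \<omega>) {..<t}) (\<Pi>\<^sub>M k\<in>{..<t}. noise_space))"
  let ?G = "{A \<inter> B | A B. A \<in> ?I \<and> B \<in> ?N}"
  let ?J = "sets (vimage_algebra (space M) (\<lambda>\<omega> k. noise k \<omega>) (\<Pi>\<^sub>M k\<in>UNIV. noise_space))"
  have proc: "(\<lambda>\<omega> k. noise k \<omega>) \<in> measurable M (\<Pi>\<^sub>M k\<in>UNIV. noise_space)"
    using noise_indep_init by (simp add: indep_rv_def)
  have meas_J: "(\<lambda>\<omega> k. noise k \<omega>) \<in> measurable (vimage_algebra (space M) (\<lambda>\<omega> k. noise k \<omega>) (\<Pi>\<^sub>M k\<in>UNIV. noise_space))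
      (\<Pi>\<^sub>M k\<in>UNIV. noise_space)"
    using proc by (intro measurable_vimage_algebra1) (auto dest: measurable_space)
  have IJ: "indep_set ?J ?I"
    using noise_indep_init by (rule indep_rv_vimage_algebra)
  have subI: "?I \<subseteq> events" using IJ by (simp add: indep_sets2_eq)
  have NJ: "?N \<subseteq> ?J"
  proof (rule sets_image_in_sets)
    show "(\<lambda>\<omega>. restrict (\<lambda>k. noise k \<omega>) {..<t}) \<in>
        measurable (vimage_algebra (space M) (\<lambda>\<omega> k. noise k \<omega>) (\<Pi>\<^sub>M k\<in>UNIV. noise_space)) (\<Pi>\<^sub>M k\<in>{..<t}. noise_space)"
      using measurable_compose [OF meas_J measurable_restrict_subset [of "{..<t}" UNIV]] by simp
  qed simp
  have CJ: "sets (noise_alg t) \<subseteq> ?J"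
  proof (rule sets_image_in_sets)
    show "noise t \<in> measurable (vimage_algebra (space M) (\<lambda>\<omega> k. noise k \<omega>) (\<Pi>\<^sub>M k\<in>UNIV. noise_space)) noise_space"
      using measurable_compose [OF meas_J measurable_component_singleton [of t UNIV]] by simp
  qed simp
  have NC: "prob (B \<inter> C) = prob B * prob C" if B: "B \<in> ?N" and C: "C \<in> sets (noise_alg t)" for B C
  proof -
    have ind: "indep_var (\<Pi>\<^sub>M k\<in>{..<t}. noise_space) (\<lambda>\<omega>. restrict (\<lambda>k. noise k \<omega>) {..<t})
        (\<Pi>\<^sub>M k\<in>{t}. noise_space) (\<lambda>\<omega>. restrict (\<lambda>k. noise k \<omega>) {t})"
      by (rule indep_var_restrict [OF noise_indep_time]) auto
    obtain F where F: "F \<in> sets noise_space" "C = noise t -` F \<inter> space M"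
      using C unfolding sets_noise_alg by blast
    have "(\<lambda>f. f t) -` F \<inter> space (\<Pi>\<^sub>M k\<in>{t}. noise_space) \<in> sets (\<Pi>\<^sub>M k\<in>{t}. noise_space)"
      using F(1) by (intro measurable_sets [OF measurable_component_singleton]) auto
    moreover have "C = (\<lambda>\<omega>. restrict (\<lambda>k. noise k \<omega>) {t}) -` ((\<lambda>f. f t) -` F \<inter> space (\<Pi>\<^sub>M k\<in>{t}. noise_space)) \<inter> space M"
      using measurable_space [OF noise_restrict_measurable [of "{t}"]] by (auto simp: F(2))
    ultimately have "C \<in> {(\<lambda>\<omega>. restrict (\<lambda>k. noise k \<omega>) {t}) -` E \<inter> space M | E. E \<in> sets (\<Pi>\<^sub>M k\<in>{t}. noise_space)}"
      by blast
    then have "C \<in> sigma_sets (space M)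
        {(\<lambda>\<omega>. restrict (\<lambda>k. noise k \<omega>) {t}) -` E \<inter> space M | E. E \<in> sets (\<Pi>\<^sub>M k\<in>{t}. noise_space)}"
      by (rule sigma_sets.Basic)
    moreover have "B \<in> sigma_sets (space M)
        {(\<lambda>\<omega>. restrict (\<lambda>k. noise k \<omega>) {..<t}) -` E \<inter> space M | E. E \<in> sets (\<Pi>\<^sub>M k\<in>{..<t}. noise_space)}"
      using B unfolding sets_noise_restrict_alg by (rule sigma_sets.Basic)
    ultimately show ?thesis
      using ind unfolding indep_var_eq by (intro indep_setD) auto
  qed
  have "indep_set ?G (sets (noise_alg t))"
  proof (rule indep_setI)
    have subJ: "?J \<subseteq> events" using IJ by (simp add: indep_sets2_eq)
    show "?G \<subseteq> events" using subI NJ subJ by blast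
    show "sets (noise_alg t) \<subseteq> events" using CJ subJ by (rule subset_trans)
    fix D C assume "D \<in> ?G" and C: "C \<in> sets (noise_alg t)"
    then obtain A B where D: "D = A \<inter> B" "A \<in> ?I" "B \<in> ?N" by blast
    have BJ: "B \<in> ?J" "C \<in> ?J" using D(3) NJ C CJ by auto
    then have "B \<inter> C \<in> ?J" by (rule sets.Int)
    then have "prob (B \<inter> C \<inter> A) = prob (B \<inter> C) * prob A"
      using IJ D(2) by (intro indep_setD)
    also have "\<dots> = prob B * prob C * prob A" using NC [OF D(3) C] by simp
    also have "prob B * prob C * prob A = prob (B \<inter> A) * prob C"
      using indep_setD [OF IJ BJ(1) D(2)] by simp
    finally show "prob (D \<inter> C) = prob D * prob C" by (simp add: D(1) ac_simps)
  qed
  moreover have "Int_stable ?G"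
  proof (rule Int_stableI)
    fix D D' assume "D \<in> ?G" "D' \<in> ?G"
    then obtain A B A' B' where *: "D = A \<inter> B" "D' = A' \<inter> B'" "A \<in> ?I" "B \<in> ?N" "A' \<in> ?I" "B' \<in> ?N" by blast
    then have "D \<inter> D' = (A \<inter> A') \<inter> (B \<inter> B')" "A \<inter> A' \<in> ?I" "B \<inter> B' \<in> ?N" by auto
    then show "D \<inter> D' \<in> ?G" by blast
  qed
  moreover have "Int_stable (sets (noise_alg t))" by (rule sets.Int_stable)
  ultimately have "indep_set (sigma_sets (space M) ?G) (sigma_sets (space M) (sets (noise_alg t)))"
    by (rule indep_set_sigma_sets)
  then show ?thesis
    by (rule indep_set_subset) (auto simp: sets_past)
qed

lemma past_subset: "sets (past t) \<subseteq> events"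
  using indep_past_noise by (simp add: indep_sets2_eq)

lemma initial_measurable_past: "initial \<in> measurable (past t) initial_space"
proof (rule measurableI)
  show "initial \<omega> \<in> space initial_space" if "\<omega> \<in> space (past t)" for \<omega>
    using that measurable_space [OF initial_measurable] by simp
  fix E assume "E \<in> sets initial_space"
  then have "initial -` E \<inter> space M \<in> sets (vimage_algebra (space M) initial initial_space)"
    by (rule in_vimage_algebra)
  moreover have "space M \<in> sets (vimage_algebra (space M) (\<lambda>\<omega>. restrict (\<lambda>k. noise k \<omega>) {..<t}) (\<Pi>\<^sub>M k\<in>{..<t}. noise_space))"
    by (rule sets_vimage_algebra_space)
  ultimately have "(initial -` E \<inter> space M) \<inter> space M \<in> sets (past t)"
    unfolding sets_past by (intro sigma_sets.Basic) blast
  then show "initial -` E \<inter> space (past t) \<in> sets (past t)" by simp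
qed

lemma noise_measurable_past:
  assumes "k < t"
  shows "noise k \<in> measurable (past t) noise_space"
proof -
  have "(\<lambda>\<omega>. restrict (\<lambda>k. noise k \<omega>) {..<t}) \<in> measurable (past t) (\<Pi>\<^sub>M k\<in>{..<t}. noise_space)"
  proof (rule measurableI)
    show "restrict (\<lambda>k. noise k \<omega>) {..<t} \<in> space (\<Pi>\<^sub>M k\<in>{..<t}. noise_space)" if "\<omega> \<in> space (past t)" for \<omega>
      using that measurable_space [OF noise_restrict_measurable] by simp
    fix E assume "E \<in> sets (\<Pi>\<^sub>M k\<in>{..<t}. noise_space)"
    then have "(\<lambda>\<omega>. restrict (\<lambda>k. noise k \<omega>) {..<t}) -` E \<inter> space M
        \<in> sets (vimage_algebra (space M) (\<lambda>\<omega>. restrict (\<lambda>k. noise k \<omega>) {..<t}) (\<Pi>\<^sub>M k\<in>{..<t}. noise_space))"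
      by (rule in_vimage_algebra)
    moreover have "space M \<in> sets (vimage_algebra (space M) initial initial_space)"
      by (rule sets_vimage_algebra_space)
    ultimately have "space M \<inter> ((\<lambda>\<omega>. restrict (\<lambda>k. noise k \<omega>) {..<t}) -` E \<inter> space M) \<in> sets (past t)"
      unfolding sets_past by (intro sigma_sets.Basic) blast
    then show "(\<lambda>\<omega>. restrict (\<lambda>k. noise k \<omega>) {..<t}) -` E \<inter> space (past t) \<in> sets (past t)"
      by (simp add: Int_absorb1)
  qed
  from measurable_compose [OF this measurable_component_singleton [of k]] assms
  show ?thesis by simp
qed

lemma measurable_past:
  "(\<lambda>\<omega>. restrict (pre_output (\<rho> \<omega>)) {..<0}) \<in> measurable (past t) (\<Pi>\<^sub>M i\<in>{..<0}. borel)"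
  "(\<lambda>\<omega>. init_state (\<rho> \<omega>)) \<in> borel_measurable (past t)"
  "(\<lambda>\<omega>. init_pred (\<rho> \<omega>)) \<in> borel_measurable (past t)"
  "k < t \<Longrightarrow> (\<lambda>\<omega>. proc_noise (\<rho> \<omega>) k) \<in> borel_measurable (past t)"
  "k < t \<Longrightarrow> (\<lambda>\<omega>. meas_noise (\<rho> \<omega>) k) \<in> borel_measurable (past t)"
  using measurable_compose [OF initial_measurable_past measurable_fst]
    measurable_compose [OF measurable_compose [OF initial_measurable_past measurable_snd] measurable_fst]
    measurable_compose [OF measurable_compose [OF initial_measurable_past measurable_snd] measurable_snd]
    measurable_compose [OF noise_measurable_past measurable_fst]
    measurable_compose [OF noise_measurable_past measurable_snd]
  by simp_all

lemma pred_err_measurable_past: "k \<le> t \<Longrightarrow> (\<lambda>\<omega>. pred_err S (\<rho> \<omega>) k) \<in> borel_measurable (past t)"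
proof (induction k)
  case 0
  show ?case unfolding pred_err.simps using measurable_past(2,3) by measurable
next
  case (Suc k)
  then have [measurable]: "(\<lambda>\<omega>. pred_err S (\<rho> \<omega>) k) \<in> borel_measurable (past t)"
    "(\<lambda>\<omega>. proc_noise (\<rho> \<omega>) k) \<in> borel_measurable (past t)"
    "(\<lambda>\<omega>. meas_noise (\<rho> \<omega>) k) \<in> borel_measurable (past t)"
    using measurable_past by auto
  show ?case unfolding pred_err.simps by measurable
qed

lemma nom_innov_measurable_past: "k < t \<Longrightarrow> (\<lambda>\<omega>. nom_innov S (\<rho> \<omega>) k) \<in> borel_measurable (past t)"
  unfolding nom_innov_def
  using pred_err_measurable_past [of k t] measurable_past(5) [of k t] by simp

text \<open>
  The attacker's information before time \<open>t\<close>, generated by the innovations instead of the outputs: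
  the innovations do not depend on the attack, so neither does this \<open>\<sigma>\<close>-algebra.
\<close>

primrec info :: "nat \<Rightarrow> 'a measure"
  where
    "info 0 = pre_algebra M \<rho>"
  | "info (Suc t) = sigma (space M)
      {A \<inter> (\<lambda>\<omega>. nom_innov S (\<rho> \<omega>) t) -` E | A E. A \<in> sets (info t) \<and> E \<in> sets borel}"

lemma space_info [simp]: "space (info t) = space M"
proof (induction t)
  case (Suc t)
  then have "{A \<inter> (\<lambda>\<omega>. nom_innov S (\<rho> \<omega>) t) -` E | A E. A \<in> sets (info t) \<and> E \<in> sets borel} \<subseteq> Pow (space M)"
    using sets.sets_into_space by fastforce
  then show ?case by simp
qed (simp add: pre_algebra_def)

lemma sets_info_Suc: "sets (info (Suc t)) = sigma_sets (space M)
    {A \<inter> (\<lambda>\<omega>. nom_innov S (\<rho> \<omega>) t) -` E | A E. A \<in> sets (info t) \<and> E \<in> sets borel}"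
proof -
  have "{A \<inter> (\<lambda>\<omega>. nom_innov S (\<rho> \<omega>) t) -` E | A E. A \<in> sets (info t) \<and> E \<in> sets borel} \<subseteq> Pow (space M)"
    using sets.sets_into_space [of _ "info t"] by fastforce
  then show ?thesis by simp
qed

lemma info_subset_past: "k \<le> t \<Longrightarrow> sets (info k) \<subseteq> sets (past t)"
proof (induction k)
  case 0
  have "(\<lambda>\<omega>. restrict (pre_output (\<rho> \<omega>)) {..<0}) \<in> measurable (past t) (\<Pi>\<^sub>M i\<in>{..<0}. borel)"
    by (rule measurable_past)
  then show ?case
    unfolding info.simps pre_algebra_def by (intro sets_image_in_sets) simp_all
next
  case (Suc k)
  have "{A \<inter> (\<lambda>\<omega>. nom_innov S (\<rho> \<omega>) k) -` E | A E. A \<in> sets (info k) \<and> E \<in> sets borel} \<subseteq> sets (past t)"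
  proof clarify
    fix A and E :: "(real ^ 'p) set" assume A: "A \<in> sets (info k)" and E: "E \<in> sets borel"
    have "(\<lambda>\<omega>. nom_innov S (\<rho> \<omega>) k) -` E \<inter> space M \<in> sets (past t)"
      using measurable_sets [OF nom_innov_measurable_past [of k t] E] Suc.prems by simp
    moreover have "A \<in> sets (past t)" using A Suc by auto
    ultimately have "A \<inter> ((\<lambda>\<omega>. nom_innov S (\<rho> \<omega>) k) -` E \<inter> space M) \<in> sets (past t)" by (rule sets.Int [rotated])
    moreover have "A \<inter> ((\<lambda>\<omega>. nom_innov S (\<rho> \<omega>) k) -` E \<inter> space M) = A \<inter> (\<lambda>\<omega>. nom_innov S (\<rho> \<omega>) k) -` E"
      using sets.sets_into_space [OF A] by auto
    ultimately show "A \<inter> (\<lambda>\<omega>. nom_innov S (\<rho> \<omega>) k) -` E \<in> sets (past t)" by simp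
  qed
  from sets.sigma_sets_subset [OF this] show ?case by (simp only: sets_info_Suc space_past)
qed

lemma info_subset: "sets (info t) \<subseteq> events"
  using info_subset_past [OF order_refl] past_subset by blast

lemma info_mono_Suc: "sets (info t) \<subseteq> sets (info (Suc t))"
proof
  fix A assume A: "A \<in> sets (info t)"
  show "A \<in> sets (info (Suc t))"
    unfolding sets_info_Suc
    by (intro sigma_sets.Basic CollectI exI [of _ A] exI [of _ UNIV]) (simp add: A)
qed

lemma info_mono: "k \<le> t \<Longrightarrow> sets (info k) \<subseteq> sets (info t)"
  by (induction t rule: dec_induct) (use info_mono_Suc in auto)

lemma nom_innov_measurable_info:
  assumes "k < t"
  shows "(\<lambda>\<omega>. nom_innov S (\<rho> \<omega>) k) \<in> borel_measurable (info t)"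
proof -
  have "(\<lambda>\<omega>. nom_innov S (\<rho> \<omega>) k) \<in> borel_measurable (info (Suc k))"
  proof (rule measurableI)
    fix E :: "(real ^ 'p) set" assume "E \<in> sets borel"
    moreover have "space M \<in> sets (info k)" using sets.top [of "info k"] by simp
    ultimately have "space M \<inter> (\<lambda>\<omega>. nom_innov S (\<rho> \<omega>) k) -` E \<in> sets (info (Suc k))"
      unfolding sets_info_Suc by (intro sigma_sets.Basic) blast
    then show "(\<lambda>\<omega>. nom_innov S (\<rho> \<omega>) k) -` E \<inter> space (info (Suc k)) \<in> sets (info (Suc k))"
      by (simp only: space_info Int_commute)
  qed simp
  moreover have "sets (info (Suc k)) \<subseteq> sets (info t)" using assms by (intro info_mono) simp
  ultimately show ?thesis by (rule measurable_into_larger) (simp only: space_info)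
qed

section \<open>Steady-state covariance identities\<close>

lemma possemidef_P: "possemidef (mP S)"
  using init_error_gaussian by (simp add: gaussian_def)

text \<open>\<open>mSigmaNu S\<close> inherits definiteness from the measurement noise, so the
  \<open>matrix_inv\<close> in the gain is a true inverse.\<close>

lemma K_SigmaNu: "mK S ** mSigmaNu S = mP S ** transpose (mC S)"
  and symmetric_SigmaNu: "transpose (mSigmaNu S) = mSigmaNu S"
proof -
  have symP: "transpose (mP S) = mP S" and symV: "transpose (mSigmaV S) = mSigmaV S"
    using possemidef_P SigmaV_posdef by (simp_all add: possemidef_def posdef_def)
  show sym: "transpose (mSigmaNu S) = mSigmaNu S"
    by (simp add: mSigmaNu_def transpose_simps symP symV matrix_mul_assoc)
  have "qform (mSigmaNu S) x > 0" if "x \<noteq> 0" for x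
  proof -
    have "qform (mSigmaNu S) x = qform (mP S) (transpose (mC S) *v x) + qform (mSigmaV S) x"
      using inner_transpose_mult [of _ "transpose (mC S)"]
      by (simp add: qform_def mSigmaNu_def matvec inner_add)
    then show ?thesis
      using that SigmaV_posdef possemidef_P
      by (metis add_nonneg_pos posdef_def possemidef_nonneg)
  qed
  with sym have "posdef (mSigmaNu S)" by (simp add: posdef_def)
  from matrix_inv_mult(2) [OF posdef_invertible [OF this]]
  show "mK S ** mSigmaNu S = mP S ** transpose (mC S)"
    by (simp add: mK_def flip: matrix_mul_assoc)
qed

text \<open>
  This uses \<open>K \<Sigma>\<^sub>\<nu> = P C\<^sup>T\<close>, by which the estimation error and the innovation are uncorrelated,
  and the Riccati equation.
\<close>

lemma steady_state_qform:
  fixes a :: "real ^ 'n" and b :: "real ^ 'p"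
  defines "a' \<equiv> transpose (mA S) *v a"
  defines "g \<equiv> b - transpose (mK S) *v a'"
  shows "qform (mP S) (a' + transpose (mC S) *v g) + qform (mSigmaV S) g + qform (mSigmaW S) a
    = qform (mP S) a + qform (mSigmaNu S) b"
proof -
  have symP: "transpose (mP S) = mP S" using possemidef_P by (simp add: possemidef_def)
  define c where "c = mC S *v (mP S *v a')"
  have inner_C: "(transpose (mC S) *v u) \<bullet> v = u \<bullet> (mC S *v v)" for u v
    by (metis inner_commute inner_transpose_mult)
  have nu: "qform (mSigmaNu S) x = qform (mP S) (transpose (mC S) *v x) + qform (mSigmaV S) x" for x
    by (simp add: qform_def mSigmaNu_def matvec inner_add inner_C)
  have "transpose (mK S ** mSigmaNu S) = transpose (mP S ** transpose (mC S))"
    by (simp only: K_SigmaNu)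
  then have "mSigmaNu S ** transpose (mK S) = mC S ** mP S"
    by (simp only: matrix_transpose_mul symmetric_SigmaNu symP transpose_transpose)
  from arg_cong [OF this, of "\<lambda>X. X *v a'"]
  have SK: "mSigmaNu S *v (transpose (mK S) *v a') = c"
    by (simp add: c_def matvec)
  have K: "(transpose (mK S) *v a') \<bullet> u = a' \<bullet> (mK S *v u)" for u
    by (metis inner_commute inner_transpose_mult)
  have "qform (mP S) (a' + transpose (mC S) *v g) + qform (mSigmaV S) g
    = qform (mP S) a' + 2 * (g \<bullet> c) + qform (mSigmaNu S) g"
    unfolding qform_add [OF symP] nu by (simp add: c_def inner_C)
  also have "qform (mSigmaNu S) g = qform (mSigmaNu S) (b + - (transpose (mK S) *v a'))"
    by (simp add: g_def)
  also have "\<dots> = qform (mSigmaNu S) b - 2 * (b \<bullet> c) + (transpose (mK S) *v a') \<bullet> c"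
    unfolding qform_add [OF symmetric_SigmaNu]
    by (simp add: qform_def matvec SK flip: symmetric_inner [OF symmetric_SigmaNu])
      (simp add: inner_commute SK)
  finally have 1: "qform (mP S) (a' + transpose (mC S) *v g) + qform (mSigmaV S) g
    = qform (mP S) a' + qform (mSigmaNu S) b - a' \<bullet> (mK S *v c)"
    by (simp add: g_def inner_diff K)
  \<comment> \<open>With the gain inserted, the subtracted Riccati term is
    \<open>A K C P A^T\<close>; its quadratic form at \<open>a\<close> is a' \<bullet> (K c),
    exactly the deficit in \<open>1\<close>.\<close>
  have "mP S = mA S ** mP S ** transpose (mA S) + mSigmaW S
      - mA S ** (mK S ** mC S ** mP S ** transpose (mA S))"
    using riccati unfolding mK_def mSigmaNu_def by (simp only: matrix_mul_assoc)
  then have "qform (mP S) a = qform (mA S ** mP S ** transpose (mA S) + mSigmaW S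
      - mA S ** (mK S ** mC S ** mP S ** transpose (mA S))) a" by (rule arg_cong)
  also have "\<dots> = qform (mP S) a' + qform (mSigmaW S) a - a' \<bullet> (mK S *v c)"
    using inner_transpose_mult [of a "transpose (mA S)"]
    by (simp add: qform_def matvec inner_add inner_diff a'_def c_def)
  finally show ?thesis using 1 by simp
qed

section \<open>Law of the prediction error\<close>

lemma pred_err_measurable: "(\<lambda>\<omega>. pred_err S (\<rho> \<omega>) t) \<in> borel_measurable M"
  using measurable_into_larger [OF pred_err_measurable_past [OF order_refl] past_subset] by simp

lemma nom_innov_measurable: "(\<lambda>\<omega>. nom_innov S (\<rho> \<omega>) t) \<in> borel_measurable M"
  using measurable_into_larger [OF nom_innov_measurable_past [OF lessI] past_subset] by simp

lemma noise_alg_measurable: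
  "(\<lambda>\<omega>. proc_noise (\<rho> \<omega>) t) \<in> borel_measurable (noise_alg t)"
  "(\<lambda>\<omega>. meas_noise (\<rho> \<omega>) t) \<in> borel_measurable (noise_alg t)"
proof -
  have *: "noise t \<in> measurable (noise_alg t) noise_space"
    using measurable_space [OF noise_measurable] by (intro measurable_vimage_algebra1) auto
  show "(\<lambda>\<omega>. proc_noise (\<rho> \<omega>) t) \<in> borel_measurable (noise_alg t)"
    using measurable_compose [OF * measurable_fst] by simp
  show "(\<lambda>\<omega>. meas_noise (\<rho> \<omega>) t) \<in> borel_measurable (noise_alg t)"
    using measurable_compose [OF * measurable_snd] by simp
qed

text \<open>Only the separate laws of the two noises are given; their independence supplies the
  joint characteristic function.\<close>

lemma noise_char:
  "(\<integral>\<omega>. iexp (g \<bullet> meas_noise (\<rho> \<omega>) t) * iexp (a \<bullet> proc_noise (\<rho> \<omega>) t) \<partial>M)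
    = exp (- (qform (mSigmaV S) g + qform (mSigmaW S) a) / 2)"
proof -
  have [measurable]: "(\<lambda>\<omega>. proc_noise (\<rho> \<omega>) t) \<in> borel_measurable M"
    "(\<lambda>\<omega>. meas_noise (\<rho> \<omega>) t) \<in> borel_measurable M"
    using proc_noise_gaussian meas_noise_gaussian gaussian_measurable by blast+
  let ?V = "vimage_algebra (space M) (\<lambda>\<omega>. meas_noise (\<rho> \<omega>) t) borel"
  let ?W = "vimage_algebra (space M) (\<lambda>\<omega>. proc_noise (\<rho> \<omega>) t) borel"
  have ind: "indep_set (sets ?W) (sets ?V)"
    by (rule indep_rv_vimage_algebra [OF noise_indep_pair])
  have [measurable]: "(\<lambda>\<omega>. meas_noise (\<rho> \<omega>) t) \<in> borel_measurable ?V"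
    "(\<lambda>\<omega>. proc_noise (\<rho> \<omega>) t) \<in> borel_measurable ?W"
    by (simp_all add: measurable_vimage_algebra1)
  have int: "integrable M (\<lambda>\<omega>. iexp (X \<omega>))" if "X \<in> borel_measurable M" for X
    using integrable_mult_iexp [of "\<lambda>_. 1", OF _ that] by simp
  have "(\<integral>\<omega>. iexp (a \<bullet> proc_noise (\<rho> \<omega>) t) * iexp (g \<bullet> meas_noise (\<rho> \<omega>) t) \<partial>M)
    = (\<integral>\<omega>. iexp (a \<bullet> proc_noise (\<rho> \<omega>) t) \<partial>M) * (\<integral>\<omega>. iexp (g \<bullet> meas_noise (\<rho> \<omega>) t) \<partial>M)"
  proof (rule indep_set_integral_mult [OF ind])
    show "(\<lambda>\<omega>. iexp (a \<bullet> proc_noise (\<rho> \<omega>) t)) \<in> borel_measurable ?W" by measurable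
    show "(\<lambda>\<omega>. iexp (g \<bullet> meas_noise (\<rho> \<omega>) t)) \<in> borel_measurable ?V" by measurable
    show "integrable M (\<lambda>\<omega>. iexp (a \<bullet> proc_noise (\<rho> \<omega>) t))" by (rule int) simp
    show "integrable M (\<lambda>\<omega>. iexp (g \<bullet> meas_noise (\<rho> \<omega>) t))" by (rule int) simp
  qed simp_all
  also have "\<dots> = exp (- qform (mSigmaW S) a / 2) * exp (- qform (mSigmaV S) g / 2)"
    by (simp only: gaussian_char [OF proc_noise_gaussian] gaussian_char [OF meas_noise_gaussian] of_real_mult)
  also have "\<dots> = exp (- (qform (mSigmaV S) g + qform (mSigmaW S) a) / 2)"
    unfolding of_real_mult [symmetric] exp_half_mult by (simp only: add.commute)
  finally show ?thesis by (simp only: mult.commute)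
qed

text \<open>A functional of the next error and the present innovation is one of the present error
  and the present noises, where independence applies. By \<open>steady_state_qform\<close> the
  exponent splits again, into a part in \<open>a\<close> with the same \<open>mP S\<close> and a
  part in \<open>b\<close>: given A, the next error is independent of the innovation and keeps its
  covariance.\<close>

lemma pred_err_step_char:
  assumes IH: "\<And>A a. A \<in> sets (info t) \<Longrightarrow>
      (\<integral>\<omega>. indicator A \<omega> * iexp (a \<bullet> pred_err S (\<rho> \<omega>) t) \<partial>M)
        = complex_of_real (prob A * exp (- qform (mP S) a / 2))"
    and A: "A \<in> sets (info t)"
  shows "(\<integral>\<omega>. indicator A \<omega> * iexp (a \<bullet> pred_err S (\<rho> \<omega>) (Suc t) + b \<bullet> nom_innov S (\<rho> \<omega>) t) \<partial>M)
    = complex_of_real (prob A * exp (- (qform (mP S) a + qform (mSigmaNu S) b) / 2))"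
proof -
  \<comment> \<open>Coefficients from unfolding the recursions: \<open>\<alpha>\<close> multiplies
    the present error and \<open>g\<close> the measurement noise; \<open>a\<close> is left for the
    process noise.\<close>
  define a' where "a' = transpose (mA S) *v a"
  define g where "g = b - transpose (mK S) *v a'"
  define \<alpha> where "\<alpha> = a' + transpose (mC S) *v g"
  have tr: "(transpose B *v u) \<bullet> v = u \<bullet> (B *v v)" for B :: "real ^ 'x::finite ^ 'y::finite" and u v
    by (metis inner_commute inner_transpose_mult)
  have split: "a \<bullet> pred_err S r (Suc t) + b \<bullet> nom_innov S r t
      = \<alpha> \<bullet> pred_err S r t + (g \<bullet> meas_noise r t + a \<bullet> proc_noise r t)" for r
  proof -
    have "\<alpha> \<bullet> pred_err S r t + g \<bullet> meas_noise r t = a' \<bullet> pred_err S r t + g \<bullet> nom_innov S r t"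
      by (simp add: \<alpha>_def nom_innov_def inner_add tr)
    also have "\<dots> = a' \<bullet> est_err S r t + b \<bullet> nom_innov S r t"
      by (simp add: g_def est_err_def inner_diff tr)
    also have "a' \<bullet> est_err S r t = a \<bullet> (mA S *v est_err S r t)"
      by (simp add: a'_def tr)
    finally show ?thesis by (simp add: pred_err_Suc inner_add)
  qed
  have A': "A \<in> events" "A \<in> sets (past t)"
    using A info_subset info_subset_past [OF order_refl] by auto
  have iexp_measurable: "(\<lambda>\<omega>. iexp (X \<omega>)) \<in> borel_measurable N" if "X \<in> borel_measurable N" for X and N :: "'a measure"
    using that by measurable
  have noise_M: "(\<lambda>\<omega>. proc_noise (\<rho> \<omega>) t) \<in> borel_measurable M"
    "(\<lambda>\<omega>. meas_noise (\<rho> \<omega>) t) \<in> borel_measurable M"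
    using proc_noise_gaussian meas_noise_gaussian gaussian_measurable by blast+
  let ?X = "\<lambda>\<omega>. indicator A \<omega> * iexp (\<alpha> \<bullet> pred_err S (\<rho> \<omega>) t)"
  let ?Y = "\<lambda>\<omega>. iexp (g \<bullet> meas_noise (\<rho> \<omega>) t) * iexp (a \<bullet> proc_noise (\<rho> \<omega>) t)"
  have "(\<integral>\<omega>. indicator A \<omega> * iexp (a \<bullet> pred_err S (\<rho> \<omega>) (Suc t) + b \<bullet> nom_innov S (\<rho> \<omega>) t) \<partial>M)
    = (\<integral>\<omega>. ?X \<omega> * ?Y \<omega> \<partial>M)"
    unfolding split by (simp add: distrib_left exp_add mult.assoc)
  also have "\<dots> = (\<integral>\<omega>. ?X \<omega> \<partial>M) * (\<integral>\<omega>. ?Y \<omega> \<partial>M)"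
  proof (rule indep_set_integral_mult [OF indep_past_noise])
    show "?X \<in> borel_measurable (past t)"
      using A' pred_err_measurable_past [of t t]
      by (intro borel_measurable_times borel_measurable_indicator iexp_measurable inner_measurable) auto
    show "integrable M ?X"
      using A'(1) by (intro integrable_indicator_iexp inner_measurable pred_err_measurable)
    show "?Y \<in> borel_measurable (noise_alg t)"
      using noise_alg_measurable by (intro borel_measurable_times iexp_measurable inner_measurable)
    have "integrable M (\<lambda>\<omega>. 1 * iexp (g \<bullet> meas_noise (\<rho> \<omega>) t))"
      by (intro integrable_mult_iexp inner_measurable noise_M) simp
    from integrable_mult_iexp [OF this inner_measurable [OF noise_M(1), of a]]
    show "integrable M ?Y" by (simp only: mult_1)
  qed simp_all
  also have "\<dots> = complex_of_real (prob A * exp (- qform (mP S) \<alpha> / 2)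
      * exp (- (qform (mSigmaV S) g + qform (mSigmaW S) a) / 2))"
    by (simp only: IH [OF A] noise_char of_real_mult)
  also have "prob A * exp (- qform (mP S) \<alpha> / 2) * exp (- (qform (mSigmaV S) g + qform (mSigmaW S) a) / 2)
    = prob A * exp (- (qform (mP S) \<alpha> + qform (mSigmaV S) g + qform (mSigmaW S) a) / 2)"
    by (simp only: mult.assoc exp_half_mult add.assoc)
  also have "qform (mP S) \<alpha> + qform (mSigmaV S) g + qform (mSigmaW S) a = qform (mP S) a + qform (mSigmaNu S) b"
    using steady_state_qform unfolding \<alpha>_def g_def a'_def by blast
  finally show ?thesis .
qed

text \<open>The prediction error is \<open>N(0, P)\<close> distributed and independent of the attacker's information.\<close>

lemma pred_err_char:
  assumes "A \<in> sets (info t)"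
  shows "(\<integral>\<omega>. indicator A \<omega> * iexp (a \<bullet> pred_err S (\<rho> \<omega>) t) \<partial>M)
    = complex_of_real (prob A * exp (- qform (mP S) a / 2))"
  using assms
proof (induction t arbitrary: A a)
  case 0
  let ?d = "\<lambda>\<omega>. init_state (\<rho> \<omega>) - init_pred (\<rho> \<omega>)"
  have A: "A \<in> events" using 0 info_subset by blast
  have ind: "indep_set (sets (vimage_algebra (space M) ?d borel)) (sets (info 0))"
    using indep_rv_vimage_algebra [OF init_error_indep] by (simp add: pre_algebra_def)
  have d: "?d \<in> borel_measurable M" using init_error_gaussian by (rule gaussian_measurable)
  have [measurable]: "?d \<in> borel_measurable (vimage_algebra (space M) ?d borel)"
    by (rule measurable_vimage_algebra1) simp
  have "(\<integral>\<omega>. iexp (a \<bullet> ?d \<omega>) * indicator A \<omega> \<partial>M) = (\<integral>\<omega>. iexp (a \<bullet> ?d \<omega>) \<partial>M) * (\<integral>\<omega>. indicator A \<omega> \<partial>M)"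
  proof (rule indep_set_integral_mult [OF ind])
    show "(\<lambda>\<omega>. iexp (a \<bullet> ?d \<omega>)) \<in> borel_measurable (vimage_algebra (space M) ?d borel)"
      by measurable
    have "integrable M (\<lambda>\<omega>. 1 * iexp (a \<bullet> ?d \<omega>))"
      using d by (intro integrable_mult_iexp inner_measurable) auto
    then show "integrable M (\<lambda>\<omega>. iexp (a \<bullet> ?d \<omega>))" by (simp only: mult_1)
    show "indicator A \<in> borel_measurable (info 0)"
      by (rule borel_measurable_indicator [OF 0])
    show "integrable M (indicator A :: 'a \<Rightarrow> complex)"
      by (rule integrable_indicator_complex [OF A])
  qed (simp_all add: pre_algebra_def)
  also have "(\<integral>\<omega>. indicator A \<omega> \<partial>M) = complex_of_real (prob A)"
    by (rule integral_indicator_complex [OF A])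
  also have "(\<integral>\<omega>. iexp (a \<bullet> ?d \<omega>) \<partial>M) = complex_of_real (exp (- qform (mP S) a / 2))"
    by (rule gaussian_char [OF init_error_gaussian])
  finally show ?case by (simp only: mult.commute pred_err.simps of_real_mult)
next
  case (Suc t)
  let ?d = "\<lambda>\<omega>. pred_err S (\<rho> \<omega>) (Suc t)" and ?\<nu> = "\<lambda>\<omega>. nom_innov S (\<rho> \<omega>) t"
  \<comment> \<open>\<open>c\<close> is the characteristic function of N(0, P) at \<open>a\<close>,
    so the claim for a set is that \<open>h\<close> integrates to 0 over it.\<close>
  define c where "c = complex_of_real (exp (- qform (mP S) a / 2))"
  define h where "h \<omega> = iexp (a \<bullet> ?d \<omega>) - c" for \<omega>
  have meas: "?d \<in> borel_measurable M" "?\<nu> \<in> borel_measurable M"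
    by (rule pred_err_measurable nom_innov_measurable)+
  have "integrable M (\<lambda>\<omega>. 1 * iexp (a \<bullet> ?d \<omega>))"
    using meas by (intro integrable_mult_iexp inner_measurable) auto
  then have int_h: "integrable M h" unfolding h_def by (simp del: pred_err.simps)
  \<comment> \<open>The one-step identity is used twice, at \<open>a\<close> and at 0. Both values
    have the same factor in \<open>b\<close>, so the combination in \<open>h\<close> vanishes for
    every \<open>b\<close>.\<close>
  have joint: "(\<integral>\<omega>. indicator B \<omega> * h \<omega> * iexp (b \<bullet> ?\<nu> \<omega>) \<partial>M) = 0" if B: "B \<in> sets (info t)" for B b
  proof -
    have BM: "B \<in> events" using B info_subset by blast
    note step = pred_err_step_char [OF Suc.IH B]
    have "indicator B \<omega> * h \<omega> * iexp (b \<bullet> ?\<nu> \<omega>) = indicator B \<omega> * iexp (a \<bullet> ?d \<omega> + b \<bullet> ?\<nu> \<omega>)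
        - c * (indicator B \<omega> * iexp (0 \<bullet> ?d \<omega> + b \<bullet> ?\<nu> \<omega>))" for \<omega>
      by (simp add: h_def exp_add algebra_simps)
    then have "(\<integral>\<omega>. indicator B \<omega> * h \<omega> * iexp (b \<bullet> ?\<nu> \<omega>) \<partial>M)
      = (\<integral>\<omega>. indicator B \<omega> * iexp (a \<bullet> ?d \<omega> + b \<bullet> ?\<nu> \<omega>) \<partial>M)
        - (\<integral>\<omega>. c * (indicator B \<omega> * iexp (0 \<bullet> ?d \<omega> + b \<bullet> ?\<nu> \<omega>)) \<partial>M)"
      using BM meas
      by (simp only:) (intro Bochner_Integration.integral_diff integrable_mult_right
          integrable_indicator_iexp borel_measurable_add inner_measurable)
    also have "\<dots> = complex_of_real (prob B * exp (- (qform (mP S) a + qform (mSigmaNu S) b) / 2))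
        - c * complex_of_real (prob B * exp (- (qform (mP S) 0 + qform (mSigmaNu S) b) / 2))"
      by (simp only: Bochner_Integration.integral_mult_right_zero step)
    also have "\<dots> = 0"
      unfolding c_def exp_half_mult [symmetric] by (simp add: qform_def)
    finally show ?thesis .
  qed
  \<comment> \<open>A generator of \<open>info (Suc t)\<close> is an old set cut by an innovation
    event. With the weight \<open>indicator A * h\<close>, vanishing at all frequencies
    \<open>b\<close> becomes vanishing over all innovation events.\<close>
  have zero: "(LINT \<omega>:B|M. h \<omega>) = 0" if "B \<in> sets (info (Suc t))" for B
  proof (rule set_integral_zero_generated [OF int_h])
    let ?G = "{A \<inter> ?\<nu> -` E | A E. A \<in> sets (info t) \<and> E \<in> sets borel}"
    show "integral\<^sup>L M h = 0"
    proof -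
      have "space M \<in> sets (info t)" using sets.top [of "info t"] by simp
      from joint [OF this, of 0] show ?thesis
        by (simp cong: Bochner_Integration.integral_cong)
    qed
    show "?G \<subseteq> sets M"
    proof clarify
      fix A and E :: "(real ^ 'p) set" assume A: "A \<in> sets (info t)" and E: "E \<in> sets borel"
      have "A \<inter> ?\<nu> -` E = A \<inter> (?\<nu> -` E \<inter> space M)"
        using sets.sets_into_space [OF A] by auto
      moreover have "A \<inter> (?\<nu> -` E \<inter> space M) \<in> events"
        using A info_subset measurable_sets [OF meas(2) E] by blast
      ultimately show "A \<inter> ?\<nu> -` E \<in> events" by simp
    qed
    show "Int_stable ?G"
    proof (rule Int_stableI)
      fix D D' assume "D \<in> ?G" "D' \<in> ?G"
      then obtain A E A' E' where *: "D = A \<inter> ?\<nu> -` E" "D' = A' \<inter> ?\<nu> -` E'"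
          "A \<in> sets (info t)" "A' \<in> sets (info t)" "E \<in> sets borel" "E' \<in> sets borel" by blast
      have "D \<inter> D' = (A \<inter> A') \<inter> ?\<nu> -` (E \<inter> E')" using *(1,2) by auto
      moreover have "A \<inter> A' \<in> sets (info t)" "E \<inter> E' \<in> sets borel" using *(3-6) by auto
      ultimately show "D \<inter> D' \<in> ?G" by blast
    qed
    show "B \<in> sigma_sets (space M) ?G" using that by (simp only: sets_info_Suc)
    fix D assume "D \<in> ?G"
    then obtain A E where D: "D = A \<inter> ?\<nu> -` E" "A \<in> sets (info t)" "E \<in> sets borel" by blast
    have A: "A \<in> events" using D(2) info_subset by blast
    have "integrable M (\<lambda>\<omega>. indicator A \<omega> *\<^sub>R h \<omega>)"
      by (rule integrable_mult_indicator [OF A int_h])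
    moreover have "indicat_real A \<omega> *\<^sub>R h \<omega> = indicator A \<omega> * h \<omega>" for \<omega>
      by (auto simp: indicator_def)
    ultimately have int: "integrable M (\<lambda>\<omega>. indicator A \<omega> * h \<omega>)" by simp
    have "(LINT \<omega>:?\<nu> -` E \<inter> space M|M. indicator A \<omega> * h \<omega>) = 0"
      using joint [OF D(2)] by (intro fourier_zero_vec [OF int meas(2) _ D(3)])
    moreover have "(LINT \<omega>:?\<nu> -` E \<inter> space M|M. indicator A \<omega> * h \<omega>) = (LINT \<omega>:D|M. h \<omega>)"
      unfolding set_lebesgue_integral_def D(1)
      by (intro Bochner_Integration.integral_cong) (auto simp: indicator_def)
    ultimately show "(LINT \<omega>:D|M. h \<omega>) = 0" by simp
  qed
  have A: "A \<in> events" using Suc.prems info_subset by blast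
  have "(\<integral>\<omega>. indicator A \<omega> * h \<omega> \<partial>M) = 0"
    unfolding integral_indicator_mult_set by (rule zero [OF Suc.prems])
  moreover have "(\<integral>\<omega>. indicator A \<omega> * h \<omega> \<partial>M)
      = (\<integral>\<omega>. indicator A \<omega> * iexp (a \<bullet> ?d \<omega>) - c * indicator A \<omega> \<partial>M)"
    by (simp add: h_def algebra_simps)
  also have "\<dots> = (\<integral>\<omega>. indicator A \<omega> * iexp (a \<bullet> ?d \<omega>) \<partial>M) - (\<integral>\<omega>. c * indicator A \<omega> \<partial>M)"
    using A meas
    by (intro Bochner_Integration.integral_diff integrable_indicator_iexp inner_measurable integrable_mult_right
        integrable_indicator_complex)
  also have "(\<integral>\<omega>. c * indicator A \<omega> \<partial>M) = c * complex_of_real (prob A)"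
    by (simp only: Bochner_Integration.integral_mult_right_zero integral_indicator_complex [OF A])
  ultimately show ?case by (simp add: c_def mult.commute)
qed

text \<open>Single coordinates suffice, as inner products are sums over them. The weight is the
  centred indicator of A, whose Fourier transform against the coordinate vanishes by
  \<open>pred_err_char\<close>.\<close>

lemma pred_err_nth_indep:
  "indep_set (sets (vimage_algebra (space M) (\<lambda>\<omega>. pred_err S (\<rho> \<omega>) t $ i) borel)) (sets (info t))"
proof (rule indep_setI)
  let ?X = "\<lambda>\<omega>. pred_err S (\<rho> \<omega>) t $ i"
  have X: "?X \<in> borel_measurable M"
    using pred_err_measurable by (simp add: borel_measurable_vec_iff)
  have sets_X: "sets (vimage_algebra (space M) ?X borel) = {?X -` E \<inter> space M | E. E \<in> sets borel}"
    using X by (rule sets_vimage_algebra_measurable) simp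
  show "sets (vimage_algebra (space M) ?X borel) \<subseteq> events"
    unfolding sets_X using measurable_sets [OF X] by blast
  show "sets (info t) \<subseteq> events" by (rule info_subset)
  fix B A assume "B \<in> sets (vimage_algebra (space M) ?X borel)" and A: "A \<in> sets (info t)"
  then obtain E where B: "B = ?X -` E \<inter> space M" and E [measurable]: "E \<in> sets borel" unfolding sets_X by blast
  have AM [measurable]: "A \<in> events" using A info_subset by blast
  have [measurable]: "?X \<in> borel_measurable M" by (rule X)
  have BM: "B \<in> events" unfolding B by measurable
  have int: "integrable M (\<lambda>\<omega>. indicator A \<omega> - prob A)"
    using AM by (auto simp: less_top [symmetric])
  have "(\<integral>\<omega>. complex_of_real (indicator A \<omega> - prob A) * iexp (s * ?X \<omega>) \<partial>M) = 0" for s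
  proof -
    let ?q = "complex_of_real (exp (- qform (mP S) (axis i s) / 2))"
    have sX: "s * ?X \<omega> = axis i s \<bullet> pred_err S (\<rho> \<omega>) t" for \<omega> by (simp add: inner_axis')
    have top: "space M \<in> sets (info t)" using sets.top [of "info t"] by simp
    have one: "(\<integral>\<omega>. iexp (s * ?X \<omega>) \<partial>M) = ?q"
      using pred_err_char [OF top, of "axis i s"] unfolding sX
      by (simp add: prob_space cong: Bochner_Integration.integral_cong)
    have "complex_of_real (indicator A \<omega> - prob A) * iexp (s * ?X \<omega>)
        = indicator A \<omega> * iexp (s * ?X \<omega>) - complex_of_real (prob A) * (1 * iexp (s * ?X \<omega>))" for \<omega>
      by (simp add: algebra_simps indicator_def)
    then have "(\<integral>\<omega>. complex_of_real (indicator A \<omega> - prob A) * iexp (s * ?X \<omega>) \<partial>M)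
      = (\<integral>\<omega>. indicator A \<omega> * iexp (s * ?X \<omega>) \<partial>M) - (\<integral>\<omega>. complex_of_real (prob A) * (1 * iexp (s * ?X \<omega>)) \<partial>M)"
      using AM X
      by (simp only:) (intro Bochner_Integration.integral_diff integrable_mult_right
          integrable_indicator_iexp integrable_mult_iexp; simp)
    also have "\<dots> = complex_of_real (prob A) * ?q - complex_of_real (prob A) * ?q"
      by (simp only: Bochner_Integration.integral_mult_right_zero mult_1 one)
        (simp only: sX pred_err_char [OF A] of_real_mult)
    finally show ?thesis by simp
  qed
  from fourier_zero_real [OF int X this E]
  have "(\<integral>\<omega>. (indicator A \<omega> - prob A) * indicator E (?X \<omega>) \<partial>M) = 0" .
  moreover have "(\<integral>\<omega>. (indicator A \<omega> - prob A) * indicator E (?X \<omega>) \<partial>M)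
    = (\<integral>\<omega>. indicator (B \<inter> A) \<omega> - prob A * indicator B \<omega> \<partial>M)"
    by (intro Bochner_Integration.integral_cong) (auto simp: B indicator_def)
  moreover have "\<dots> = prob (B \<inter> A) - prob A * prob B"
    using AM BM sets.sets_into_space [OF BM]
    by (subst Bochner_Integration.integral_diff) (auto simp: less_top [symmetric] Int_absorb2 inf.absorb1 le_infI1)
  ultimately show "prob (B \<inter> A) = prob B * prob A" by simp
qed

section \<open>Second moments, and orthogonality to the earlier information\<close>

lemma pred_err_sq_integrable: "sq_integrable M (\<lambda>\<omega>. pred_err S (\<rho> \<omega>) t)"
proof (induction t)
  case 0
  then show ?case using gaussian_sq_integrable [OF init_error_gaussian] by simp
next
  case (Suc t)
  then show ?case
    unfolding pred_err.simps
    by (intro sq_integrable_add sq_integrable_diff sq_integrable_matrix_mult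
        gaussian_sq_integrable [OF proc_noise_gaussian] gaussian_sq_integrable [OF meas_noise_gaussian])
qed

lemma meas_noise_sq_integrable: "sq_integrable M (\<lambda>\<omega>. meas_noise (\<rho> \<omega>) t)"
  by (rule gaussian_sq_integrable [OF meas_noise_gaussian])

lemma nom_innov_sq_integrable: "sq_integrable M (\<lambda>\<omega>. nom_innov S (\<rho> \<omega>) t)"
  unfolding nom_innov_def
  by (intro sq_integrable_add sq_integrable_matrix_mult pred_err_sq_integrable meas_noise_sq_integrable)

lemma est_err_sq_integrable: "sq_integrable M (\<lambda>\<omega>. est_err S (\<rho> \<omega>) t)"
  unfolding est_err_def
  by (intro sq_integrable_diff sq_integrable_matrix_mult pred_err_sq_integrable nom_innov_sq_integrable)

text \<open>The mean is carried along the linear recursion, which spares recovering moments from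
  characteristic functions.\<close>

lemma pred_err_nth_mean: "(\<integral>\<omega>. pred_err S (\<rho> \<omega>) t $ i \<partial>M) = 0"
proof (induction t arbitrary: i)
  case 0
  then show ?case using gaussian_nth_mean [OF init_error_gaussian] by simp
next
  case (Suc t)
  have int: "integrable M (\<lambda>\<omega>. X \<omega> $ i)" if "sq_integrable M X" for X :: "'a \<Rightarrow> real ^ 'k::finite" and i
    by (rule sq_integrable_integrable [OF sq_integrable_nth [OF that]])
  have mult_zero: "(\<integral>\<omega>. (T *v X \<omega>) $ j \<partial>M) = 0"
    if "sq_integrable M X" "\<And>i. (\<integral>\<omega>. X \<omega> $ i \<partial>M) = 0"
    for X :: "'a \<Rightarrow> real ^ 'k::finite" and T :: "real ^ 'k ^ 'l::finite" and j
    using int [OF that(1)] that(2) by (simp add: matrix_vector_mult_def)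
  have "(\<integral>\<omega>. nom_innov S (\<rho> \<omega>) t $ i \<partial>M) = 0" for i
    unfolding nom_innov_def vector_add_component
    using mult_zero [OF pred_err_sq_integrable Suc.IH] gaussian_nth_mean [OF meas_noise_gaussian]
    by (subst Bochner_Integration.integral_add)
      (auto intro!: int sq_integrable_matrix_mult pred_err_sq_integrable meas_noise_sq_integrable)
  then have "(\<integral>\<omega>. est_err S (\<rho> \<omega>) t $ i \<partial>M) = 0" for i
    unfolding est_err_def vector_minus_component
    using mult_zero [OF nom_innov_sq_integrable] Suc.IH
    by (subst Bochner_Integration.integral_diff)
      (auto intro!: int sq_integrable_matrix_mult pred_err_sq_integrable nom_innov_sq_integrable)
  then show ?case
    unfolding pred_err_Suc vector_add_component
    using mult_zero [OF est_err_sq_integrable] gaussian_nth_mean [OF proc_noise_gaussian]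
    by (subst Bochner_Integration.integral_add)
      (auto intro!: int sq_integrable_matrix_mult est_err_sq_integrable gaussian_sq_integrable [OF proc_noise_gaussian])
qed

lemma pred_err_orthogonal:
  assumes Y: "Y \<in> borel_measurable (info t)" "sq_integrable M Y"
  shows "(\<integral>\<omega>. pred_err S (\<rho> \<omega>) t \<bullet> Y \<omega> \<partial>M) = 0"
proof -
  have "(\<integral>\<omega>. pred_err S (\<rho> \<omega>) t $ i * Y \<omega> $ i \<partial>M) = 0" for i
  proof -
    have "(\<lambda>\<omega>. pred_err S (\<rho> \<omega>) t $ i)
        \<in> borel_measurable (vimage_algebra (space M) (\<lambda>\<omega>. pred_err S (\<rho> \<omega>) t $ i) borel)"
      by (rule measurable_vimage_algebra1) simp
    then have "(\<integral>\<omega>. pred_err S (\<rho> \<omega>) t $ i * Y \<omega> $ i \<partial>M)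
      = (\<integral>\<omega>. pred_err S (\<rho> \<omega>) t $ i \<partial>M) * (\<integral>\<omega>. Y \<omega> $ i \<partial>M)"
      using Y by (intro indep_set_integral_mult [OF pred_err_nth_indep [of t i]] sq_integrable_integrable
          sq_integrable_nth pred_err_sq_integrable)
        (auto simp: borel_measurable_vec_iff)
    then show ?thesis by (simp add: pred_err_nth_mean)
  qed
  moreover have "integrable M (\<lambda>\<omega>. pred_err S (\<rho> \<omega>) t $ i * Y \<omega> $ i)" for i
    using sq_integrable_inner [OF sq_integrable_nth [OF pred_err_sq_integrable] sq_integrable_nth [OF Y(2)]]
    by simp
  ultimately show ?thesis by (simp add: inner_vec_def)
qed

text \<open>\<open>info t\<close> is contained in \<open>past t\<close>, which is independent of the
  noise at t by assumption; the Kalman identities do not enter here.\<close>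

lemma meas_noise_orthogonal:
  assumes Y: "Y \<in> borel_measurable (info t)" "sq_integrable M Y"
  shows "(\<integral>\<omega>. meas_noise (\<rho> \<omega>) t \<bullet> Y \<omega> \<partial>M) = 0"
proof -
  have Y': "Y \<in> borel_measurable (past t)"
    using Y(1) info_subset_past [OF order_refl] by (rule measurable_into_larger) simp
  have "(\<integral>\<omega>. Y \<omega> $ i * meas_noise (\<rho> \<omega>) t $ i \<partial>M) = 0" for i
  proof -
    have "(\<integral>\<omega>. Y \<omega> $ i * meas_noise (\<rho> \<omega>) t $ i \<partial>M)
      = (\<integral>\<omega>. Y \<omega> $ i \<partial>M) * (\<integral>\<omega>. meas_noise (\<rho> \<omega>) t $ i \<partial>M)"
      using Y Y' noise_alg_measurable(2)
      by (intro indep_set_integral_mult [OF indep_past_noise] sq_integrable_integrable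
          sq_integrable_nth meas_noise_sq_integrable)
        (auto simp: borel_measurable_vec_iff)
    then show ?thesis by (simp add: gaussian_nth_mean [OF meas_noise_gaussian])
  qed
  moreover have "integrable M (\<lambda>\<omega>. Y \<omega> $ i * meas_noise (\<rho> \<omega>) t $ i)" for i
    using sq_integrable_inner [OF sq_integrable_nth [OF Y(2)] sq_integrable_nth [OF meas_noise_sq_integrable]]
    by simp
  ultimately show ?thesis by (simp add: inner_vec_def mult.commute)
qed

lemma nom_innov_orthogonal:
  assumes Y: "Y \<in> borel_measurable (info t)" "sq_integrable M Y"
  shows "(\<integral>\<omega>. nom_innov S (\<rho> \<omega>) t \<bullet> Y \<omega> \<partial>M) = 0"
proof -
  have "nom_innov S (\<rho> \<omega>) t \<bullet> Y \<omega>
      = pred_err S (\<rho> \<omega>) t \<bullet> (transpose (mC S) *v Y \<omega>) + meas_noise (\<rho> \<omega>) t \<bullet> Y \<omega>" for \<omega>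
    by (simp add: nom_innov_def inner_add inner_transpose_mult)
  then have "(\<integral>\<omega>. nom_innov S (\<rho> \<omega>) t \<bullet> Y \<omega> \<partial>M)
    = (\<integral>\<omega>. pred_err S (\<rho> \<omega>) t \<bullet> (transpose (mC S) *v Y \<omega>) \<partial>M) + (\<integral>\<omega>. meas_noise (\<rho> \<omega>) t \<bullet> Y \<omega> \<partial>M)"
    by (simp only:) (intro Bochner_Integration.integral_add sq_integrable_inner pred_err_sq_integrable
        meas_noise_sq_integrable sq_integrable_matrix_mult Y(2))
  also have "\<dots> = 0"
    using Y by (simp add: pred_err_orthogonal meas_noise_orthogonal sq_integrable_matrix_mult)
  finally show ?thesis .
qed

lemma est_err_orthogonal:
  assumes Y: "Y \<in> borel_measurable (info t)" "sq_integrable M Y"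
  shows "(\<integral>\<omega>. est_err S (\<rho> \<omega>) t \<bullet> Y \<omega> \<partial>M) = 0"
proof -
  have "est_err S (\<rho> \<omega>) t \<bullet> Y \<omega>
      = pred_err S (\<rho> \<omega>) t \<bullet> Y \<omega> - nom_innov S (\<rho> \<omega>) t \<bullet> (transpose (mK S) *v Y \<omega>)" for \<omega>
    by (simp add: est_err_def inner_diff inner_transpose_mult)
  then have "(\<integral>\<omega>. est_err S (\<rho> \<omega>) t \<bullet> Y \<omega> \<partial>M)
    = (\<integral>\<omega>. pred_err S (\<rho> \<omega>) t \<bullet> Y \<omega> \<partial>M) - (\<integral>\<omega>. nom_innov S (\<rho> \<omega>) t \<bullet> (transpose (mK S) *v Y \<omega>) \<partial>M)"
    by (simp only:) (intro Bochner_Integration.integral_diff sq_integrable_inner pred_err_sq_integrable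
        nom_innov_sq_integrable sq_integrable_matrix_mult Y(2))
  also have "\<dots> = 0"
    using Y by (simp add: pred_err_orthogonal nom_innov_orthogonal sq_integrable_matrix_mult)
  finally show ?thesis .
qed

end

section \<open>The linear-quadratic problem\<close>

text \<open>The coefficient of the innovation in the costate of a single stage, as it comes out of
  the stationarity computation in \<open>riccati_step\<close>.\<close>

definition costate_gain :: "real ^ 'k::finite ^ 'k \<Rightarrow> real ^ 's::finite ^ 'k \<Rightarrow> real ^ 'k ^ 'q::finite \<Rightarrow>
    real ^ 's ^ 'q \<Rightarrow> real ^ 'r::finite ^ 'q \<Rightarrow> real ^ 'q ^ 'q \<Rightarrow> real ^ 'k ^ 'k \<Rightarrow> real ^ 's ^ 's \<Rightarrow>
    real ^ 'r ^ 'k"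
  where "costate_gain A B C D Mm F Qn G = transpose C ** F ** Mm
    - transpose (stage_mixed A B C D F Qn) ** G ** (transpose D ** F ** Mm)"

text \<open>Each stage is a difference of costate pairings at consecutive times, up to the fresh
  innovation: the next costate is formed with \<open>x (Suc t)\<close>, which exceeds A x + B e by
  an innovation term. That surplus is the summand with \<open>Qs t ** Kk\<close>; the boundary terms
  vanish because \<open>dx 0 = 0\<close> and \<open>Qs (Suc N) = 0\<close>.\<close>

lemma trajectory_cross:
  fixes A :: "real ^ 'k::finite ^ 'k" and B :: "real ^ 's::finite ^ 'k"
    and C :: "real ^ 'k ^ 'q::finite" and D :: "real ^ 's ^ 'q"
    and Mm :: "real ^ 'r::finite ^ 'q" and Kk :: "real ^ 'r ^ 'k"
  assumes step: "\<And>t. t \<le> N \<Longrightarrow> riccati_step A B C D (F t) (Qs (Suc t)) (Qs t) (G t)"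
    and GM: "\<And>t. t \<le> N \<Longrightarrow> stage_gram B D (F t) (Qs (Suc t)) ** G t ** (transpose D ** F t ** Mm)
      = transpose D ** F t ** Mm"
    and e: "\<And>t. t \<le> N \<Longrightarrow> e t = - (G t *v (stage_mixed A B C D (F t) (Qs (Suc t)) *v x t
      + (transpose D ** F t ** Mm) *v v t))"
    and x: "\<And>t. x (Suc t) = A *v x t + B *v e t + Kk *v v (Suc t)"
    and dx: "dx 0 = 0" "\<And>t. dx (Suc t) = A *v dx t + B *v de t"
    and last: "Qs (Suc N) = 0"
  shows "(\<Sum>t\<le>N. (C *v dx t + D *v de t) \<bullet> (F t *v (C *v x t + D *v e t + Mm *v v t)))
    = (\<Sum>t\<le>N. dx t \<bullet> ((costate_gain A B C D Mm (F t) (Qs (Suc t)) (G t) + Qs t ** Kk) *v v t))"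
proof -
  let ?cross = "\<lambda>t. (C *v dx t + D *v de t) \<bullet> (F t *v (C *v x t + D *v e t + Mm *v v t))"
  let ?S = "\<lambda>t. costate_gain A B C D Mm (F t) (Qs (Suc t)) (G t)"
  have cross: "?cross t = dx t \<bullet> (Qs t *v x t + ?S t *v v t)
      - dx (Suc t) \<bullet> (Qs (Suc t) *v (A *v x t + B *v e t))" if "t \<le> N" for t
    using riccati_step.stage_cross [OF step [OF that] GM [OF that] e [OF that]]
    by (simp add: dx(2) costate_gain_def)
  have "(\<Sum>t\<le>k. ?cross t) = (\<Sum>t\<le>k. dx t \<bullet> ((?S t + Qs t ** Kk) *v v t))
      - dx (Suc k) \<bullet> (Qs (Suc k) *v (A *v x k + B *v e k))" if "k \<le> N" for k
    using that
  proof (induction k)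
    case 0
    have "?cross 0 = - (dx (Suc 0) \<bullet> (Qs (Suc 0) *v (A *v x 0 + B *v e 0)))"
      unfolding cross [OF 0] by (simp add: dx(1))
    then show ?case by (simp add: dx(1))
  next
    case (Suc k)
    have "dx (Suc k) \<bullet> (Qs (Suc k) *v x (Suc k)) = dx (Suc k) \<bullet> (Qs (Suc k) *v (A *v x k + B *v e k))
        + dx (Suc k) \<bullet> ((Qs (Suc k) ** Kk) *v v (Suc k))"
      by (simp add: x matvec inner_add)
    moreover have "(\<Sum>t\<le>k. ?cross t) = (\<Sum>t\<le>k. dx t \<bullet> ((?S t + Qs t ** Kk) *v v t))
      - dx (Suc k) \<bullet> (Qs (Suc k) *v (A *v x k + B *v e k))"
      using Suc by simp
    ultimately show ?case
      using cross [OF Suc.prems] by (simp add: matrix_vector_mult_add_rdistrib inner_add)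
  qed
  from this [of N] show ?thesis by (simp add: last)
qed

section \<open>Convexity, and definiteness along the backward recursion\<close>

lemma qform_ge_linearization:
  assumes "posdef F"
  shows "qform F (x + y) \<ge> qform F x + 2 * (y \<bullet> (F *v x))"
  using assms possemidef_nonneg [OF posdef_possemidef [OF assms]] by (simp add: qform_add posdef_def)

lemma aug_C_D_fst:
  "aug_C S *v x + aug_D S *v a = (aug_H *v x </> aug_Ctilde S *v x + mPsi S *v a)"
  by (simp add: aug_C_def aug_D_def block_simps)

lemma aug_H_aug_B: "aug_H *v (aug_B S *v a) = mGamma S *v a + mB S *v (mL S *v (mK S *v (mPsi S *v a)))"
  unfolding aug_H_def aug_B_def by (simp add: block_simps) (simp add: matvec)

text \<open>\<open>aug_D\<close> has a zero state block, so no attack value can hide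
  \<open>aug_H *v x\<close> from the stage cost.\<close>

lemma riccati_step_pos:
  fixes S :: "('n::finite, 'm::finite, 's::finite, 'p::finite) model"
  assumes step: "riccati_step (aug_A S) (aug_B S) (aug_C S) (aug_D S) F Qn Q G"
    and F: "posdef F" and Qn: "\<And>x. qform Qn x \<ge> 0"
  shows "qform Q x \<ge> 0" "qform Q x = 0 \<Longrightarrow> aug_H *v x = 0"
proof -
  define a where "a = - (G *v (stage_mixed (aug_A S) (aug_B S) (aug_C S) (aug_D S) F Qn *v x))"
  have eq: "qform Q x = qform F (aug_C S *v x + aug_D S *v a) + qform Qn (aug_A S *v x + aug_B S *v a)"
    unfolding a_def by (rule riccati_step.qform_eq [OF step])
  have F_nonneg: "qform F y \<ge> 0" for y
    using F posdef_possemidef possemidef_nonneg by blast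
  show "qform Q x \<ge> 0" using eq F_nonneg Qn by simp
  assume "qform Q x = 0"
  then have "qform F (aug_C S *v x + aug_D S *v a) = 0"
    using eq F_nonneg Qn by (smt (verit))
  then have "aug_C S *v x + aug_D S *v a = 0" by (rule posdef_qform_eq_0 [OF F])
  then show "aug_H *v x = 0"
    unfolding aug_C_D_fst by (simp add: vec_eq_vcat_iff vec_eq_iff)
qed

text \<open>A kernel vector a annihilates both nonnegative summands. Definite \<open>F\<close> gives
  \<Psi> a = 0; then \<open>aug_H\<close> applied to the image of a under \<open>aug_B\<close>
  reduces to \<Gamma> a, which is 0 by the property of the zeros of \<open>Qn\<close>. Injectivity
  concludes.\<close>

lemma stage_gram_invertible:
  fixes S :: "('n::finite, 'm::finite, 's::finite, 'p::finite) model"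
  assumes inj: "inj (\<lambda>a. (mGamma S </> mPsi S) *v a)" and F: "posdef F"
    and Qn: "\<And>x. qform Qn x \<ge> 0" "\<And>x. qform Qn x = 0 \<Longrightarrow> aug_H *v x = 0"
  shows "invertible (stage_gram (aug_B S) (aug_D S) F Qn)"
proof (rule invertible_if_trivial_kernel)
  fix a assume "stage_gram (aug_B S) (aug_D S) F Qn *v a = 0"
  then have "a \<bullet> (stage_gram (aug_B S) (aug_D S) F Qn *v a) = 0" by simp
  then have sum: "qform F (aug_D S *v a) + qform Qn (aug_B S *v a) = 0"
    by (simp add: stage_gram_def matvec inner_add inner_transpose_mult qform_def)
  have F_nonneg: "qform F (aug_D S *v a) \<ge> 0"
    using F posdef_possemidef possemidef_nonneg by blast
  have "qform F (aug_D S *v a) = 0" using sum F_nonneg Qn(1) [of "aug_B S *v a"] by linarith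
  then have "aug_D S *v a = 0" by (rule posdef_qform_eq_0 [OF F])
  then have Psi: "mPsi S *v a = 0"
    by (simp add: aug_D_def vcat_mult vec_eq_vcat_iff vec_eq_iff)
  have "qform Qn (aug_B S *v a) = 0" using sum F_nonneg Qn(1) [of "aug_B S *v a"] by linarith
  then have "aug_H *v (aug_B S *v a) = 0" by (rule Qn(2))
  then have "mGamma S *v a = 0" by (simp add: aug_H_aug_B Psi)
  then have "(mGamma S </> mPsi S) *v a = (mGamma S </> mPsi S) *v 0"
    by (simp add: vcat_mult vcat_zero Psi)
  then show "a = 0" using inj by (meson injD)
qed

text \<open>Descending induction carries validity of the step, sign and zeros together: the zeros of
  the value matrix at t + 1 make the gram matrix at t invertible, and this makes the step at t
  valid. At N the normal equation of the pseudoinverse takes the place of invertibility.\<close>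

lemma riccati_recursion:
  fixes S :: "('n::finite, 'm::finite, 's::finite, 'p::finite) model"
    and Qs :: "nat \<Rightarrow> real ^ 'n aug ^ 'n aug" and F :: "nat \<Rightarrow> real ^ ('n + 'p) ^ ('n + 'p)"
    and N :: nat
  defines "L \<equiv> \<lambda>t. stage_gram (aug_B S) (aug_D S) (F t) (Qs (Suc t))"
    and "Y \<equiv> \<lambda>t. stage_mixed (aug_A S) (aug_B S) (aug_C S) (aug_D S) (F t) (Qs (Suc t))"
  defines "G \<equiv> \<lambda>t. if t = N then pinv (L t) else matrix_inv (L t)"
  assumes inj: "inj (\<lambda>a. (mGamma S </> mPsi S) *v a)"
    and F: "\<And>t. t \<le> N \<Longrightarrow> posdef (F t)" and last: "Qs (Suc N) = 0"
    and Q: "\<And>t. t \<le> N \<Longrightarrow> Qs t = transpose (aug_C S) ** F t ** aug_C S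
      + transpose (aug_A S) ** Qs (Suc t) ** aug_A S - transpose (Y t) ** G t ** Y t"
  shows "t \<le> N \<Longrightarrow> riccati_step (aug_A S) (aug_B S) (aug_C S) (aug_D S) (F t) (Qs (Suc t)) (Qs t) (G t)"
    and "t \<le> N \<Longrightarrow> L t ** G t ** (transpose (aug_D S) ** F t ** aug_M) = transpose (aug_D S) ** F t ** aug_M"
    and "t < N \<Longrightarrow> invertible (L t)"
proof -
  \<comment> \<open>Stated for all \<open>g\<close> because it serves both \<open>Y N\<close> and
    the innovation term; each is \<open>transpose (aug_D S) ** F N\<close> times a further
    factor.\<close>
  have N: "L N ** G N *v (transpose (aug_D S) ** F N *v g) = transpose (aug_D S) ** F N *v g" for g
    using pinv_normal_equation [OF F [OF order_refl], of "aug_D S" g]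
    by (simp add: L_def G_def stage_gram_def last)
  have YN: "Y N = transpose (aug_D S) ** F N ** aug_C S"
    by (simp add: Y_def stage_mixed_def last)
  have LY: "stage_gram (aug_B S) (aug_D S) (F t) (Qs (Suc t)) = L t"
    "stage_mixed (aug_A S) (aug_B S) (aug_C S) (aug_D S) (F t) (Qs (Suc t)) = Y t" for t
    by (simp_all add: L_def Y_def)
  have symF: "transpose (F t) = F t" if "t \<le> N" for t using F [OF that] by (simp add: posdef_def)
  let ?P = "\<lambda>t. riccati_step (aug_A S) (aug_B S) (aug_C S) (aug_D S) (F t) (Qs (Suc t)) (Qs t) (G t)
    \<and> (\<forall>x. qform (Qs t) x \<ge> 0 \<and> (qform (Qs t) x = 0 \<longrightarrow> aug_H *v x = 0))"
  have inv_step: "invertible (L t)" if "t < N" "?P (Suc t)" for t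
    unfolding L_def using that inj F [of t] by (intro stage_gram_invertible) auto
  have P: "?P t" if "t \<le> N" for t
    using that
  proof (induction t rule: inc_induct)
    case base
    have step: "riccati_step (aug_A S) (aug_B S) (aug_C S) (aug_D S) (F N) (Qs (Suc N)) (Qs N) (G N)"
    proof
      show "stage_gram (aug_B S) (aug_D S) (F N) (Qs (Suc N)) ** G N
          ** stage_mixed (aug_A S) (aug_B S) (aug_C S) (aug_D S) (F N) (Qs (Suc N))
        = stage_mixed (aug_A S) (aug_B S) (aug_C S) (aug_D S) (F N) (Qs (Suc N))"
        unfolding LY YN matrix_eq
        using N by (simp only: matrix_vector_mul_assoc [symmetric]) simp
    qed (simp_all add: symF last Q [OF order_refl] Y_def)
    have "qform (Qs (Suc N)) x \<ge> 0" for x by (simp add: last qform_def)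
    with step show ?case
      using riccati_step_pos [OF step F [OF order_refl]] by blast
  next
    case (step t)
    then have inv: "invertible (L t)" by (intro inv_step)
    have GL: "L t ** G t = mat 1"
      using step.hyps matrix_inv_mult [OF inv] by (simp add: G_def)
    have step': "riccati_step (aug_A S) (aug_B S) (aug_C S) (aug_D S) (F t) (Qs (Suc t)) (Qs t) (G t)"
    proof
      show "stage_gram (aug_B S) (aug_D S) (F t) (Qs (Suc t)) ** G t
          ** stage_mixed (aug_A S) (aug_B S) (aug_C S) (aug_D S) (F t) (Qs (Suc t))
        = stage_mixed (aug_A S) (aug_B S) (aug_C S) (aug_D S) (F t) (Qs (Suc t))"
        unfolding LY GL by simp
      show "transpose (Qs (Suc t)) = Qs (Suc t)"
        using step.IH by (intro riccati_step.symmetric) blast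
      show "Qs t = transpose (aug_C S) ** F t ** aug_C S + transpose (aug_A S) ** Qs (Suc t) ** aug_A S
        - transpose (stage_mixed (aug_A S) (aug_B S) (aug_C S) (aug_D S) (F t) (Qs (Suc t))) ** G t
          ** stage_mixed (aug_A S) (aug_B S) (aug_C S) (aug_D S) (F t) (Qs (Suc t))"
        using Q [of t] step.hyps by (simp add: Y_def)
    qed (use step.hyps symF in simp)
    then show ?case
      using riccati_step_pos [OF step' F [of t]] step by auto
  qed
  show "t \<le> N \<Longrightarrow> riccati_step (aug_A S) (aug_B S) (aug_C S) (aug_D S) (F t) (Qs (Suc t)) (Qs t) (G t)"
    using P by blast
  show inv: "t < N \<Longrightarrow> invertible (L t)" for t
    using P [of "Suc t"] by (intro inv_step) auto
  show "L t ** G t ** (transpose (aug_D S) ** F t ** aug_M) = transpose (aug_D S) ** F t ** aug_M" if "t \<le> N"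
  proof (cases "t = N")
    case True
    then show ?thesis
      unfolding matrix_eq using N by (simp only: matrix_vector_mul_assoc [symmetric]) simp
  next
    case False
    then have "L t ** G t = mat 1"
      using that matrix_inv_mult [OF inv] by (simp add: G_def)
    then show ?thesis by simp
  qed
qed

section \<open>Admissible attacks\<close>

text \<open>The feedback law refers to the augmented state that it generates itself. Running the
  closed loop as a recursion for the state alone breaks the circle; the initial augmented state
  depends on no attack value.\<close>

lemma feedback_exists:
  "\<exists>e. \<forall>\<omega> t. e t \<omega> = gx t *v aug_state S (\<rho> \<omega>) xs (\<lambda>k. e k \<omega>) t
    + gn t *v nom_innov S (\<rho> \<omega>) t"
proof -
  define x where "x \<omega> = rec_nat (aug_state S (\<rho> \<omega>) xs (\<lambda>_. 0) 0)
    (\<lambda>t z. aug_A S *v z + aug_B S *v (gx t *v z + gn t *v nom_innov S (\<rho> \<omega>) t)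
      + aug_K S *v nom_innov S (\<rho> \<omega>) (Suc t))" for \<omega>
  define e where "e t \<omega> = gx t *v x \<omega> t + gn t *v nom_innov S (\<rho> \<omega>) t" for t \<omega>
  have "aug_state S (\<rho> \<omega>) xs (\<lambda>k. e k \<omega>) t = x \<omega> t" for \<omega> t
  proof (induction t)
    case 0
    show ?case by (simp add: x_def aug_state_0)
  next
    case (Suc t)
    then show ?case unfolding aug_state_Suc Suc by (simp add: e_def x_def)
  qed
  then show ?thesis by (intro exI [of _ e]) (simp add: e_def)
qed

lemma aug_state_measurable:
  assumes "(\<lambda>\<omega>. init_pred (\<rho> \<omega>)) \<in> borel_measurable H"
    and "\<And>k. k \<le> t \<Longrightarrow> (\<lambda>\<omega>. nom_innov S (\<rho> \<omega>) k) \<in> borel_measurable H"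
    and "\<And>k. k < t \<Longrightarrow> e k \<in> borel_measurable H"
  shows "(\<lambda>\<omega>. aug_state S (\<rho> \<omega>) xs (\<lambda>k. e k \<omega>) t) \<in> borel_measurable H"
  using assms(2,3)
proof (induction t)
  case 0
  have [measurable]: "(\<lambda>\<omega>. nom_innov S (\<rho> \<omega>) 0) \<in> borel_measurable H" using 0(1) by simp
  note assms(1) [measurable]
  show ?case unfolding aug_state_0 by measurable
next
  case (Suc t)
  have [measurable]: "(\<lambda>\<omega>. nom_innov S (\<rho> \<omega>) (Suc t)) \<in> borel_measurable H" using Suc.prems(1) by simp
  have [measurable]: "e t \<in> borel_measurable H" using Suc.prems(2) by simp
  have [measurable]: "(\<lambda>\<omega>. aug_state S (\<rho> \<omega>) xs (\<lambda>k. e k \<omega>) t) \<in> borel_measurable H"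
    using Suc by simp
  show ?case unfolding aug_state_Suc by measurable
qed

text \<open>The prediction is the attacker's block before the innovation update. In this form the
  next innovation can be recovered from the next output and data of time t.\<close>

lemma att_pred_Suc_eq:
  "att_pred S r e (Suc t) = (mat 1 <|> 0) *v (aug_A S *v aug_state S r xs e t + aug_B S *v e t)"
proof -
  have "att_pred S r e (Suc t) + mK S *v nom_innov S r (Suc t)
      = (mat 1 <|> 0) *v aug_state S r xs e (Suc t)"
    using att_est_eq [of S r e "Suc t"] att_est_fst_block [of S r e "Suc t" xs] by metis
  moreover have "(mat 1 <|> 0) *v (aug_K S *v v) = mK S *v v" for v
    by (simp add: aug_K_def block_simps)
  ultimately show ?thesis
    unfolding aug_state_Suc matrix_vector_right_distrib by simp
qed

lemma nom_innov_eq_att_output: "nom_innov S r t = att_output S r e t - mC S *v att_pred S r e t"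
  by (metis att_innov.simps att_innov_eq)

context attack_setting
begin

lemma init_pred_measurable_info: "(\<lambda>\<omega>. init_pred (\<rho> \<omega>)) \<in> borel_measurable (info t)"
  using init_pred_measurable info_mono [of 0 t]
  by (intro measurable_into_larger [of _ "info 0" borel "info t"]) (auto simp: pre_algebra_def)

text \<open>Strong induction resolves the mutual dependence: the outputs up to t are functions of
  the initial prediction, the innovations up to t and earlier attack values, which are measurable by
  induction. The index \<open>Suc t\<close> accounts for the innovation at t, already known when
  \<open>e t\<close> is chosen.\<close>

lemma admissible_measurable_info:
  assumes adm: "admissible M S \<rho> N e" and "t \<le> N"
  shows "e t \<in> borel_measurable (info (Suc t))"
  using assms(2)
proof (induction t rule: less_induct)
  case (less t)
  obtain g where g: "g \<in> info_space t \<rightarrow>\<^sub>M borel"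
      "\<And>\<omega>. \<omega> \<in> space M \<Longrightarrow> e t \<omega> = g (att_info S (\<rho> \<omega>) (\<lambda>k. e k \<omega>) t)"
    using adm less.prems unfolding admissible_def by blast
  have e: "e k \<in> borel_measurable (info (Suc t))" if "k < t" for k
  proof (rule measurable_into_larger)
    show "e k \<in> borel_measurable (info (Suc k))" using less that by simp
    show "sets (info (Suc k)) \<subseteq> sets (info (Suc t))" using that by (intro info_mono) simp
  qed (simp only: space_info)
  have out: "(\<lambda>\<omega>. att_output S (\<rho> \<omega>) (\<lambda>k. e k \<omega>) k) \<in> borel_measurable (info (Suc t))" if "k \<le> t" for k
  proof -
    have nu: "(\<lambda>\<omega>. nom_innov S (\<rho> \<omega>) k) \<in> borel_measurable (info (Suc t))" if "k \<le> t" for k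
      using that by (intro nom_innov_measurable_info) simp
    have x: "(\<lambda>\<omega>. aug_state S (\<rho> \<omega>) 0 (\<lambda>k. e k \<omega>) k) \<in> borel_measurable (info (Suc t))"
      using that by (intro aug_state_measurable init_pred_measurable_info nu e) auto
    \<comment> \<open>The output is the innovation plus the predicted output; the target is set to 0
      because only the first block is read off.\<close>
    have "att_output S (\<rho> \<omega>) (\<lambda>k. e k \<omega>) k = nom_innov S (\<rho> \<omega>) k
        + mC S *v ((mat 1 <|> 0) *v aug_state S (\<rho> \<omega>) 0 (\<lambda>k. e k \<omega>) k - mK S *v nom_innov S (\<rho> \<omega>) k)" for \<omega>
      using nom_innov_eq_att_output [of S "\<rho> \<omega>" k "\<lambda>k. e k \<omega>"] att_est_eq [of S "\<rho> \<omega>" "\<lambda>k. e k \<omega>" k]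
        att_est_fst_block [of S "\<rho> \<omega>" "\<lambda>k. e k \<omega>" k 0] by (metis add_diff_cancel_right' diff_add_cancel)
    then show ?thesis using nu [OF that] x by simp
  qed
  have pre: "(\<lambda>\<omega>. restrict (pre_output (\<rho> \<omega>)) {..<0}) \<in> measurable (info (Suc t)) (\<Pi>\<^sub>M i\<in>{..<0}. borel)"
  proof (rule measurable_into_larger)
    show "(\<lambda>\<omega>. restrict (pre_output (\<rho> \<omega>)) {..<0}) \<in> measurable (info 0) (\<Pi>\<^sub>M i\<in>{..<0}. borel)"
      unfolding info.simps pre_algebra_def by (intro measurable_vimage_algebra1) (auto simp: space_PiM)
    show "sets (info 0) \<subseteq> sets (info (Suc t))" by (rule info_mono) simp
  qed (simp only: space_info)
  have "(\<lambda>\<omega>. att_info S (\<rho> \<omega>) (\<lambda>k. e k \<omega>) t) \<in> measurable (info (Suc t)) (info_space t)"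
    unfolding att_info_def info_space_def
    using out e by (intro measurable_Pair [OF pre] measurable_Pair measurable_restrict) (auto simp del: info.simps)
  from measurable_compose [OF this g(1)]
  have "(\<lambda>\<omega>. g (att_info S (\<rho> \<omega>) (\<lambda>k. e k \<omega>) t)) \<in> borel_measurable (info (Suc t))" .
  then show ?case
    by (rule measurable_cong [THEN iffD1, rotated]) (simp only: space_info g(2))
qed

lemma admissible_measurable:
  assumes "admissible M S \<rho> N e" "t \<le> N"
  shows "e t \<in> borel_measurable M"
  by (rule measurable_into_larger [OF admissible_measurable_info [OF assms] info_subset]) (rule space_info)

lemma init_pred_measurable_M: "(\<lambda>\<omega>. init_pred (\<rho> \<omega>)) \<in> borel_measurable M"
  using init_pred_gaussian by (rule gaussian_measurable)

text \<open>The converse passage, from outputs to innovations: innovations and augmented states up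
  to t are reconstructed from the attacker's information, and the factorization lemma then yields
  the required function.\<close>

lemma feedback_admissible:
  assumes e: "\<And>t \<omega>. t \<le> N \<Longrightarrow> \<omega> \<in> space M \<Longrightarrow>
    e t \<omega> = gx t *v aug_state S (\<rho> \<omega>) xs (\<lambda>k. e k \<omega>) t + gn t *v nom_innov S (\<rho> \<omega>) t"
  shows "admissible M S \<rho> N e"
  unfolding admissible_def
proof (intro allI impI)
  fix t assume t: "t \<le> N"
  let ?I = "\<lambda>\<omega>. att_info S (\<rho> \<omega>) (\<lambda>k. e k \<omega>) t"
  define H where "H = vimage_algebra (space M) ?I (info_space t)"
  have sp: "space H = space M" by (simp add: H_def)
  have I: "?I \<in> space M \<rightarrow> space (info_space t)"
    by (auto simp: att_info_def info_space_def space_pair_measure space_PiM)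
  have IH: "?I \<in> measurable H (info_space t)"
    unfolding H_def using I by (rule measurable_vimage_algebra1)
  note split = info_space_def att_info_def
  have pre: "(\<lambda>\<omega>. restrict (pre_output (\<rho> \<omega>)) {..<0}) \<in> measurable H (\<Pi>\<^sub>M i\<in>{..<0}. borel)"
    using measurable_compose [OF IH [unfolded split] measurable_fst] by simp
  have rest: "(\<lambda>\<omega>. (restrict (att_output S (\<rho> \<omega>) (\<lambda>k. e k \<omega>)) {..t}, restrict (\<lambda>k. e k \<omega>) {..<t}))
      \<in> measurable H ((\<Pi>\<^sub>M i\<in>{..t}. borel) \<Otimes>\<^sub>M (\<Pi>\<^sub>M i\<in>{..<t}. borel))"
    using measurable_compose [OF IH [unfolded split] measurable_snd] by simp
  have out: "(\<lambda>\<omega>. att_output S (\<rho> \<omega>) (\<lambda>k. e k \<omega>) k) \<in> borel_measurable H" if "k \<le> t" for k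
    using measurable_compose [OF measurable_compose [OF rest measurable_fst] measurable_component_singleton [of k]] that
    by simp
  have eH: "e k \<in> borel_measurable H" if "k < t" for k
    using measurable_compose [OF measurable_compose [OF rest measurable_snd] measurable_component_singleton [of k]] that
    by simp
  have pred: "(\<lambda>\<omega>. init_pred (\<rho> \<omega>)) \<in> borel_measurable H"
  proof (rule measurable_into_larger [OF init_pred_measurable])
    show "sets (pre_algebra M \<rho>) \<subseteq> sets H"
      unfolding pre_algebra_def by (rule sets_image_in_sets [OF sp pre])
  qed (simp add: pre_algebra_def sp)
  \<comment> \<open>A joint induction: the innovation at k + 1 needs the augmented state and the
    attack value at k, and the augmented state at k + 1 needs that innovation.\<close>
  have "(\<lambda>\<omega>. nom_innov S (\<rho> \<omega>) k) \<in> borel_measurable H \<and>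
      (\<lambda>\<omega>. aug_state S (\<rho> \<omega>) xs (\<lambda>k. e k \<omega>) k) \<in> borel_measurable H" if "k \<le> t" for k
    using that
  proof (induction k)
    case 0
    have "(\<lambda>\<omega>. att_output S (\<rho> \<omega>) (\<lambda>k. e k \<omega>) 0 - mC S *v init_pred (\<rho> \<omega>)) \<in> borel_measurable H"
      using out [OF 0] pred by simp
    moreover have "att_output S (\<rho> \<omega>) (\<lambda>k. e k \<omega>) 0 - mC S *v init_pred (\<rho> \<omega>) = nom_innov S (\<rho> \<omega>) 0" for \<omega>
      using nom_innov_eq_att_output [of S "\<rho> \<omega>" 0 "\<lambda>k. e k \<omega>"] by simp
    ultimately have nu: "(\<lambda>\<omega>. nom_innov S (\<rho> \<omega>) 0) \<in> borel_measurable H" by simp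
    moreover have "(\<lambda>\<omega>. aug_state S (\<rho> \<omega>) xs (\<lambda>k. e k \<omega>) 0) \<in> borel_measurable H"
      using nu pred by (intro aug_state_measurable) auto
    ultimately show ?case ..
  next
    case (Suc k)
    then have x [measurable]: "(\<lambda>\<omega>. aug_state S (\<rho> \<omega>) xs (\<lambda>k. e k \<omega>) k) \<in> borel_measurable H" by simp
    have [measurable]: "e k \<in> borel_measurable H" using eH Suc.prems by simp
    have [measurable]: "(\<lambda>\<omega>. att_output S (\<rho> \<omega>) (\<lambda>k. e k \<omega>) (Suc k)) \<in> borel_measurable H"
      by (rule out [OF Suc.prems])
    have "nom_innov S (\<rho> \<omega>) (Suc k) = att_output S (\<rho> \<omega>) (\<lambda>k. e k \<omega>) (Suc k)
        - mC S *v ((mat 1 <|> 0) *v (aug_A S *v aug_state S (\<rho> \<omega>) xs (\<lambda>k. e k \<omega>) k + aug_B S *v e k \<omega>))" for \<omega>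
      unfolding nom_innov_eq_att_output [of S "\<rho> \<omega>" "Suc k" "\<lambda>k. e k \<omega>"] att_pred_Suc_eq [of _ _ _ _ xs] ..
    then have [measurable]: "(\<lambda>\<omega>. nom_innov S (\<rho> \<omega>) (Suc k)) \<in> borel_measurable H" by simp
    show ?case unfolding aug_state_Suc by measurable
  qed
  from this [of t] have [measurable]: "(\<lambda>\<omega>. nom_innov S (\<rho> \<omega>) t) \<in> borel_measurable H"
      "(\<lambda>\<omega>. aug_state S (\<rho> \<omega>) xs (\<lambda>k. e k \<omega>) t) \<in> borel_measurable H" by auto
  have "(\<lambda>\<omega>. gx t *v aug_state S (\<rho> \<omega>) xs (\<lambda>k. e k \<omega>) t + gn t *v nom_innov S (\<rho> \<omega>) t)
      \<in> borel_measurable H" by measurable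
  then have "e t \<in> borel_measurable H"
    by (rule measurable_cong [THEN iffD1, rotated]) (simp add: sp e [OF t])
  then show "\<exists>g\<in>info_space t \<rightarrow>\<^sub>M borel. \<forall>\<omega>\<in>space M. e t \<omega> = g (?I \<omega>)"
    unfolding H_def by (rule factorization_vec [OF I])
qed

section \<open>Optimality\<close>

lemma aug_state_0_sq_integrable: "sq_integrable M (\<lambda>\<omega>. aug_state S (\<rho> \<omega>) xs (\<lambda>k. e k \<omega>) 0)"
  unfolding aug_state_0
  by (intro sq_integrable_vcat sq_integrable_add sq_integrable_matrix_mult sq_integrable_const
      nom_innov_sq_integrable gaussian_sq_integrable [OF init_pred_gaussian])

lemma feedback_sq_integrable:
  assumes e: "\<And>t \<omega>. t \<le> N \<Longrightarrow> \<omega> \<in> space M \<Longrightarrow>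
    e t \<omega> = gx t *v aug_state S (\<rho> \<omega>) xs (\<lambda>k. e k \<omega>) t + gn t *v nom_innov S (\<rho> \<omega>) t"
    and "t \<le> N"
  shows "sq_integrable M (\<lambda>\<omega>. aug_state S (\<rho> \<omega>) xs (\<lambda>k. e k \<omega>) t)" "sq_integrable M (e t)"
proof -
  have e_sq: "sq_integrable M (e t)"
    if "sq_integrable M (\<lambda>\<omega>. aug_state S (\<rho> \<omega>) xs (\<lambda>k. e k \<omega>) t)" "t \<le> N" for t
  proof (rule sq_integrable_cong)
    show "sq_integrable M (\<lambda>\<omega>. gx t *v aug_state S (\<rho> \<omega>) xs (\<lambda>k. e k \<omega>) t + gn t *v nom_innov S (\<rho> \<omega>) t)"
      by (intro sq_integrable_add sq_integrable_matrix_mult that(1) nom_innov_sq_integrable)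
  qed (simp add: e [OF that(2)])
  show *: "sq_integrable M (\<lambda>\<omega>. aug_state S (\<rho> \<omega>) xs (\<lambda>k. e k \<omega>) t)"
    using assms(2)
  proof (induction t)
    case (Suc t)
    then have x: "sq_integrable M (\<lambda>\<omega>. aug_state S (\<rho> \<omega>) xs (\<lambda>k. e k \<omega>) t)" by simp
    show ?case
      unfolding aug_state_Suc using Suc.prems
      by (intro sq_integrable_add sq_integrable_matrix_mult x nom_innov_sq_integrable e_sq [OF x]) simp
  qed (rule aug_state_0_sq_integrable)
  show "sq_integrable M (e t)" by (rule e_sq [OF * assms(2)])
qed

definition run_cost :: "real ^ 'n \<Rightarrow> (nat \<Rightarrow> real ^ 'n ^ 'n) \<Rightarrow> (nat \<Rightarrow> real ^ 'p ^ 'p) \<Rightarrow> nat \<Rightarrow>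
    (nat \<Rightarrow> 'a \<Rightarrow> real ^ 's) \<Rightarrow> 'a \<Rightarrow> real"
  where "run_cost xs Q R N e \<omega> = (\<Sum>t\<le>N. qform (Q t) (plant_state S (\<rho> \<omega>) (\<lambda>k. e k \<omega>) t - xs)
    + qform (R t) (sys_innov S (\<rho> \<omega>) (\<lambda>k. e k \<omega>) t))"

text \<open>
  Finite cost bounds \<open>x\<^sub>t\<close> and \<open>\<nu>\<^sup>e\<^sub>t\<close> in mean square; these determine \<open>\<Gamma> e\<^sub>t\<close> and \<open>\<Psi> e\<^sub>t\<close> up to square
  integrable terms, hence \<open>e\<^sub>t\<close> for \<open>t < N\<close> by injectivity.
\<close>

lemma finite_cost_sq_integrable:
  assumes QR: "\<And>t. t \<le> N \<Longrightarrow> posdef (Q t)" "\<And>t. t \<le> N \<Longrightarrow> posdef (R t)"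
    and adm: "admissible M S \<rho> N e" and finite: "attack_cost M S \<rho> xs Q R N e < \<infinity>"
    and "t \<le> N"
  shows "integrable M (run_cost xs Q R N e)"
    and "sq_integrable M (\<lambda>\<omega>. aug_state S (\<rho> \<omega>) xs (\<lambda>k. e k \<omega>) t)"
proof -
  let ?x = "\<lambda>t \<omega>. plant_state S (\<rho> \<omega>) (\<lambda>k. e k \<omega>) t - xs"
  let ?\<nu> = "\<lambda>t \<omega>. sys_innov S (\<rho> \<omega>) (\<lambda>k. e k \<omega>) t"
  let ?\<xi> = "\<lambda>t \<omega>. aug_state S (\<rho> \<omega>) xs (\<lambda>k. e k \<omega>) t"
  have x_eq: "?x t \<omega> = aug_H *v ?\<xi> t \<omega> + est_err S (\<rho> \<omega>) t" for t \<omega>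
    unfolding aug_H_aug_state plant_state_eq_att_est by simp
  have \<nu>_eq: "?\<nu> t \<omega> = nom_innov S (\<rho> \<omega>) t + aug_Ctilde S *v ?\<xi> t \<omega> + mPsi S *v e t \<omega>" for t \<omega>
    unfolding sys_innov_eq by (simp add: aug_Ctilde_def aug_state_def block_simps del: att_est.simps)
  have \<xi>_meas: "?\<xi> t \<in> borel_measurable M" if "t \<le> N" for t
    using that by (intro aug_state_measurable init_pred_measurable_M nom_innov_measurable
        admissible_measurable [OF adm]) simp
  have meas: "?x t \<in> borel_measurable M" "?\<nu> t \<in> borel_measurable M" if "t \<le> N" for t
    unfolding x_eq \<nu>_eq
    using \<xi>_meas [OF that] admissible_measurable [OF adm that] nom_innov_measurable [of t]
      sq_integrable_measurable [OF est_err_sq_integrable [of t]] by measurable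
  have nonneg: "qform (Q t) v \<ge> 0" "qform (R t) w \<ge> 0" if "t \<le> N" for t v w
    using QR [OF that] posdef_possemidef possemidef_nonneg by blast+
  have cost_nonneg: "run_cost xs Q R N e \<omega> \<ge> 0" for \<omega>
    unfolding run_cost_def by (intro sum_nonneg add_nonneg_nonneg nonneg) auto
  show int: "integrable M (run_cost xs Q R N e)"
  proof (rule integrableI_nonneg)
    show "run_cost xs Q R N e \<in> borel_measurable M"
      unfolding run_cost_def qform_def using meas by (intro borel_measurable_sum) simp
    show "(\<integral>\<^sup>+ \<omega>. ennreal (run_cost xs Q R N e \<omega>) \<partial>M) < \<infinity>"
      using finite unfolding attack_cost_def run_cost_def .
  qed (simp add: cost_nonneg)
  have sq: "sq_integrable M (?x t)" "sq_integrable M (?\<nu> t)" if t: "t \<le> N" for t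
  proof -
    have le: "qform (Q t) (?x t \<omega>) + qform (R t) (?\<nu> t \<omega>) \<le> run_cost xs Q R N e \<omega>" for \<omega>
      unfolding run_cost_def using t
      by (intro member_le_sum [of t "{..N}" "\<lambda>t. qform (Q t) (?x t \<omega>) + qform (R t) (?\<nu> t \<omega>)"])
        (auto intro!: add_nonneg_nonneg nonneg)
    obtain c where c: "c > 0" "\<And>v. c * (norm v)\<^sup>2 \<le> qform (Q t) v"
      using posdef_lower_bound [OF QR(1) [OF t]] by blast
    obtain d where d: "d > 0" "\<And>v. d * (norm v)\<^sup>2 \<le> qform (R t) v"
      using posdef_lower_bound [OF QR(2) [OF t]] by blast
    show "sq_integrable M (?x t)"
    proof (rule sq_integrable_bound)
      show "integrable M (\<lambda>\<omega>. run_cost xs Q R N e \<omega> / c)" using int by simp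
      show "(norm (?x t \<omega>))\<^sup>2 \<le> run_cost xs Q R N e \<omega> / c" for \<omega>
        using le [of \<omega>] c(2) [of "?x t \<omega>"] nonneg(2) [OF t, of "?\<nu> t \<omega>"] c(1)
        by (simp only: pos_le_divide_eq mult.commute [of _ c])
    qed (rule meas [OF t])
    show "sq_integrable M (?\<nu> t)"
    proof (rule sq_integrable_bound)
      show "integrable M (\<lambda>\<omega>. run_cost xs Q R N e \<omega> / d)" using int by simp
      show "(norm (?\<nu> t \<omega>))\<^sup>2 \<le> run_cost xs Q R N e \<omega> / d" for \<omega>
        using le [of \<omega>] d(2) [of "?\<nu> t \<omega>"] nonneg(1) [OF t, of "?x t \<omega>"] d(1)
        by (simp only: pos_le_divide_eq mult.commute [of _ d])
    qed (rule meas [OF t])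
  qed
  \<comment> \<open>A left inverse of the stacked attack matrix recovers \<open>e t\<close> from its
    two images.\<close>
  obtain T where T: "T ** (mGamma S </> mPsi S) = mat 1"
    using attack_injective matrix_left_invertible_injective by blast
  show "sq_integrable M (?\<xi> t)"
    using assms(5)
  proof (induction t)
    case (Suc t)
    then have t: "t \<le> N" "Suc t \<le> N" and \<xi>: "sq_integrable M (?\<xi> t)" by auto
    have "mPsi S *v e t \<omega> = ?\<nu> t \<omega> - nom_innov S (\<rho> \<omega>) t - aug_Ctilde S *v ?\<xi> t \<omega>" for \<omega>
      unfolding \<nu>_eq by simp
    then have Psi: "sq_integrable M (\<lambda>\<omega>. mPsi S *v e t \<omega>)"
      by (simp only:) (intro sq_integrable_diff sq_integrable_matrix_mult sq t nom_innov_sq_integrable \<xi>)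
    \<comment> \<open>This image of \<open>e t\<close> becomes visible in the state only one step
      later, so the bound at \<open>Suc t\<close> is what is used.\<close>
    have "mGamma S *v e t \<omega> = ?x (Suc t) \<omega> - est_err S (\<rho> \<omega>) (Suc t) - aug_H *v (aug_A S *v ?\<xi> t \<omega>)
        - aug_H *v (aug_K S *v nom_innov S (\<rho> \<omega>) (Suc t))
        - mB S *v (mL S *v (mK S *v (mPsi S *v e t \<omega>)))" for \<omega>
      unfolding x_eq aug_state_Suc matrix_vector_right_distrib aug_H_aug_B by simp
    then have "sq_integrable M (\<lambda>\<omega>. mGamma S *v e t \<omega>)"
      by (simp only:) (intro sq_integrable_diff sq_integrable_matrix_mult sq t nom_innov_sq_integrable
          est_err_sq_integrable \<xi> Psi)
    from sq_integrable_matrix_mult [OF sq_integrable_vcat [OF this Psi]]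
    have "sq_integrable M (\<lambda>\<omega>. T *v (mGamma S *v e t \<omega> </> mPsi S *v e t \<omega>))" .
    moreover have "T *v (mGamma S *v e t \<omega> </> mPsi S *v e t \<omega>) = e t \<omega>" for \<omega>
      unfolding vcat_mult [symmetric] matrix_vector_mul_assoc T by simp
    ultimately have "sq_integrable M (e t)" by simp
    then show ?case
      unfolding aug_state_Suc
      by (intro sq_integrable_add sq_integrable_matrix_mult \<xi> nom_innov_sq_integrable)
  qed (rule aug_state_0_sq_integrable)
qed

text \<open>Pathwise the extra cost is at least \<open>2 * cross\<close>; the remaining work is that
  \<open>cross\<close> is integrable with mean zero.\<close>

lemma feedback_optimal:
  fixes Q :: "nat \<Rightarrow> real ^ 'n ^ 'n" and R :: "nat \<Rightarrow> real ^ 'p ^ 'p"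
  defines "F \<equiv> \<lambda>t. aug_F (Q t) (R t)"
  assumes QR: "\<And>t. t \<le> N \<Longrightarrow> posdef (Q t)" "\<And>t. t \<le> N \<Longrightarrow> posdef (R t)"
    and step: "\<And>t. t \<le> N \<Longrightarrow>
      riccati_step (aug_A S) (aug_B S) (aug_C S) (aug_D S) (F t) (Qs (Suc t)) (Qs t) (G t)"
    and GM: "\<And>t. t \<le> N \<Longrightarrow> stage_gram (aug_B S) (aug_D S) (F t) (Qs (Suc t)) ** G t
      ** (transpose (aug_D S) ** F t ** aug_M) = transpose (aug_D S) ** F t ** aug_M"
    and last: "Qs (Suc N) = 0"
    and e: "\<And>t \<omega>. t \<le> N \<Longrightarrow> \<omega> \<in> space M \<Longrightarrow> e t \<omega> =
      - (G t *v (stage_mixed (aug_A S) (aug_B S) (aug_C S) (aug_D S) (F t) (Qs (Suc t))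
          *v aug_state S (\<rho> \<omega>) xs (\<lambda>k. e k \<omega>) t
        + (transpose (aug_D S) ** F t ** aug_M) *v nom_innov S (\<rho> \<omega>) t))"
    and adm: "admissible M S \<rho> N e" and adm': "admissible M S \<rho> N e'"
  shows "attack_cost M S \<rho> xs Q R N e \<le> attack_cost M S \<rho> xs Q R N e'"
proof (cases "attack_cost M S \<rho> xs Q R N e' < \<infinity>")
  case finite: True
  let ?\<xi> = "\<lambda>t \<omega>. aug_state S (\<rho> \<omega>) xs (\<lambda>k. e k \<omega>) t"
  let ?\<xi>' = "\<lambda>t \<omega>. aug_state S (\<rho> \<omega>) xs (\<lambda>k. e' k \<omega>) t"
  let ?\<nu> = "\<lambda>t \<omega>. nom_innov S (\<rho> \<omega>) t"
  let ?z = "\<lambda>t \<omega>. aug_C S *v ?\<xi> t \<omega> + aug_D S *v e t \<omega> + aug_M *v ?\<nu> t \<omega>"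
  define dx where "dx t \<omega> = ?\<xi>' t \<omega> - ?\<xi> t \<omega>" for t \<omega>
  define de where "de t \<omega> = e' t \<omega> - e t \<omega>" for t \<omega>
  define dz where "dz t \<omega> = aug_C S *v dx t \<omega> + aug_D S *v de t \<omega>" for t \<omega>
  define T where "T t = costate_gain (aug_A S) (aug_B S) (aug_C S) (aug_D S) aug_M (F t) (Qs (Suc t)) (G t)
    + Qs t ** aug_K S" for t
  have F: "posdef (F t)" if "t \<le> N" for t
    unfolding F_def using QR that by (intro posdef_aug_F)
  have dx_0: "dx 0 \<omega> = 0" for \<omega> by (simp add: dx_def aug_state_0)
  have dx_Suc: "dx (Suc t) \<omega> = aug_A S *v dx t \<omega> + aug_B S *v de t \<omega>" for t \<omega>
    unfolding dx_def de_def aug_state_Suc by (simp add: matvec)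

  \<comment> \<open>Both summands pair a quantity orthogonal to \<open>info t\<close> with a matrix
    image of \<open>dx t\<close>, the form that the orthogonality lemmas require; no
    \<open>de t\<close> occurs.\<close>
  define cross where "cross \<omega> = (\<Sum>t\<le>N. ?\<nu> t \<omega> \<bullet> (transpose (T t) *v dx t \<omega>)
    + est_err S (\<rho> \<omega>) t \<bullet> (Q t *v (aug_H *v dx t \<omega>)))" for \<omega>

  have cost: "run_cost xs Q R N f \<omega> = (\<Sum>t\<le>N. qform (F t) (aug_C S *v aug_state S (\<rho> \<omega>) xs (\<lambda>k. f k \<omega>) t
      + aug_D S *v f t \<omega> + aug_M *v ?\<nu> t \<omega> + (est_err S (\<rho> \<omega>) t </> 0)))" for f \<omega>
    unfolding run_cost_def F_def stage_cost_eq ..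
  have cross_eq: "(\<Sum>t\<le>N. dz t \<omega> \<bullet> (F t *v (?z t \<omega> + (est_err S (\<rho> \<omega>) t </> 0)))) = cross \<omega>"
    if \<omega>: "\<omega> \<in> space M" for \<omega>
  proof -
    have "(\<Sum>t\<le>N. dz t \<omega> \<bullet> (F t *v ?z t \<omega>)) = (\<Sum>t\<le>N. dx t \<omega> \<bullet> (T t *v ?\<nu> t \<omega>))"
      unfolding dz_def T_def
    proof (rule trajectory_cross [where e = "\<lambda>t. e t \<omega>" and v = "\<lambda>t. ?\<nu> t \<omega>" and Kk = "aug_K S"])
      show "aug_state S (\<rho> \<omega>) xs (\<lambda>k. e k \<omega>) (Suc t) = aug_A S *v ?\<xi> t \<omega> + aug_B S *v e t \<omega>
          + aug_K S *v ?\<nu> (Suc t) \<omega>" for t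
        by (rule aug_state_Suc)
    qed (use step GM last e \<omega> dx_0 dx_Suc in auto)
    also have "\<dots> = (\<Sum>t\<le>N. ?\<nu> t \<omega> \<bullet> (transpose (T t) *v dx t \<omega>))"
      by (intro sum.cong refl) (metis inner_commute inner_transpose_mult)
    finally have 1: "(\<Sum>t\<le>N. dz t \<omega> \<bullet> (F t *v ?z t \<omega>)) = (\<Sum>t\<le>N. ?\<nu> t \<omega> \<bullet> (transpose (T t) *v dx t \<omega>))" .
    \<comment> \<open>The state block of \<open>dz\<close> is \<open>aug_H *v dx t\<close>, as
      \<open>aug_D\<close> vanishes there; so the estimation error is paired with no attack value of
      time t.\<close>
    have 2: "dz t \<omega> \<bullet> (F t *v (est_err S (\<rho> \<omega>) t </> 0)) = est_err S (\<rho> \<omega>) t \<bullet> (Q t *v (aug_H *v dx t \<omega>))"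
      if "t \<le> N" for t
    proof -
      have "dz t \<omega> \<bullet> (F t *v (est_err S (\<rho> \<omega>) t </> 0)) = (aug_H *v dx t \<omega>) \<bullet> (Q t *v est_err S (\<rho> \<omega>) t)"
        unfolding dz_def aug_C_D_fst by (simp add: F_def aug_F_def block_simps inner_vcat)
      also have "\<dots> = est_err S (\<rho> \<omega>) t \<bullet> (Q t *v (aug_H *v dx t \<omega>))"
        using symmetric_inner [of "Q t"] QR(1) [OF that] by (metis inner_commute posdef_def)
      finally show ?thesis .
    qed
    have "dz t \<omega> \<bullet> (F t *v (?z t \<omega> + (est_err S (\<rho> \<omega>) t </> 0)))
        = dz t \<omega> \<bullet> (F t *v ?z t \<omega>) + dz t \<omega> \<bullet> (F t *v (est_err S (\<rho> \<omega>) t </> 0))" for t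
      by (simp only: matrix_vector_right_distrib [of "F t" "?z t \<omega>"] inner_add_right)
    then have "(\<Sum>t\<le>N. dz t \<omega> \<bullet> (F t *v (?z t \<omega> + (est_err S (\<rho> \<omega>) t </> 0))))
        = (\<Sum>t\<le>N. dz t \<omega> \<bullet> (F t *v ?z t \<omega>)) + (\<Sum>t\<le>N. dz t \<omega> \<bullet> (F t *v (est_err S (\<rho> \<omega>) t </> 0)))"
      by (simp only: sum.distrib)
    then show ?thesis unfolding 1 cross_def using 2 by (simp add: sum.distrib)
  qed
  \<comment> \<open>The stage costs are linearized at the proposed attack with the estimation error
    included, so that the first-order term is the true one for each realization.\<close>
  have ineq: "run_cost xs Q R N e \<omega> + 2 * cross \<omega> \<le> run_cost xs Q R N e' \<omega>" if \<omega>: "\<omega> \<in> space M" for \<omega>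
  proof -
    let ?a = "\<lambda>t. ?z t \<omega> + (est_err S (\<rho> \<omega>) t </> 0)"
    have "(\<Sum>t\<le>N. qform (F t) (?a t) + 2 * (dz t \<omega> \<bullet> (F t *v ?a t))) \<le> (\<Sum>t\<le>N. qform (F t) (?a t + dz t \<omega>))"
      by (intro sum_mono qform_ge_linearization F) simp
    moreover have "?a t + dz t \<omega> = aug_C S *v ?\<xi>' t \<omega> + aug_D S *v e' t \<omega> + aug_M *v ?\<nu> t \<omega> + (est_err S (\<rho> \<omega>) t </> 0)" for t
      unfolding dz_def dx_def de_def by (simp add: matvec)
    ultimately show ?thesis
      unfolding cost cross_eq [OF \<omega>, symmetric] by (simp only: sum.distrib sum_distrib_left)
  qed

  define gx where "gx t = - (G t ** stage_mixed (aug_A S) (aug_B S) (aug_C S) (aug_D S) (F t) (Qs (Suc t)))" for t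
  define gn where "gn t = - (G t ** (transpose (aug_D S) ** F t ** aug_M))" for t
  have fb: "e t \<omega> = gx t *v ?\<xi> t \<omega> + gn t *v ?\<nu> t \<omega>" if "t \<le> N" "\<omega> \<in> space M" for t \<omega>
    unfolding e [OF that] gx_def gn_def by (simp add: matvec)
  note sq = feedback_sq_integrable [OF fb]
  note sq' = finite_cost_sq_integrable [OF QR adm' finite]
  have dx_sq: "sq_integrable M (dx t)" if "t \<le> N" for t
    unfolding dx_def using sq(1) [OF _ _ that] sq'(2) [OF _ _ that] by (intro sq_integrable_diff) auto
  \<comment> \<open>Both trajectories receive the same innovation at t, which cancels in
    \<open>dx t\<close>. Hence \<open>info t\<close> suffices, although each augmented state by
    itself involves the innovation at t.\<close>
  have dx_meas: "dx t \<in> borel_measurable (info t)" if "t \<le> N" for t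
    using that
  proof (induction t)
    case 0
    then show ?case by (simp add: dx_0 [abs_def])
  next
    case (Suc t)
    have into: "f \<in> borel_measurable (info (Suc t))" if "f \<in> borel_measurable (info t)" for f :: "'a \<Rightarrow> real ^ 'n aug"
      by (rule measurable_into_larger [OF that info_mono_Suc]) (simp only: space_info)
    have [measurable]: "dx t \<in> borel_measurable (info (Suc t))" using Suc by (intro into) simp
    have [measurable]: "e t \<in> borel_measurable (info (Suc t))" "e' t \<in> borel_measurable (info (Suc t))"
      using admissible_measurable_info [OF adm] admissible_measurable_info [OF adm'] Suc.prems
      by (auto simp del: info.simps)
    have "(\<lambda>\<omega>. aug_A S *v dx t \<omega> + aug_B S *v (e' t \<omega> - e t \<omega>)) \<in> borel_measurable (info (Suc t))"
      by measurable
    then show ?case unfolding dx_Suc [abs_def] de_def .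
  qed
  have int_cross_terms: "integrable M (\<lambda>\<omega>. ?\<nu> t \<omega> \<bullet> (transpose (T t) *v dx t \<omega>))"
      "integrable M (\<lambda>\<omega>. est_err S (\<rho> \<omega>) t \<bullet> (Q t *v (aug_H *v dx t \<omega>)))" if "t \<le> N" for t
    by (intro sq_integrable_inner sq_integrable_matrix_mult nom_innov_sq_integrable est_err_sq_integrable
        dx_sq [OF that])+
  have cross_int: "integrable M cross"
    unfolding cross_def using int_cross_terms
    by (intro Bochner_Integration.integrable_sum Bochner_Integration.integrable_add) auto
  have "integral\<^sup>L M cross = 0"
  proof -
    have "integral\<^sup>L M cross = (\<Sum>t\<le>N. (\<integral>\<omega>. ?\<nu> t \<omega> \<bullet> (transpose (T t) *v dx t \<omega>) \<partial>M)
        + (\<integral>\<omega>. est_err S (\<rho> \<omega>) t \<bullet> (Q t *v (aug_H *v dx t \<omega>)) \<partial>M))"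
      unfolding cross_def using int_cross_terms
      by (subst Bochner_Integration.integral_sum) (auto intro!: sum.cong Bochner_Integration.integral_add)
    also have "\<dots> = 0"
      using dx_meas dx_sq
      by (intro sum.neutral ballI) (simp add: nom_innov_orthogonal est_err_orthogonal sq_integrable_matrix_mult)
    finally show ?thesis .
  qed
  have cost_int': "integrable M (run_cost xs Q R N e')" using sq'(1) by blast
  have cost_int: "integrable M (run_cost xs Q R N e)"
    unfolding cost
    by (intro Bochner_Integration.integrable_sum sq_integrable_qform sq_integrable_add sq_integrable_vcat
        sq_integrable_matrix_mult sq_integrable_const sq nom_innov_sq_integrable est_err_sq_integrable) auto
  have nonneg: "0 \<le> run_cost xs Q R N f \<omega>" for f \<omega>
    unfolding run_cost_def
    by (intro sum_nonneg add_nonneg_nonneg possemidef_nonneg posdef_possemidef QR) auto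
  have attack_cost_eq: "attack_cost M S \<rho> xs Q R N f = ennreal (integral\<^sup>L M (run_cost xs Q R N f))"
    if "integrable M (run_cost xs Q R N f)" for f
    unfolding attack_cost_def run_cost_def [symmetric]
    using that nonneg by (intro nn_integral_eq_integral) auto
  have "integral\<^sup>L M (run_cost xs Q R N e) = (\<integral>\<omega>. run_cost xs Q R N e \<omega> + 2 * cross \<omega> \<partial>M)"
    using cost_int cross_int \<open>integral\<^sup>L M cross = 0\<close> by simp
  also have "\<dots> \<le> integral\<^sup>L M (run_cost xs Q R N e')"
    using cost_int cross_int cost_int' ineq by (intro integral_mono) auto
  finally show ?thesis
    unfolding attack_cost_eq [OF cost_int] attack_cost_eq [OF cost_int'] by (rule ennreal_leI)
next
  case False
  then show ?thesis by (simp add: less_top [symmetric])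
qed

end

theorem theorem1:
  fixes M :: "'a measure"
    and S :: "('n::finite, 'm::finite, 's::finite, 'p::finite) model"
    and \<rho> :: "'a \<Rightarrow> ('n, 'p) realization"
    and xs :: "real ^ 'n"
    and N :: nat
    and Q :: "nat \<Rightarrow> real ^ 'n ^ 'n"
    and R :: "nat \<Rightarrow> real ^ 'p ^ 'p"
    and \<A> :: "real ^ 'n aug ^ 'n aug"
    and \<B> :: "real ^ 's ^ 'n aug"
    and \<C> :: "real ^ 'n aug ^ ('n + 'p)"
    and \<D> :: "real ^ 's ^ ('n + 'p)"
    and \<M> :: "real ^ 'p ^ ('n + 'p)"
    and \<F> :: "nat \<Rightarrow> real ^ ('n + 'p) ^ ('n + 'p)"
    and \<Q> :: "nat \<Rightarrow> real ^ 'n aug ^ 'n aug"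
    and feedback :: "(nat \<Rightarrow> 'a \<Rightarrow> real ^ 's) \<Rightarrow> bool"
  defines "\<A> \<equiv> aug_A S" and "\<B> \<equiv> aug_B S" and "\<C> \<equiv> aug_C S" and "\<D> \<equiv> aug_D S"
    and "\<M> \<equiv> aug_M" and "\<F> \<equiv> \<lambda>t. aug_F (Q t) (R t)"
  defines "feedback \<equiv> \<lambda>e. \<forall>\<omega>\<in>space M.
      (let \<xi> = aug_state S (\<rho> \<omega>) xs (\<lambda>k. e k \<omega>); \<nu> = att_innov S (\<rho> \<omega>) (\<lambda>k. e k \<omega>) in
        e N \<omega> = - (pinv (transpose \<D> ** \<F> N ** \<D>) *v
                     ((transpose \<D> ** \<F> N) *v (\<C> *v \<xi> N + \<M> *v \<nu> N))) \<and>
        (\<forall>t<N. e t \<omega> =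
          - (matrix_inv (transpose \<D> ** \<F> t ** \<D> + transpose \<B> ** \<Q> (Suc t) ** \<B>) *v
              ((transpose \<D> ** \<F> t ** \<C> + transpose \<B> ** \<Q> (Suc t) ** \<A>) *v \<xi> t
               + (transpose \<D> ** \<F> t ** \<M>) *v \<nu> t))))"
  assumes setting: "attack_setting M S \<rho>"
    and QR: "\<And>t. t \<le> N \<Longrightarrow> posdef (Q t)" "\<And>t. t \<le> N \<Longrightarrow> posdef (R t)"
    and Q_final: "\<Q> N = transpose \<C> ** \<F> N ** \<C>
      - transpose \<C> ** \<F> N ** \<D> ** pinv (transpose \<D> ** \<F> N ** \<D>)
        ** transpose \<D> ** \<F> N ** \<C>"
    and Q_step: "\<And>t. t < N \<Longrightarrow> \<Q> t =
      transpose \<C> ** \<F> t ** \<C> + transpose \<A> ** \<Q> (Suc t) ** \<A>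
      - transpose (transpose \<D> ** \<F> t ** \<C> + transpose \<B> ** \<Q> (Suc t) ** \<A>)
        ** matrix_inv (transpose \<D> ** \<F> t ** \<D> + transpose \<B> ** \<Q> (Suc t) ** \<B>)
        ** (transpose \<D> ** \<F> t ** \<C> + transpose \<B> ** \<Q> (Suc t) ** \<A>)"
  shows "(\<forall>t<N. invertible (transpose \<D> ** \<F> t ** \<D> + transpose \<B> ** \<Q> (Suc t) ** \<B>)) \<and>
    (\<exists>e. feedback e) \<and>
    (\<forall>e. feedback e \<longrightarrow> admissible M S \<rho> N e \<and>
      (\<forall>e'. admissible M S \<rho> N e' \<longrightarrow>
        attack_cost M S \<rho> xs Q R N e \<le> attack_cost M S \<rho> xs Q R N e'))"
proof -
  interpret attack_setting M S \<rho> by (rule setting)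
  \<comment> \<open>Extension by 0 beyond the horizon makes the cost-to-go terms vanish at N, where
    the general stage then reduces to the final formulas.\<close>
  define Qs where "Qs t = (if t \<le> N then \<Q> t else 0)" for t
  define L where "L t = stage_gram \<B> \<D> (\<F> t) (Qs (Suc t))" for t
  define Y where "Y t = stage_mixed \<A> \<B> \<C> \<D> (\<F> t) (Qs (Suc t))" for t
  define G where "G t = (if t = N then pinv (L t) else matrix_inv (L t))" for t
  have F: "posdef (\<F> t)" if "t \<le> N" for t
    unfolding \<F>_def using QR that by (intro posdef_aug_F)
  have F_eq: "aug_F (Q t) (R t) = \<F> t" for t by (simp add: \<F>_def)
  have last: "Qs (Suc N) = 0" by (simp add: Qs_def)
  have L: "L t = transpose \<D> ** \<F> t ** \<D> + transpose \<B> ** \<Q> (Suc t) ** \<B>"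
    and Y: "Y t = transpose \<D> ** \<F> t ** \<C> + transpose \<B> ** \<Q> (Suc t) ** \<A>" if "t < N" for t
    using that by (simp_all add: L_def Y_def stage_gram_def stage_mixed_def Qs_def)
  have LN: "L N = transpose \<D> ** \<F> N ** \<D>" and YN: "Y N = transpose \<D> ** \<F> N ** \<C>"
    by (simp_all add: L_def Y_def stage_gram_def stage_mixed_def last)
  have Q: "Qs t = transpose \<C> ** \<F> t ** \<C> + transpose \<A> ** Qs (Suc t) ** \<A>
      - transpose (Y t) ** G t ** Y t" if t: "t \<le> N" for t
  proof (cases "t = N")
    case True
    \<comment> \<open>Symmetry identifies the transpose of \<open>Y N\<close> with the left factor
      in \<open>Q_final\<close>.\<close>
    have "transpose (\<F> N) = \<F> N" using F by (simp add: posdef_def)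
    then show ?thesis
      unfolding True YN last G_def
      by (simp add: Qs_def Q_final LN matrix_transpose_mul matrix_mul_assoc)
  next
    case False
    then have "t < N" using t by simp
    then show ?thesis using Q_step [of t] by (simp add: Qs_def G_def L Y)
  qed
  note recursion = riccati_recursion [where S = S and F = \<F> and N = N and Qs = Qs, folded \<A>_def \<B>_def \<C>_def \<D>_def \<M>_def,
      folded L_def Y_def, folded G_def, OF attack_injective F last Q]
  have inv: "invertible (transpose \<D> ** \<F> t ** \<D> + transpose \<B> ** \<Q> (Suc t) ** \<B>)" if "t < N" for t
    using recursion(3) [OF _ _ that] that by (simp add: L)
  \<comment> \<open>The two displayed formulas become one law with gain \<open>G\<close>; at N,
    distributing over the sum produces \<open>Y N\<close> and the innovation term.\<close>
  have feedback_iff: "feedback e \<longleftrightarrow> (\<forall>\<omega>\<in>space M. \<forall>t\<le>N. e t \<omega> =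
      - (G t *v (Y t *v aug_state S (\<rho> \<omega>) xs (\<lambda>k. e k \<omega>) t
        + (transpose \<D> ** \<F> t ** \<M>) *v nom_innov S (\<rho> \<omega>) t)))" for e
  proof -
    have all: "(\<forall>t\<le>N. P t) \<longleftrightarrow> P N \<and> (\<forall>t<N. P t)" for P by (auto simp: le_less)
    show ?thesis
      unfolding feedback_def Let_def all att_innov_eq
      by (simp add: G_def L Y LN YN matrix_vector_right_distrib matrix_vector_mul_assoc matrix_mul_assoc)
  qed
  define gx where "gx t = - (G t ** Y t)" for t
  define gn where "gn t = - (G t ** (transpose \<D> ** \<F> t ** \<M>))" for t
  have gains: "- (G t *v (Y t *v x + (transpose \<D> ** \<F> t ** \<M>) *v v)) = gx t *v x + gn t *v v" for t x v
    by (simp add: gx_def gn_def matvec)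
  show ?thesis
  proof (intro conjI allI impI)
    show "invertible (transpose \<D> ** \<F> t ** \<D> + transpose \<B> ** \<Q> (Suc t) ** \<B>)" if "t < N" for t
      using that by (rule inv)
    show "\<exists>e. feedback e"
      using feedback_exists [of gx S \<rho> xs gn] unfolding feedback_iff gains by blast
    fix e assume "feedback e"
    then have e: "e t \<omega> = - (G t *v (Y t *v aug_state S (\<rho> \<omega>) xs (\<lambda>k. e k \<omega>) t
        + (transpose \<D> ** \<F> t ** \<M>) *v nom_innov S (\<rho> \<omega>) t))" if "t \<le> N" "\<omega> \<in> space M" for t \<omega>
      using that unfolding feedback_iff by blast
    show adm: "admissible M S \<rho> N e"
      by (rule feedback_admissible) (rule e [unfolded gains])
    fix e' assume adm': "admissible M S \<rho> N e'"
    show "attack_cost M S \<rho> xs Q R N e \<le> attack_cost M S \<rho> xs Q R N e'"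
      by (rule feedback_optimal [where N = N and Q = Q and R = R and Qs = Qs and G = G,
            folded \<A>_def \<B>_def \<C>_def \<D>_def \<M>_def, unfolded F_eq, folded L_def Y_def,
            OF QR recursion(1) recursion(2) last e adm adm'])
  qed
qed

end
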